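(* Let $X$ be a $d$-dimensional simplicial complex and let $r$ be an integer with $7r+7\le d$. Let $\beta>0$ and assume that for every $-1\le m\le r$ and every $s\in X(m)$ we have $h^1(X_s)\ge\beta$, and that $X$ is a $\lambda$-two-sided local spectral expander for some $\lambda<\frac{1}{2r^2}$. Then $X$ is a $(\beta^{O(r)},r)$-swap coboundary expander, i.e. $h^1(F^rX)\ge \beta^{O(r)}$, where the constant implied by $O(r)$ is absolute.
   Context: Probability conventions: a pure $d$-dimensional complex $X$ carries a distribution on $X(d)$, inducing distributions on $X(k)$ by $\Pr_k(t)=\binom{d+1}{k+1}^{-1}\sum_{s\supseteq t}\Pr_d(s)$ and on ordered faces via a uniformly random ordering. $X(-1)=\{\emptyset\}$ and $X_\emptyset=X$. The link of $s$ is $X_s=\{t\setminus s: t\supseteq s, t\in X\}$ with the conditional distribution on its top faces. $X$ is a $\lambda$-two-sided local spectral expander if for every $s\in X$ of dimension at most $d-2$ (including $s=\emptyset$) the normalized adjacency operator of the weighted underlying graph of $X_s$ has all nontrivial eigenvalues of absolute value at most $\lambda$. Faces complex: $F^rX$ has vertex set $X(r)$ and faces the sets $\{s_0,\dots,s_j\}$ of pairwise disjoint $r$-faces with $s_0\cup\dots\cup s_j\in X$; a top face is sampled by sampling $t\in X(d)$ and uniformly choosing $\lfloor (d+1)/(r+1)\rfloor$ pairwise disjoint $(r+1)$-subsets of $t$. Coboundary expansion: for a group $\Gamma$, $C^0(X,\Gamma)=\{X(0)\to\Gamma\}$, $C^1(X,\Gamma)$ the maps $f$ on ordered edges with $f(u,v)=f(v,u)^{-1}$,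 $\delta_0 g(u,v)=g(u)g(v)^{-1}$, $\delta_1 f(u,v,w)=f(u,v)f(v,w)f(w,u)$. $\mathrm{dist}(f,f')$ = probability over a random ordered edge that they differ; $\mathrm{wt}(\delta_1 f)$ = probability over a random ordered triangle that $\delta_1 f\ne \mathrm{Id}$. $h^1(Y)\ge\beta$ means: for every group $\Gamma$ and $f\in C^1(Y,\Gamma)$ there is $g\in C^0(Y,\Gamma)$ with $\beta\,\mathrm{dist}(f,\delta_0 g)\le\mathrm{wt}(\delta_1 f)$ ($Y$ is a $\beta$-coboundary expander). $X$ is a $(\beta,r)$-swap coboundary expander if $h^1(F^rX)\ge\beta$.
   Formalization: The bound proved is min(β,1/2)^{Kr} with K absolute, since β^{Kr} fails as β tends to 1 (complete complexes, r=1); for β ≤ 1/2 it is β^{Kr}. The case r=0, where 1/(2r²) is undefined, is excluded (r ≥ 1). *)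

theory Defs
  imports "HOL-Probability.Probability" "HOL-Algebra.Generated_Groups"
begin

section \<open>Weighted simplicial complexes\<close>

text \<open>The index of \<open>faces\<close> is the dimension, so it may be \<open>-1\<close>: a nonempty complex \<open>X\<close> has
  \<open>faces X (-1) = {{}}\<close>.\<close>

definition faces :: "'a set set \<Rightarrow> int \<Rightarrow> 'a set set" where
  "faces X k = {s \<in> X. int (card s) = k + 1}"

text \<open>A pure \<open>d\<close>-dimensional finite complex \<open>X\<close> with a fully supported distribution on \<open>X(d)\<close>.\<close>

definition weighted_complex :: "nat \<Rightarrow> 'a set set \<Rightarrow> 'a set pmf \<Rightarrow> bool" where
  "weighted_complex d X \<mu> \<longleftrightarrow>
     finite X \<and> (\<forall>s\<in>X. finite s) \<and> (\<forall>s\<in>X. \<forall>t. t \<subseteq> s \<longrightarrow> t \<in> X) \<and>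
     (\<forall>s\<in>X. \<exists>t\<in>faces X (int d). s \<subseteq> t) \<and> set_pmf \<mu> = faces X (int d)"

text \<open>The distribution on \<open>X(k)\<close>: sample a top face, then a uniform \<open>(k+1)\<close>-subset of it
  (lemma \<open>pmf_face_pmf\<close> gives the closed formula).\<close>

definition face_pmf :: "nat \<Rightarrow> 'a set pmf \<Rightarrow> 'a set pmf" where
  "face_pmf k \<mu> = bind_pmf \<mu> (\<lambda>s. pmf_of_set {t. t \<subseteq> s \<and> card t = k + 1})"

definition ordered_face_pmf :: "nat \<Rightarrow> 'a set pmf \<Rightarrow> 'a list pmf" where
  "ordered_face_pmf k \<mu> =
     bind_pmf (face_pmf k \<mu>) (\<lambda>t. pmf_of_set {xs. distinct xs \<and> set xs = t})"

definition link_faces :: "'a set set \<Rightarrow> 'a set \<Rightarrow> 'a set set" where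
  "link_faces X s = {t - s | t. t \<in> X \<and> s \<subseteq> t}"

definition link_pmf :: "'a set pmf \<Rightarrow> 'a set \<Rightarrow> 'a set pmf" where
  "link_pmf \<mu> s = map_pmf (\<lambda>t. t - s) (cond_pmf \<mu> {t. s \<subseteq> t})"


section \<open>Local spectral expansion\<close>

text \<open>Matrix entries of the normalized adjacency operator: the probability that a random ordered
  edge is \<open>(u, v)\<close>, conditioned on its first vertex being \<open>u\<close>.\<close>

definition adj :: "'a set pmf \<Rightarrow> 'a \<Rightarrow> 'a \<Rightarrow> real" where
  "adj \<mu> u v = pmf (ordered_face_pmf 1 \<mu>) [u, v] / pmf (ordered_face_pmf 0 \<mu>) [u]"

text \<open>The trivial eigenvalue is a single copy of \<open>1\<close>, with the constants as eigenfunctions.  So an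
  eigenvalue is nontrivial iff it has a non-constant eigenfunction; in particular \<open>1\<close> is
  nontrivial iff its multiplicity is at least \<open>2\<close>.  The operator is self-adjoint, hence real
  eigenvalues suffice.\<close>

definition nontrivial_eigenvalue :: "'a set set \<Rightarrow> 'a set pmf \<Rightarrow> real \<Rightarrow> bool" where
  "nontrivial_eigenvalue X \<mu> \<theta> \<longleftrightarrow>
     (\<exists>g :: 'a \<Rightarrow> real.
        (\<forall>u\<in>{v. {v} \<in> X}. (\<Sum>v\<in>{v. {v} \<in> X}. adj \<mu> u v * g v) = \<theta> * g u) \<and>
        (\<exists>u v. {u} \<in> X \<and> {v} \<in> X \<and> g u \<noteq> g v))"

definition two_sided_local_spectral_expander ::
    "nat \<Rightarrow> 'a set set \<Rightarrow> 'a set pmf \<Rightarrow> real \<Rightarrow> bool" where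
  "two_sided_local_spectral_expander d X \<mu> lam \<longleftrightarrow>
     (\<forall>m\<in>{-1..int d - 2}. \<forall>s\<in>faces X m. \<forall>\<theta>.
        nontrivial_eigenvalue (link_faces X s) (link_pmf \<mu> s) \<theta> \<longrightarrow> \<bar>\<theta>\<bar> \<le> lam)"


section \<open>Coboundary expansion\<close>

definition cochains0 :: "'a set set \<Rightarrow> ('g, 'm) monoid_scheme \<Rightarrow> ('a \<Rightarrow> 'g) set" where
  "cochains0 X G = {g. \<forall>v. {v} \<in> X \<longrightarrow> g v \<in> carrier G}"

definition cochains1 :: "'a set set \<Rightarrow> ('g, 'm) monoid_scheme \<Rightarrow> ('a \<Rightarrow> 'a \<Rightarrow> 'g) set" where
  "cochains1 X G = {f. \<forall>u v. u \<noteq> v \<and> {u, v} \<in> X \<longrightarrow>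
                          f u v \<in> carrier G \<and> f u v = m_inv G (f v u)}"

definition coboundary0 :: "('g, 'm) monoid_scheme \<Rightarrow> ('a \<Rightarrow> 'g) \<Rightarrow> 'a \<Rightarrow> 'a \<Rightarrow> 'g" where
  "coboundary0 G g u v = g u \<otimes>\<^bsub>G\<^esub> m_inv G (g v)"

definition coboundary1 ::
    "('g, 'm) monoid_scheme \<Rightarrow> ('a \<Rightarrow> 'a \<Rightarrow> 'g) \<Rightarrow> 'a \<Rightarrow> 'a \<Rightarrow> 'a \<Rightarrow> 'g" where
  "coboundary1 G f u v w = f u v \<otimes>\<^bsub>G\<^esub> f v w \<otimes>\<^bsub>G\<^esub> f w u"

definition cochain_dist ::
    "'a set pmf \<Rightarrow> ('a \<Rightarrow> 'a \<Rightarrow> 'g) \<Rightarrow> ('a \<Rightarrow> 'a \<Rightarrow> 'g) \<Rightarrow> real" where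
  "cochain_dist \<mu> f f' =
     measure_pmf.prob (ordered_face_pmf 1 \<mu>) {[u, v] | u v. f u v \<noteq> f' u v}"

definition coboundary1_weight ::
    "'a set pmf \<Rightarrow> ('g, 'm) monoid_scheme \<Rightarrow> ('a \<Rightarrow> 'a \<Rightarrow> 'g) \<Rightarrow> real" where
  "coboundary1_weight \<mu> G f =
     measure_pmf.prob (ordered_face_pmf 2 \<mu>) {[u, v, w] | u v w. coboundary1 G f u v w \<noteq> \<one>\<^bsub>G\<^esub>}"

definition coboundary_expander_over ::
    "('g, 'm) monoid_scheme \<Rightarrow> 'a set set \<Rightarrow> 'a set pmf \<Rightarrow> real \<Rightarrow> bool" where
  "coboundary_expander_over G X \<mu> \<beta> \<longleftrightarrow>
     (\<forall>f\<in>cochains1 X G. \<exists>g\<in>cochains0 X G.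
        \<beta> * cochain_dist \<mu> f (coboundary0 G g) \<le> coboundary1_weight \<mu> G f)"

text \<open>\<open>h\<^sup>1(X) \<ge> \<beta>\<close>.  HOL cannot quantify over all types inside a definition, so the groups range
  over those with carrier in \<open>nat\<close>, i.e. over all countable groups up to isomorphism.  A cochain on
  a finite complex takes values in a countable subgroup, so this covers groups over every
  type (lemma \<open>coboundary_expander_all_groups\<close>).\<close>

definition coboundary_expander :: "'a set set \<Rightarrow> 'a set pmf \<Rightarrow> real \<Rightarrow> bool" where
  "coboundary_expander X \<mu> \<beta> \<longleftrightarrow>
     (\<forall>G :: nat monoid. group G \<longrightarrow> coboundary_expander_over G X \<mu> \<beta>)"


section \<open>The faces complex\<close>

definition faces_complex :: "nat \<Rightarrow> 'a set set \<Rightarrow> 'a set set set" where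
  "faces_complex r X = {S. S \<subseteq> faces X (int r) \<and> disjoint S \<and> \<Union>S \<in> X}"

definition faces_complex_pmf :: "nat \<Rightarrow> nat \<Rightarrow> 'a set pmf \<Rightarrow> 'a set set pmf" where
  "faces_complex_pmf d r \<mu> =
     bind_pmf \<mu> (\<lambda>t. pmf_of_set {S. (\<forall>s\<in>S. s \<subseteq> t \<and> card s = r + 1) \<and> disjoint S \<and>
                                    card S = (d + 1) div (r + 1)})"

definition swap_coboundary_expander ::
    "nat \<Rightarrow> nat \<Rightarrow> 'a set set \<Rightarrow> 'a set pmf \<Rightarrow> real \<Rightarrow> bool" where
  "swap_coboundary_expander r d X \<mu> \<beta> \<longleftrightarrow>
     coboundary_expander (faces_complex r X) (faces_complex_pmf d r \<mu>) \<beta>"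


section \<open>Consistency of the definitions\<close>

lemma link_faces_empty: "link_faces X {} = X"
  by (simp add: link_faces_def)

lemma link_pmf_empty: "link_pmf \<mu> {} = \<mu>"
proof -
  have "cond_pmf \<mu> UNIV = \<mu>"
    by (rule pmf_eqI) (subst pmf_cond, auto simp: set_pmf_not_empty)
  then show ?thesis
    by (simp add: link_pmf_def)
qed

lemma top_face:
  assumes "weighted_complex d X \<mu>" "s \<in> set_pmf \<mu>"
  shows "s \<in> X" "finite s" "card s = d + 1"
  using assms by (auto simp: weighted_complex_def faces_def)

lemma subfaces_nonempty:
  assumes "weighted_complex d X \<mu>" "s \<in> set_pmf \<mu>" "k \<le> d"
  shows "finite {t. t \<subseteq> s \<and> card t = k + 1}" "{t. t \<subseteq> s \<and> card t = k + 1} \<noteq> {}"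
proof -
  note s = top_face[OF assms(1,2)]
  show "finite {t. t \<subseteq> s \<and> card t = k + 1}"
    using s(2) by simp
  show "{t. t \<subseteq> s \<and> card t = k + 1} \<noteq> {}"
    using obtain_subset_with_card_n[of "k + 1" s] s assms(3) by auto
qed

lemma pmf_face_pmf:
  assumes "weighted_complex d X \<mu>" "k \<le> d" "t \<in> faces X (int k)"
  shows "pmf (face_pmf k \<mu>) t =
           (\<Sum>s | s \<in> faces X (int d) \<and> t \<subseteq> s. pmf \<mu> s) / real ((d + 1) choose (k + 1))"
proof -
  have fin: "finite (faces X (int d))" and set: "set_pmf \<mu> = faces X (int d)"
    using assms(1) by (auto simp: weighted_complex_def faces_def)
  have ct: "card t = k + 1"
    using assms(3) by (auto simp: faces_def)
  have *: "pmf (pmf_of_set {t. t \<subseteq> s \<and> card t = k + 1}) t =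
          (if t \<subseteq> s then 1 / real ((d + 1) choose (k + 1)) else 0)" if "s \<in> set_pmf \<mu>" for s
    using subfaces_nonempty[OF assms(1) that assms(2)] top_face[OF assms(1) that] ct
      n_subsets[of s "k + 1"]
    by (subst pmf_of_set) (auto simp: indicator_def)
  have "pmf (face_pmf k \<mu>) t =
        (\<Sum>s\<in>faces X (int d). pmf (pmf_of_set {t. t \<subseteq> s \<and> card t = k + 1}) t * pmf \<mu> s)"
    unfolding face_pmf_def pmf_bind
    by (rule integral_measure_pmf_real) (use fin set in auto)
  also have "\<dots> = (\<Sum>s\<in>faces X (int d).
        (if t \<subseteq> s then pmf \<mu> s / real ((d + 1) choose (k + 1)) else 0))"
    by (rule sum.cong) (use * set in auto)
  also have "\<dots> = (\<Sum>s | s \<in> faces X (int d) \<and> t \<subseteq> s. pmf \<mu> s / real ((d + 1) choose (k + 1)))"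
    using fin by (rule sum.inter_filter[symmetric])
  finally show ?thesis
    by (simp add: sum_divide_distrib)
qed

lemma set_ordered_face_pmf:
  assumes "weighted_complex d X \<mu>" "k \<le> d" "xs \<in> set_pmf (ordered_face_pmf k \<mu>)"
  shows "distinct xs" "length xs = k + 1" "set xs \<in> X"
proof -
  obtain t where t: "t \<in> set_pmf (face_pmf k \<mu>)"
      "xs \<in> set_pmf (pmf_of_set {xs. distinct xs \<and> set xs = t})"
    using assms(3) by (auto simp: ordered_face_pmf_def)
  obtain s where s: "s \<in> set_pmf \<mu>" "t \<in> set_pmf (pmf_of_set {t. t \<subseteq> s \<and> card t = k + 1})"
    using t(1) by (auto simp: face_pmf_def)
  have ts: "t \<subseteq> s" "card t = k + 1"
    using s subfaces_nonempty[OF assms(1) s(1) assms(2)] by auto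
  have "t \<in> X"
    using ts top_face[OF assms(1) s(1)] assms(1) by (auto simp: weighted_complex_def)
  have "finite t"
    using ts top_face[OF assms(1) s(1)] finite_subset by auto
  then have "finite {xs. distinct xs \<and> set xs = t}" "{xs. distinct xs \<and> set xs = t} \<noteq> {}"
    using finite_distinct_list[of t]
    by (auto intro: finite_subset[OF _ finite_subset_distinct[of t]])
  then have "distinct xs \<and> set xs = t"
    using t(2) by auto
  with ts \<open>t \<in> X\<close> show "distinct xs" "length xs = k + 1" "set xs \<in> X"
    using distinct_card by fastforce+
qed

lemma countable_generate:
  assumes "group G" "countable S" "S \<subseteq> carrier G"
  shows "countable (generate G S)"
proof -
  interpret group G by fact
  let ?L = "lists (S \<union> m_inv G ` S)"
  let ?h = "\<lambda>xs. foldr (\<lambda>x y. x \<otimes>\<^bsub>G\<^esub> y) xs \<one>\<^bsub>G\<^esub>"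
  have car: "S \<union> m_inv G ` S \<subseteq> carrier G"
    using assms by auto
  have cl: "?h xs \<in> carrier G" if "xs \<in> ?L" for xs
    using that car by (induction xs) auto
  have app: "?h xs \<otimes>\<^bsub>G\<^esub> ?h ys = ?h (xs @ ys)" if xs: "xs \<in> ?L" and ys: "ys \<in> ?L" for xs ys
    using xs
  proof (induction xs)
    case Nil
    then show ?case using cl[OF ys] by simp
  next
    case (Cons a xs)
    then have "a \<in> carrier G" "?h xs \<in> carrier G"
      using cl car by blast+
    then show ?case
      using Cons cl[OF ys] by (simp add: m_assoc)
  qed
  have "x \<in> ?h ` ?L" if "x \<in> generate G S" for x
    using that
  proof (induction rule: generate.induct)
    case one
    then show ?case by (auto intro!: image_eqI[of _ _ "[]"])
  next
    case (incl h)
    then show ?case using assms by (auto intro!: image_eqI[of _ _ "[h]"])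
  next
    case (inv h)
    then show ?case using assms by (auto intro!: image_eqI[of _ _ "[m_inv G h]"])
  next
    case (eng h1 h2)
    then obtain xs ys where xy: "xs \<in> ?L" "h1 = ?h xs" "ys \<in> ?L" "h2 = ?h ys"
      by blast
    with app have "h1 \<otimes>\<^bsub>G\<^esub> h2 = ?h (xs @ ys)" by simp
    moreover have "xs @ ys \<in> ?L" using xy by auto
    ultimately show ?case by blast
  qed
  then have "generate G S \<subseteq> ?h ` ?L" by blast
  then show ?thesis
    using assms(2) by (meson countable_Un countable_image countable_lists countable_subset)
qed

theorem coboundary_expander_all_groups:
  fixes G :: "'g monoid"
  assumes W: "weighted_complex d X \<mu>" "2 \<le> d" and ce: "coboundary_expander X \<mu> \<beta>"
    and G: "group G"
  shows "coboundary_expander_over G X \<mu> \<beta>"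
  unfolding coboundary_expander_over_def
proof
  fix f assume f: "f \<in> cochains1 X G"
  interpret group G by fact
  define S where "S = {f u v | u v. u \<noteq> v \<and> {u, v} \<in> X}"
  define H where "H = generate G S"
  define \<phi> where "\<phi> = to_nat_on H"
  have SG: "S \<subseteq> carrier G"
    using f by (auto simp: S_def cochains1_def)
  have "S \<subseteq> (\<lambda>(u, v). f u v) ` (\<Union>X \<times> \<Union>X)"
    by (auto simp: S_def)
  moreover have "finite (\<Union>X)"
    using W by (auto simp: weighted_complex_def)
  ultimately have "finite S"
    by (meson finite_SigmaI finite_imageI finite_subset)
  then have cH: "countable H"
    using countable_generate[OF G _ SG] by (simp add: H_def countable_finite)
  have subH: "subgroup H G"
    using generate_is_subgroup[OF SG] by (simp add: H_def)
  have inj: "inj_on \<phi> H"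
    unfolding \<phi>_def by (rule inj_on_to_nat_on[OF cH])
  define GH where "GH = G\<lparr>carrier := H\<rparr>"
  have grpGH: "group GH"
    unfolding GH_def using subH by (rule subgroup.subgroup_is_group) (rule G)
  interpret GH: group GH by (rule grpGH)
  define \<psi> where "\<psi> = inv_into H \<phi>"
  have \<psi>\<phi>: "\<psi> (\<phi> x) = x" if "x \<in> H" for x
    using inj that by (simp add: \<psi>_def)
  define N :: "nat monoid" where
    "N = \<lparr>carrier = \<phi> ` H, mult = (\<lambda>x y. \<phi> (\<psi> x \<otimes>\<^bsub>G\<^esub> \<psi> y)), one = \<phi> \<one>\<^bsub>G\<^esub>\<rparr>"
  have Hc: "x \<otimes>\<^bsub>G\<^esub> y \<in> H" "\<one>\<^bsub>G\<^esub> \<in> H" "m_inv G x \<in> H" "x \<in> carrier G"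
    if "x \<in> H" "y \<in> H" for x y
    using subH that
    by (auto simp: subgroup.m_closed subgroup.one_closed subgroup.m_inv_closed
      intro: subgroup.mem_carrier)
  have oneH: "\<one>\<^bsub>G\<^esub> \<in> H"
    using subH by (rule subgroup.one_closed)
  have grpN: "group N"
  proof (rule groupI)
    show "x \<otimes>\<^bsub>N\<^esub> y \<in> carrier N" if "x \<in> carrier N" "y \<in> carrier N" for x y
      using that Hc by (auto simp: N_def \<psi>\<phi>)
    show "\<one>\<^bsub>N\<^esub> \<in> carrier N"
      using oneH by (auto simp: N_def)
    show "x \<otimes>\<^bsub>N\<^esub> y \<otimes>\<^bsub>N\<^esub> z = x \<otimes>\<^bsub>N\<^esub> (y \<otimes>\<^bsub>N\<^esub> z)"
      if "x \<in> carrier N" "y \<in> carrier N" "z \<in> carrier N" for x y z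
      using that Hc by (auto simp: N_def \<psi>\<phi> m_assoc)
    show "\<one>\<^bsub>N\<^esub> \<otimes>\<^bsub>N\<^esub> x = x" if "x \<in> carrier N" for x
      using that Hc oneH by (auto simp: N_def \<psi>\<phi>)
    show "\<exists>y\<in>carrier N. y \<otimes>\<^bsub>N\<^esub> x = \<one>\<^bsub>N\<^esub>" if x: "x \<in> carrier N" for x
    proof -
      obtain h where h: "h \<in> H" "x = \<phi> h" using x by (auto simp: N_def)
      then show ?thesis
        using Hc[OF h(1) h(1)] by (intro bexI[of _ "\<phi> (m_inv G h)"]) (auto simp: N_def \<psi>\<phi> l_inv)
    qed
  qed
  interpret N: group N by (rule grpN)
  have Nmult: "\<phi> x \<otimes>\<^bsub>N\<^esub> \<phi> y = \<phi> (x \<otimes>\<^bsub>G\<^esub> y)" if "x \<in> H" "y \<in> H" for x y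
    using that by (simp add: N_def \<psi>\<phi>)
  have Ncar: "\<phi> x \<in> carrier N" if "x \<in> H" for x
    using that by (simp add: N_def)
  have None: "\<one>\<^bsub>N\<^esub> = \<phi> \<one>\<^bsub>G\<^esub>"
    by (simp add: N_def)
  have Ninv: "m_inv N (\<phi> x) = \<phi> (m_inv G x)" if "x \<in> H" for x
  proof (rule N.inv_equality)
    show "\<phi> (m_inv G x) \<otimes>\<^bsub>N\<^esub> \<phi> x = \<one>\<^bsub>N\<^esub>"
      using that Hc[OF that that] by (simp add: Nmult None l_inv)
  qed (use that Hc[OF that that] Ncar in auto)
  have fH: "f u v \<in> H" if "u \<noteq> v" "{u, v} \<in> X" for u v
    using that by (auto simp: H_def S_def intro!: generate.incl)
  have finv: "f u v = m_inv G (f v u)" if "u \<noteq> v" "{u, v} \<in> X" for u v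
    using f that by (auto simp: cochains1_def)
  define f' where "f' = (\<lambda>u v. \<phi> (f u v))"
  have f'N: "f' \<in> cochains1 X N"
    unfolding cochains1_def
  proof (intro CollectI allI impI conjI)
    fix u v assume uv: "u \<noteq> v \<and> {u, v} \<in> X"
    then have uv': "v \<noteq> u" "{v, u} \<in> X" by (auto simp: insert_commute)
    show "f' u v \<in> carrier N"
      using uv by (simp add: f'_def fH Ncar)
    show "f' u v = m_inv N (f' v u)"
      using uv finv[of u v] Ninv[OF fH[OF uv']] by (simp add: f'_def)
  qed
  obtain g' where g': "g' \<in> cochains0 X N"
      "\<beta> * cochain_dist \<mu> f' (coboundary0 N g') \<le> coboundary1_weight \<mu> N f'"
    using ce grpN f'N unfolding coboundary_expander_def coboundary_expander_over_def by blast
  define g where "g = (\<lambda>v. \<psi> (g' v))"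
  have gH: "g v \<in> H" "g' v = \<phi> (g v)" if v: "{v} \<in> X" for v
  proof -
    obtain h where h: "h \<in> H" "g' v = \<phi> h"
      using g'(1) v by (auto simp: cochains0_def N_def)
    then show "g v \<in> H" "g' v = \<phi> (g v)"
      by (auto simp: g_def \<psi>\<phi>)
  qed
  have sub: "t \<in> X" if "s \<in> X" "t \<subseteq> s" for s t
    using W that by (auto simp: weighted_complex_def)
  have eq1: "cochain_dist \<mu> f' (coboundary0 N g') = cochain_dist \<mu> f (coboundary0 G g)"
    unfolding cochain_dist_def
  proof (rule measure_eq_AE)
    show "AE xs in ordered_face_pmf 1 \<mu>.
        xs \<in> {[u, v] | u v. f' u v \<noteq> coboundary0 N g' u v} \<longleftrightarrow>
        xs \<in> {[u, v] | u v. f u v \<noteq> coboundary0 G g u v}"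
    proof (rule AE_pmfI)
      fix xs assume xs: "xs \<in> set_pmf (ordered_face_pmf 1 \<mu>)"
      have *: "distinct xs" "length xs = 2" "set xs \<in> X"
        using set_ordered_face_pmf[OF W(1) _ xs] W(2) by auto
      then obtain u v where uv: "xs = [u, v]"
        by (auto simp: numeral_2_eq_2 length_Suc_conv)
      have e: "u \<noteq> v" "{u, v} \<in> X" "{u} \<in> X" "{v} \<in> X"
        using * uv sub[of "{u, v}"] by auto
      have "m_inv G (g v) \<in> H"
        using Hc(3) gH(1)[OF e(4)] by blast
      then have "g u \<otimes>\<^bsub>G\<^esub> m_inv G (g v) \<in> H"
        using Hc(1) gH(1)[OF e(3)] by blast
      moreover have "coboundary0 N g' u v = \<phi> (g u \<otimes>\<^bsub>G\<^esub> m_inv G (g v))"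
        using gH[OF e(3)] gH[OF e(4)] \<open>m_inv G (g v) \<in> H\<close>
        by (simp add: coboundary0_def Ninv Nmult)
      ultimately show "xs \<in> {[u, v] | u v. f' u v \<noteq> coboundary0 N g' u v} \<longleftrightarrow>
        xs \<in> {[u, v] | u v. f u v \<noteq> coboundary0 G g u v}"
        using uv fH[OF e(1,2)] inj by (auto simp: f'_def coboundary0_def inj_on_eq_iff)
    qed
  qed auto
  have eq2: "coboundary1_weight \<mu> N f' = coboundary1_weight \<mu> G f"
    unfolding coboundary1_weight_def
  proof (rule measure_eq_AE)
    show "AE xs in ordered_face_pmf 2 \<mu>.
        xs \<in> {[u, v, w] | u v w. coboundary1 N f' u v w \<noteq> \<one>\<^bsub>N\<^esub>} \<longleftrightarrow>
        xs \<in> {[u, v, w] | u v w. coboundary1 G f u v w \<noteq> \<one>\<^bsub>G\<^esub>}"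
    proof (rule AE_pmfI)
      fix xs assume xs: "xs \<in> set_pmf (ordered_face_pmf 2 \<mu>)"
      have *: "distinct xs" "length xs = 3" "set xs \<in> X"
        using set_ordered_face_pmf[OF W(1) _ xs] W(2) by auto
      then obtain u v w where uvw: "xs = [u, v, w]"
        by (auto simp: numeral_3_eq_3 length_Suc_conv)
      have X3: "{u, v, w} \<in> X"
        using * uvw by auto
      have h: "f u v \<in> H" "f v w \<in> H" "f w u \<in> H"
        using * uvw by (auto intro!: fH sub[OF X3])
      have h1: "f u v \<otimes>\<^bsub>G\<^esub> f v w \<in> H"
        using Hc(1)[OF h(1,2)] .
      have h2: "f u v \<otimes>\<^bsub>G\<^esub> f v w \<otimes>\<^bsub>G\<^esub> f w u \<in> H"
        using Hc(1)[OF h1 h(3)] .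
      have "coboundary1 N f' u v w = \<phi> (f u v \<otimes>\<^bsub>G\<^esub> f v w \<otimes>\<^bsub>G\<^esub> f w u)"
        using h h1 by (simp add: coboundary1_def f'_def Nmult)
      then show "xs \<in> {[u, v, w] | u v w. coboundary1 N f' u v w \<noteq> \<one>\<^bsub>N\<^esub>} \<longleftrightarrow>
        xs \<in> {[u, v, w] | u v w. coboundary1 G f u v w \<noteq> \<one>\<^bsub>G\<^esub>}"
        using uvw h2 oneH inj by (auto simp: None coboundary1_def inj_on_eq_iff)
    qed
  qed auto
  have "g \<in> cochains0 X G"
    using gH(1) subgroup.mem_carrier[OF subH] by (simp add: cochains0_def)
  then show "\<exists>g\<in>cochains0 X G. \<beta> * cochain_dist \<mu> f (coboundary0 G g) \<le> coboundary1_weight \<mu> G f"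
    using g'(2) eq1 eq2 by auto
qed

end

theory Submission
  imports Defs
begin

text \<open>All distributions in the problem are images of a uniformly random labelling of a random top face
  by \<open>0, \<dots>, d\<close>, which is exchangeable, so that error probabilities can be added up on one space.
  In links of faces of dimension at most \<open>d - 2\<close> the spectral gap makes a function that mostly agrees
  along edges mostly constant.

  Let \<open>f\<close> be a 1-cochain of the faces complex with few inconsistent triangles.  First, \<open>f\<close> is extended
  to pairs of \<open>r\<close>-faces that differ in one vertex (edges of the Johnson graph).  There the size of the
  faces is decreased one vertex at a time, each time using coboundary expansion of the links and losing
  a factor \<open>O(1/\<beta>)\<close>; losses from the extension and from the return to disjoint faces are \<open>exp(O(r))\<close>
  and occur only once.\<close>

subsection \<open>Spectral gap and plurality\<close>


text \<open>Disjoint faces share no vertex, so they are not neighbouring vertices of the link of a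
  common subface, and the hypothesis on links does not apply to them directly. This is what forces
  the passage to faces that differ in one vertex. The second constraint is the budget. A loss
  exponential in \<open>r\<close> is affordable a bounded number of times, but not in each of about
  \<open>r\<close> descent steps. Hence a descent step varies single vertices only (plurality factor
  7), while whole faces are varied twice (factor \<open>7 ^ (r + 1)\<close> each). With 513 /
  \<beta> per step and a prefactor of 49 this gives \<open>(1231713 / \<beta>) ^ (r + 1)\<close>,
  where 1231713 = 49 * 49 * 513. Values in a nonabelian group cannot be averaged. So every step
  takes a most likely value and pays by a union bound over boundedly many events, which is where the
  numerical constants come from.\<close>

lemma linear_term_zero_if_quadratic_nonneg:
  fixes b c :: real
  assumes "\<And>t. 0 \<le> 2 * t * b + t\<^sup>2 * c"
  shows "b = 0"
proof (rule ccontr)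
  assume b: "b \<noteq> 0"
  \<comment> \<open>The parabola is tested at \<open>t = - b / k\<close>; any positive
    \<open>k\<close> above \<open>c\<close> makes its value negative there, whatever the sign of
    \<open>c\<close>.\<close>
  define k where "k = \<bar>c\<bar> + 1"
  have k: "k > 0" "c < k" by (auto simp: k_def)
  have "2 * (- b / k) * b + (- b / k)\<^sup>2 * c = (b\<^sup>2 / k) * (c / k - 2)"
    using k by (simp add: field_simps power2_eq_square)
  moreover have "b\<^sup>2 / k > 0" using b k by simp
  moreover have "c / k - 2 < 0" using k by (simp add: field_simps)
  ultimately have "2 * (- b / k) * b + (- b / k)\<^sup>2 * c < 0"
    by (simp only: mult_pos_neg)
  with assms[of "- b / k"] show False by simp
qed

text \<open>The Rayleigh quotient is minimised over functions on all of \<open>'a\<close>, which may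
  be infinite. Pinning the values to 0 outside \<open>V\<close> leaves a product of compact
  intervals, and Tychonoff's theorem applies.\<close>

lemma compact_box_finite_support:
  fixes M :: "'a \<Rightarrow> real"
  shows "compact {g :: 'a \<Rightarrow> real. \<forall>i. g i \<in> (if i \<in> V then {- M i..M i} else {0})}"
proof -
  have "compactin (product_topology (\<lambda>i. euclideanreal) UNIV)
      (PiE UNIV (\<lambda>i. if i \<in> V then {- M i..M i} else {0}))"
    by (simp add: compactin_PiE)
  moreover have "PiE UNIV (\<lambda>i. if i \<in> V then {- M i..M i} else {0}) =
      {g :: 'a \<Rightarrow> real. \<forall>i. g i \<in> (if i \<in> V then {- M i..M i} else {0})}"
    by (auto simp: PiE_def Pi_def extensional_def)
  ultimately show ?thesis
    by (simp add: euclidean_product_topology)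
qed

text \<open>A minimiser of the Rayleigh quotient exists by compactness and is an eigenfunction by the
  first-order condition.\<close>

lemma poincare_from_eigenvalues:
  fixes w :: "'a \<Rightarrow> 'a \<Rightarrow> real" and w1 g :: "'a \<Rightarrow> real"
  assumes fin: "finite V"
    and sym: "\<And>u v. w u v = w v u"
    and nonneg: "\<And>u v. 0 \<le> w u v"
    and w1: "\<And>u. u \<in> V \<Longrightarrow> w1 u = (\<Sum>v\<in>V. w u v)"
    and pos: "\<And>u. u \<in> V \<Longrightarrow> 0 < w1 u"
    and eig: "\<And>\<theta> g. (\<forall>u\<in>V. (\<Sum>v\<in>V. w u v * g v) = \<theta> * (w1 u * g u)) \<Longrightarrow>
        \<exists>u\<in>V. \<exists>v\<in>V. g u \<noteq> g v \<Longrightarrow> \<theta> \<le> 1 / 2"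
    and mean: "(\<Sum>u\<in>V. w1 u * g u) = 0"
  shows "(\<Sum>u\<in>V. w1 u * (g u)\<^sup>2) \<le> (\<Sum>u\<in>V. \<Sum>v\<in>V. w u v * (g u - g v)\<^sup>2)"
proof -
  \<comment> \<open>The Dirichlet form over ordered pairs: \<open>B g g\<close> is twice the
    difference of \<open>I g g\<close> and the quadratic form of \<open>w\<close>. So eigenvalues at
    most 1/2 are exactly what makes \<open>B\<close> dominate \<open>I\<close> with constant
    1.\<close>
  define B where "B g h = (\<Sum>u\<in>V. \<Sum>v\<in>V. w u v * ((g u - g v) * (h u - h v)))"
    for g h :: "'a \<Rightarrow> real"
  define I where "I g h = (\<Sum>u\<in>V. w1 u * (g u * h u))" for g h :: "'a \<Rightarrow> real"
  define m where "m g = (\<Sum>u\<in>V. w1 u * g u)" for g :: "'a \<Rightarrow> real"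
  define z where "z g = (\<lambda>u. if u \<in> V then g u else 0)" for g :: "'a \<Rightarrow> real"
  have B0: "0 \<le> B g g" for g
    unfolding B_def by (intro sum_nonneg mult_nonneg_nonneg[OF nonneg] zero_le_square)
  have I0: "0 \<le> I g g" for g
    unfolding I_def by (intro sum_nonneg mult_nonneg_nonneg[OF less_imp_le[OF pos] zero_le_square])
  have z: "B (z g) (z h) = B g h" "I (z g) (z h) = I g h" "m (z g) = m g" for g h
    by (auto simp: B_def I_def m_def z_def)
  have Bsc: "B (\<lambda>u. c * g u) (\<lambda>u. c * g u) = c\<^sup>2 * B g g"
      "I (\<lambda>u. c * g u) (\<lambda>u. c * g u) = c\<^sup>2 * I g g"
      "m (\<lambda>u. c * g u) = c * m g" for c g
    unfolding B_def I_def m_def sum_distrib_left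
    by (rule sum.cong[OF refl], rule sum.cong[OF refl], simp add: power2_eq_square algebra_simps)
       (rule sum.cong[OF refl], simp add: power2_eq_square algebra_simps)+
  have Bsym: "B g h = B h g" "I g h = I h g" for g h
    by (simp_all add: B_def I_def mult.commute)
  have Badd: "B (\<lambda>u. g u + t * h u) (\<lambda>u. g u + t * h u) = B g g + 2 * t * B g h + t\<^sup>2 * B h h"
       "I (\<lambda>u. g u + t * h u) (\<lambda>u. g u + t * h u) = I g g + 2 * t * I g h + t\<^sup>2 * I h h" for g h t
    by (simp_all add: B_def I_def sum_distrib_left sum.distrib[symmetric] power2_eq_square
        algebra_simps)
  have madd: "m (\<lambda>u. g u + t * h u) = m g + t * m h" for g h t
    by (simp add: m_def sum.distrib sum_distrib_left algebra_simps)
  \<comment> \<open>\<open>I g g = 1\<close> forces \<open>(g i)\<^sup>2 \<le> 1 / w1 i\<close>. The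
    box uses the cruder bound \<open>1 + 1 / w1 i\<close>, which avoids a square root.\<close>
  define S where "S = {g. (\<forall>i. g i \<in> (if i \<in> V then {- (1 + 1 / w1 i)..1 + 1 / w1 i} else {0}))}
      \<inter> {g. I g g = 1 \<and> m g = 0}"
  have inS: "z g \<in> S" if "I g g = 1" "m g = 0" for g
  proof -
    have "- (1 + 1 / w1 i) \<le> g i \<and> g i \<le> 1 + 1 / w1 i" if i: "i \<in> V" for i
    proof -
      have "w1 i * (g i * g i) \<le> I g g"
        unfolding I_def using i fin
        by (intro member_le_sum mult_nonneg_nonneg[OF less_imp_le[OF pos] zero_le_square]) auto
      then have "(g i)\<^sup>2 \<le> 1 / w1 i"
        using \<open>I g g = 1\<close> pos[OF i] by (simp add: field_simps power2_eq_square)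
      also have "\<dots> \<le> (1 + 1 / w1 i)\<^sup>2"
      proof -
        have "c \<le> (1 + c)\<^sup>2" if "0 \<le> c" for c :: real
          using that by (simp add: power2_eq_square algebra_simps)
        from this[of "1 / w1 i"] show ?thesis using pos[OF i] by simp
      qed
      finally have "\<bar>g i\<bar> \<le> \<bar>1 + 1 / w1 i\<bar>"
        by (simp add: abs_le_square_iff)
      then show ?thesis using pos[OF i] by (simp add: abs_le_iff)
    qed
    then show ?thesis
      using that z(2)[of g g] z(3)[of g] unfolding S_def
      by (auto simp: z_def)
  qed
  have cB: "continuous_on UNIV (\<lambda>g. B g g)" "continuous_on UNIV (\<lambda>g. I g g)"
      "continuous_on UNIV m"
    unfolding B_def I_def m_def by (intro continuous_intros continuous_on_product_coordinates)+
  have "closed {g. I g g = 1 \<and> m g = 0}"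
    by (intro closed_Collect_conj closed_Collect_eq cB) (auto intro: continuous_intros)
  then have "compact S"
    unfolding S_def by (intro compact_Int_closed compact_box_finite_support)
  have key: "I g g \<le> B g g" if mg: "m g = 0" for g
  proof (cases "I g g = 0")
    case True
    then show ?thesis using B0 by simp
  next
    case False
    have norm: "I (\<lambda>u. 1 / sqrt (I f f) * f u) (\<lambda>u. 1 / sqrt (I f f) * f u) = 1"
        "m (\<lambda>u. 1 / sqrt (I f f) * f u) = 0" if "I f f \<noteq> 0" "m f = 0" for f
      using that I0[of f] unfolding Bsc by (auto simp: power_divide)
    then have "S \<noteq> {}"
      using inS[OF norm[OF False mg]] by auto
    then obtain g0 where g0: "g0 \<in> S" and min: "\<And>h. h \<in> S \<Longrightarrow> B g0 g0 \<le> B h h"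
      using continuous_attains_inf[OF \<open>compact S\<close> _ continuous_on_subset[OF cB(1)]] by auto
    define \<gamma> where "\<gamma> = B g0 g0"
    have I1: "I g0 g0 = 1" and m1: "m g0 = 0"
      using g0 by (auto simp: S_def)
    have ray: "\<gamma> * I h h \<le> B h h" if mh: "m h = 0" for h
    proof (cases "I h h = 0")
      case False
      have "\<gamma> \<le> B (\<lambda>u. 1 / sqrt (I h h) * h u) (\<lambda>u. 1 / sqrt (I h h) * h u)"
        using min[OF inS[OF norm[OF False mh]]] by (simp add: \<gamma>_def z)
      also have "\<dots> = B h h / I h h"
        using I0[of h] unfolding Bsc by (simp add: power_divide)
      finally show ?thesis
        using I0[of h] False by (simp add: field_simps)
    qed (use B0 in auto)
    have lin0: "B g0 h = \<gamma> * I g0 h" if mh: "m h = 0" for h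
    proof -
      have "0 \<le> 2 * t * (B g0 h - \<gamma> * I g0 h) + t\<^sup>2 * (B h h - \<gamma> * I h h)" for t
        using ray[of "\<lambda>u. g0 u + t * h u"] I1 m1 mh
        unfolding Badd madd by (simp add: \<gamma>_def algebra_simps)
      then have "B g0 h - \<gamma> * I g0 h = 0"
        by (rule linear_term_zero_if_quadratic_nonneg)
      then show ?thesis by simp
    qed
    have "V \<noteq> {}" using I1 by (auto simp: I_def)
    define W where "W = (\<Sum>u\<in>V. w1 u)"
    have W: "W > 0" unfolding W_def using fin \<open>V \<noteq> {}\<close> pos by (intro sum_pos) auto
    \<comment> \<open>Every \<open>h\<close> is a mean-zero function plus a constant;
      \<open>B\<close> ignores the constant, and \<open>I g0\<close> does because
      \<open>m g0 = 0\<close>. So stationarity holds against all \<open>h\<close>, in particular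
      against indicators of points.\<close>
    have lin: "B g0 h = \<gamma> * I g0 h" for h
    proof -
      define c where "c = m h / W"
      have "m (\<lambda>u. h u - c) = m h - c * W"
        by (simp add: m_def W_def sum_subtractf sum_distrib_left algebra_simps)
      then have "m (\<lambda>u. h u - c) = 0" using W by (simp add: c_def)
      from lin0[OF this] have "B g0 (\<lambda>u. h u - c) = \<gamma> * I g0 (\<lambda>u. h u - c)" .
      moreover have "B g0 (\<lambda>u. h u - c) = B g0 h" by (simp add: B_def)
      moreover have "I g0 (\<lambda>u. h u - c) = I g0 h - c * m g0"
        by (simp add: I_def m_def sum_subtractf sum_distrib_left algebra_simps)
      ultimately show ?thesis using m1 by simp
    qed
    \<comment> \<open>Testing against the indicator of \<open>u\<close> gives the eigenvalue
      equation; the eigenvalue is \<open>1 - \<gamma> / 2\<close> because \<open>B\<close> counts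
      each pair in both orders.\<close>
    have "(\<Sum>v\<in>V. w u v * g0 v) = (1 - \<gamma> / 2) * (w1 u * g0 u)" if u: "u \<in> V" for u
    proof -
      let ?e = "\<lambda>v. if v = u then 1 else 0 :: real"
      have "I g0 ?e = (\<Sum>v\<in>V. if v = u then w1 u * g0 u else 0)"
        unfolding I_def by (rule sum.cong[OF refl]) auto
      then have 1: "I g0 ?e = w1 u * g0 u" using u fin by simp
      have "B g0 ?e = (\<Sum>a\<in>V. \<Sum>b\<in>V. (if a = u then w u b * (g0 u - g0 b) else 0) -
          (if b = u then w a u * (g0 a - g0 u) else 0))"
        unfolding B_def by (rule sum.cong[OF refl], rule sum.cong[OF refl]) (auto simp: right_diff_distrib)
      also have "\<dots> = (\<Sum>a\<in>V. \<Sum>b\<in>V. (if a = u then w u b * (g0 u - g0 b) else 0)) -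
          (\<Sum>b\<in>V. \<Sum>a\<in>V. (if b = u then w a u * (g0 a - g0 u) else 0))"
        by (subst (3) sum.swap) (simp only: sum_subtractf)
      also have "(\<Sum>a\<in>V. \<Sum>b\<in>V. (if a = u then w u b * (g0 u - g0 b) else 0)) =
          (\<Sum>a\<in>V. if a = u then (\<Sum>b\<in>V. w u b * (g0 u - g0 b)) else 0)"
        by (rule sum.cong[OF refl]) auto
      also have "\<dots> = (\<Sum>b\<in>V. w u b * (g0 u - g0 b))"
        using u fin by simp
      also have "(\<Sum>b\<in>V. \<Sum>a\<in>V. (if b = u then w a u * (g0 a - g0 u) else 0)) =
          (\<Sum>b\<in>V. if b = u then (\<Sum>a\<in>V. w a u * (g0 a - g0 u)) else 0)"
        by (rule sum.cong[OF refl]) auto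
      also have "\<dots> = (\<Sum>a\<in>V. w a u * (g0 a - g0 u))"
        using u fin by simp
      also have "\<dots> = - (\<Sum>b\<in>V. w u b * (g0 u - g0 b))"
      proof -
        have "w a u * (g0 a - g0 u) = - (w u a * (g0 u - g0 a))" for a
          unfolding sym[of a u] by (simp add: algebra_simps)
        then show ?thesis by (simp only: sum_negf)
      qed
      finally have "B g0 ?e = 2 * (\<Sum>b\<in>V. w u b * (g0 u - g0 b))" by simp
      also have "(\<Sum>b\<in>V. w u b * (g0 u - g0 b)) = w1 u * g0 u - (\<Sum>v\<in>V. w u v * g0 v)"
        by (simp add: w1[OF u] right_diff_distrib sum_subtractf sum_distrib_right[symmetric])
      finally have "B g0 ?e = 2 * (w1 u * g0 u - (\<Sum>v\<in>V. w u v * g0 v))" .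
      with lin[of ?e] 1 show ?thesis by (simp add: algebra_simps)
    qed
    \<comment> \<open>A constant of mean zero is zero and cannot have norm 1. So \<open>eig\<close>
      applies to \<open>g0\<close> and yields \<open>1 \<le> \<gamma>\<close>.\<close>
    moreover have "\<exists>u\<in>V. \<exists>v\<in>V. g0 u \<noteq> g0 v"
    proof (rule ccontr)
      assume c: "\<not> ?thesis"
      obtain u where u: "u \<in> V" using \<open>V \<noteq> {}\<close> by auto
      have c': "g0 v = g0 u" if "v \<in> V" for v
        using c u that by blast
      have "m g0 = (\<Sum>v\<in>V. w1 v * g0 u)"
        unfolding m_def by (rule sum.cong[OF refl]) (simp only: c')
      then have "m g0 = W * g0 u" by (simp add: W_def sum_distrib_right)
      then have "g0 u = 0" using m1 W by simp
      then have "I g0 g0 = 0"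
        unfolding I_def by (intro sum.neutral) (simp add: c')
      then show False using I1 by simp
    qed
    ultimately have "1 - \<gamma> / 2 \<le> 1 / 2" by (intro eig[of g0]) auto
    then have "1 * I g g \<le> \<gamma> * I g g" by (intro mult_right_mono I0) auto
    then show ?thesis using ray[OF mg] by simp
  qed
  from key[of g] mean show ?thesis
    by (simp add: I_def B_def m_def power2_eq_square)
qed

text \<open>Applied to the indicators of the level sets of \<open>F\<close> and summed; the most likely value has
  probability at least the collision probability.\<close>

lemma plurality_from_eigenvalues:
  fixes w :: "'a \<Rightarrow> 'a \<Rightarrow> real" and w1 :: "'a \<Rightarrow> real" and F :: "'a \<Rightarrow> 'c"
  assumes fin: "finite V" and ne: "V \<noteq> {}"
    and sym: "\<And>u v. w u v = w v u"
    and nonneg: "\<And>u v. 0 \<le> w u v"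
    and w1: "\<And>u. u \<in> V \<Longrightarrow> w1 u = (\<Sum>v\<in>V. w u v)"
    and pos: "\<And>u. u \<in> V \<Longrightarrow> 0 < w1 u"
    and total: "(\<Sum>u\<in>V. w1 u) = 1"
    and eig: "\<And>\<theta> g. (\<forall>u\<in>V. (\<Sum>v\<in>V. w u v * g v) = \<theta> * (w1 u * g u)) \<Longrightarrow>
        \<exists>u\<in>V. \<exists>v\<in>V. g u \<noteq> g v \<Longrightarrow> \<theta> \<le> 1 / 2"
  shows "\<exists>v0\<in>V. (\<Sum>u\<in>V. if F u \<noteq> F v0 then w1 u else 0) \<le>
           2 * (\<Sum>u\<in>V. \<Sum>v\<in>V. if F u \<noteq> F v then w u v else 0)"
proof -
  define p where "p c = (\<Sum>u\<in>V. if F u = c then w1 u else 0)" for c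
  define D where "D c = (\<Sum>u\<in>V. \<Sum>v\<in>V. if (F u = c) \<noteq> (F v = c) then w u v else 0)" for c
  have p0: "0 \<le> p c" for c
    unfolding p_def by (intro sum_nonneg) (use pos less_imp_le in auto)
  have sp: "(\<Sum>c\<in>F ` V. p c) = 1"
    unfolding p_def by (subst sum.swap) (simp add: fin total)
  \<comment> \<open>The Poincare inequality for the centred indicator of the level set: the left
    side is its variance, the right side the weight of the pairs that it separates.\<close>
  have one: "p c - (p c)\<^sup>2 \<le> D c" for c
  proof -
    define g where "g u = (if F u = c then 1 else 0) - p c" for u
    have "(\<Sum>u\<in>V. w1 u * g u) = p c - p c * (\<Sum>u\<in>V. w1 u)"
      unfolding g_def right_diff_distrib sum_subtractf
      by (simp add: p_def sum_distrib_right algebra_simps if_distrib cong: if_cong)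
    then have "(\<Sum>u\<in>V. w1 u * g u) = 0" by (simp add: total)
    from this fin sym nonneg w1 pos eig
    have "(\<Sum>u\<in>V. w1 u * (g u)\<^sup>2) \<le> (\<Sum>u\<in>V. \<Sum>v\<in>V. w u v * (g u - g v)\<^sup>2)"
      by (intro poincare_from_eigenvalues[where ?w1.0 = w1])
    moreover have "(\<Sum>u\<in>V. w1 u * (g u)\<^sup>2) = (1 - 2 * p c) * p c + (p c)\<^sup>2"
    proof -
      have "(\<Sum>u\<in>V. w1 u * (g u)\<^sup>2) =
        (\<Sum>u\<in>V. (1 - 2 * p c) * (if F u = c then w1 u else 0) + (p c)\<^sup>2 * w1 u)"
        unfolding g_def by (rule sum.cong[OF refl]) (auto simp: power2_eq_square algebra_simps)
      also have "\<dots> = (1 - 2 * p c) * p c + (p c)\<^sup>2"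
        by (simp add: sum.distrib sum_distrib_left[symmetric] total p_def[symmetric])
      finally show ?thesis .
    qed
    moreover have "(\<Sum>u\<in>V. \<Sum>v\<in>V. w u v * (g u - g v)\<^sup>2) = D c"
      unfolding g_def D_def by (rule sum.cong[OF refl], rule sum.cong[OF refl]) auto
    ultimately show ?thesis by (simp add: power2_eq_square algebra_simps)
  qed
  \<comment> \<open>A pair with different values of \<open>F\<close> is separated by exactly two
    level sets, those of \<open>F u\<close> and \<open>F v\<close>. This is the factor 2 of the
    conclusion.\<close>
  have "(\<Sum>c\<in>F ` V. D c) = (\<Sum>u\<in>V. \<Sum>v\<in>V. \<Sum>c\<in>F ` V. if (F u = c) \<noteq> (F v = c) then w u v else 0)"
    unfolding D_def by (subst sum.swap, rule sum.cong[OF refl], rule sum.swap)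
  also have "\<dots> = (\<Sum>u\<in>V. \<Sum>v\<in>V. 2 * (if F u \<noteq> F v then w u v else 0))"
  proof (rule sum.cong[OF refl], rule sum.cong[OF refl])
    fix u v assume uv: "u \<in> V" "v \<in> V"
    show "(\<Sum>c\<in>F ` V. if (F u = c) \<noteq> (F v = c) then w u v else 0) =
        2 * (if F u \<noteq> F v then w u v else 0)"
    proof (cases "F u = F v")
      case False
      have "(\<Sum>c\<in>F ` V. if (F u = c) \<noteq> (F v = c) then w u v else 0) =
          (\<Sum>c\<in>F ` V. (if c = F u then w u v else 0) + (if c = F v then w u v else 0))"
        by (rule sum.cong[OF refl]) (use False in auto)
      also have "\<dots> = 2 * w u v" using uv fin by (simp add: sum.distrib)
      finally show ?thesis using False by simp
    qed auto
  qed
  finally have sD: "(\<Sum>c\<in>F ` V. D c) =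
      2 * (\<Sum>u\<in>V. \<Sum>v\<in>V. if F u \<noteq> F v then w u v else 0)"
    by (simp add: sum_distrib_left)
  define q where "q = Max (p ` F ` V)"
  have "q \<in> p ` F ` V" unfolding q_def using fin ne by (intro Max_in) auto
  then obtain v0 where v0: "v0 \<in> V" "q = p (F v0)" by auto
  have pq: "p c \<le> q" if "c \<in> F ` V" for c
    unfolding q_def using that fin by (intro Max_ge) auto
  have "(\<Sum>c\<in>F ` V. (p c)\<^sup>2) \<le> (\<Sum>c\<in>F ` V. q * p c)"
    unfolding power2_eq_square by (intro sum_mono mult_right_mono pq p0)
  also have "\<dots> = q" by (simp add: sum_distrib_left[symmetric] sp)
  finally have "1 - q \<le> (\<Sum>c\<in>F ` V. p c) - (\<Sum>c\<in>F ` V. (p c)\<^sup>2)"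
    by (simp add: sp)
  also have "\<dots> \<le> (\<Sum>c\<in>F ` V. D c)"
    unfolding sum_subtractf[symmetric] by (intro sum_mono one)
  finally have "1 - q \<le> 2 * (\<Sum>u\<in>V. \<Sum>v\<in>V. if F u \<noteq> F v then w u v else 0)"
    unfolding sD .
  moreover have "(\<Sum>u\<in>V. if F u \<noteq> F v0 then w1 u else 0) = (\<Sum>u\<in>V. w1 u) - q"
    unfolding v0 p_def sum_subtractf[symmetric] by (rule sum.cong[OF refl]) auto
  ultimately have "(\<Sum>u\<in>V. if F u \<noteq> F v0 then w1 u else 0) \<le>
      2 * (\<Sum>u\<in>V. \<Sum>v\<in>V. if F u \<noteq> F v then w u v else 0)"
    unfolding total by simp
  then show ?thesis using v0(1) by blast
qed

section \<open>Uniform distributions recognised by symmetry\<close>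

lemma pmf_eq_pmf_of_set_if_constant:
  assumes "finite S" "S \<noteq> {}" "set_pmf p \<subseteq> S"
    and eq: "\<And>a b. a \<in> S \<Longrightarrow> b \<in> S \<Longrightarrow> pmf p a = pmf p b"
  shows "p = pmf_of_set S"
proof -
  obtain a where a: "a \<in> S" using assms(2) by auto
  have "(\<Sum>b\<in>S. pmf p b) = 1" using assms(1,3) by (rule sum_pmf_eq_1)
  also have "(\<Sum>b\<in>S. pmf p b) = (\<Sum>b\<in>S. pmf p a)"
    by (rule sum.cong[OF refl]) (rule eq[OF _ a])
  finally have "real (card S) * pmf p a = 1" by simp
  then have pa: "pmf p a = 1 / real (card S)"
    by (metis mult_zero_left nonzero_mult_div_cancel_left zero_neq_one)
  show ?thesis
  proof (rule pmf_eqI)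
    fix b
    show "pmf p b = pmf (pmf_of_set S) b"
    proof (cases "b \<in> S")
      case True
      then show ?thesis using assms(1,2) eq[OF True a] pa by simp
    next
      case False
      then show ?thesis using assms(1-3) by (auto simp: set_pmf_iff)
    qed
  qed
qed

text \<open>An injection that preserves the distribution preserves point masses, so a transitive
  family of symmetries forces uniformity. This replaces most counting arguments below.\<close>

lemma pmf_eq_pmf_of_set_if_transitive:
  assumes "finite S" "S \<noteq> {}" "set_pmf p \<subseteq> S"
    and trans: "\<And>a b. a \<in> S \<Longrightarrow> b \<in> S \<Longrightarrow> \<exists>\<phi>. inj \<phi> \<and> map_pmf \<phi> p = p \<and> \<phi> a = b"
  shows "p = pmf_of_set S"
proof (rule pmf_eq_pmf_of_set_if_constant[OF assms(1-3)])
  fix a b assume "a \<in> S" "b \<in> S"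
  then obtain \<phi> where \<phi>: "inj \<phi>" "map_pmf \<phi> p = p" "\<phi> a = b" using trans by metis
  then show "pmf p a = pmf p b" using pmf_map_inj'[of \<phi> p a] by simp
qed

lemma extend_injection_to_permutation:
  assumes "finite t" "A \<subseteq> t" "inj_on h A" "h ` A \<subseteq> t"
  shows "\<exists>\<pi>. \<pi> permutes t \<and> (\<forall>a\<in>A. \<pi> a = h a)"
proof -
  have "finite A" using assms finite_subset by auto
  have "card (t - A) = card (t - h ` A)"
    using assms \<open>finite A\<close> by (simp add: card_Diff_subset card_image)
  then obtain k where k: "bij_betw k (t - A) (t - h ` A)"
    using assms(1) by (metis finite_Diff finite_same_card_bij)
  define \<pi> where "\<pi> a = (if a \<in> A then h a else if a \<in> t then k a else a)" for a
  have "bij_betw \<pi> A (h ` A)"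
    using assms(3) by (auto simp: bij_betw_def \<pi>_def inj_on_def)
  moreover have "bij_betw \<pi> (t - A) (t - h ` A)"
    using k by (subst bij_betw_cong[of _ _ k]) (auto simp: \<pi>_def)
  ultimately have "bij_betw \<pi> (A \<union> (t - A)) (h ` A \<union> (t - h ` A))"
    by (rule bij_betw_combine) auto
  moreover have "A \<union> (t - A) = t" "h ` A \<union> (t - h ` A) = t" using assms by auto
  ultimately have "\<pi> permutes t"
    using assms(2) by (intro bij_imp_permutes) (auto simp: \<pi>_def)
  then show ?thesis by (auto simp: \<pi>_def)
qed

lemma permutation_mapping_distinct_lists:
  assumes "finite t" "distinct xs" "distinct ys" "length xs = length ys" "set xs \<subseteq> t" "set ys \<subseteq> t"
  shows "\<exists>\<pi>. \<pi> permutes t \<and> map \<pi> xs = ys"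
proof -
  define h where "h a = ys ! (THE i. i < length xs \<and> xs ! i = a)" for a
  have h: "h (xs ! i) = ys ! i" if "i < length xs" for i
  proof -
    have "(THE j. j < length xs \<and> xs ! j = xs ! i) = i"
      using assms that by (intro the_equality) (auto simp: nth_eq_iff_index_eq)
    then show ?thesis by (simp add: h_def)
  qed
  have "inj_on h (set xs)"
    using assms h by (auto simp: inj_on_def in_set_conv_nth nth_eq_iff_index_eq)
  moreover have "h ` set xs \<subseteq> t"
    using assms(4,6) h by (auto simp: in_set_conv_nth) (metis nth_mem subsetD)
  ultimately obtain \<pi> where "\<pi> permutes t" "\<forall>a\<in>set xs. \<pi> a = h a"
    using extend_injection_to_permutation[OF assms(1,5)] by blast
  then show ?thesis using h assms by (auto intro!: exI[of _ \<pi>] nth_equalityI)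
qed

text \<open>Bijections between corresponding sets are glued. The result is well defined because the
  sets in \<open>As\<close> are disjoint, and injective because those in \<open>Bs\<close>
  are.\<close>

lemma permutation_mapping_disjoint_sets:
  assumes "finite t" "length As = length Bs" "\<forall>A\<in>set As. A \<subseteq> t" "\<forall>B\<in>set Bs. B \<subseteq> t"
    and "\<And>i j. i < length As \<Longrightarrow> j < length As \<Longrightarrow> i \<noteq> j \<Longrightarrow> As ! i \<inter> As ! j = {}"
    and "\<And>i j. i < length Bs \<Longrightarrow> j < length Bs \<Longrightarrow> i \<noteq> j \<Longrightarrow> Bs ! i \<inter> Bs ! j = {}"
    and "\<And>i. i < length As \<Longrightarrow> card (As ! i) = card (Bs ! i)"
  shows "\<exists>\<pi>. \<pi> permutes t \<and> map ((`) \<pi>) As = Bs"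
proof -
  let ?n = "length As"
  have sub: "As ! i \<subseteq> t" "Bs ! i \<subseteq> t" if "i < ?n" for i
    using assms(2-4) that by auto
  have "\<exists>h. bij_betw h (As ! i) (Bs ! i)" if "i < ?n" for i
    using sub[OF that] assms(1,7) that by (meson finite_same_card_bij finite_subset)
  then obtain h where h: "\<And>i. i < ?n \<Longrightarrow> bij_betw (h i) (As ! i) (Bs ! i)" by metis
  define g where "g a = h (THE i. i < ?n \<and> a \<in> As ! i) a" for a
  have g: "g a = h i a" if "i < ?n" "a \<in> As ! i" for i a
  proof -
    have "(THE j. j < ?n \<and> a \<in> As ! j) = i"
      using that assms(5) by (intro the_equality) auto
    then show ?thesis by (simp add: g_def)
  qed
  have gB: "g ` (As ! i) = Bs ! i" if "i < ?n" for i
    using h[OF that] g[OF that] by (auto simp: bij_betw_def image_def)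
  have "inj_on g (\<Union>(set As))"
  proof (rule inj_onI)
    fix a b assume ab: "a \<in> \<Union>(set As)" "b \<in> \<Union>(set As)" "g a = g b"
    then obtain i j where ij: "i < ?n" "a \<in> As ! i" "j < ?n" "b \<in> As ! j"
      by (auto simp: in_set_conv_nth)
    have "g a \<in> Bs ! i" "g b \<in> Bs ! j" using gB ij by blast+
    then have "i = j" using assms(6)[of i j] assms(2) ij ab(3) by auto
    then show "a = b"
      using g[OF ij(1)] ij ab(3) h[OF ij(1)] by (auto simp: bij_betw_def inj_on_def)
  qed
  moreover have "g ` \<Union>(set As) \<subseteq> t"
    using gB sub by (fastforce simp: in_set_conv_nth)
  ultimately obtain \<pi> where \<pi>: "\<pi> permutes t" "\<forall>a\<in>\<Union>(set As). \<pi> a = g a"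
    using extend_injection_to_permutation[OF assms(1), of "\<Union>(set As)" g] assms(3) by blast
  have "\<pi> ` (As ! i) = Bs ! i" if "i < ?n" for i
    unfolding gB[OF that, symmetric] using \<pi>(2) that by (intro image_cong) auto
  then show ?thesis using \<pi> assms(2) by (auto intro!: exI[of _ \<pi>] nth_equalityI)
qed

subsection \<open>Random orderings of a random top face\<close>

text \<open>Fixing the values from \<open>N\<close> on makes a labelling determined by its values
  below \<open>N\<close>, so that there are finitely many and a uniform one exists.\<close>

definition labellings :: "nat \<Rightarrow> 'a set \<Rightarrow> (nat \<Rightarrow> 'a) set" where
  "labellings N t = {x. bij_betw x {..<N} t \<and> (\<forall>i\<ge>N. x i = undefined)}"

definition labelling_pmf :: "nat \<Rightarrow> 'a set pmf \<Rightarrow> (nat \<Rightarrow> 'a) pmf" where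
  "labelling_pmf N \<mu> = bind_pmf \<mu> (\<lambda>t. pmf_of_set (labellings N t))"

lemma finite_labellings: "finite t \<Longrightarrow> finite (labellings N t)"
proof -
  assume t: "finite t"
  have "labellings N t \<subseteq> PiE {..<N} (\<lambda>_. t)"
    by (auto simp: labellings_def bij_betw_def PiE_def extensional_def)
  then show ?thesis using t by (meson finite_PiE finite_lessThan finite_subset)
qed

lemma labellings_nonempty:
  assumes "finite t" "card t = N"
  shows "labellings N t \<noteq> {}"
proof -
  obtain h where "bij_betw h {..<N} t"
    using assms by (metis card_lessThan finite_lessThan finite_same_card_bij)
  then have "(\<lambda>i. if i < N then h i else undefined) \<in> labellings N t"
    by (auto simp: labellings_def) (subst bij_betw_cong[of _ _ h], auto)
  then show ?thesis by auto
qed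

lemma set_labelling_pmf:
  assumes "\<And>t. t \<in> set_pmf \<mu> \<Longrightarrow> finite t \<and> card t = N" "x \<in> set_pmf (labelling_pmf N \<mu>)"
  shows "inj_on x {..<N}" "x ` {..<N} \<in> set_pmf \<mu>"
proof -
  obtain t where t: "t \<in> set_pmf \<mu>" "x \<in> set_pmf (pmf_of_set (labellings N t))"
    using assms(2) by (auto simp: labelling_pmf_def)
  then have "x \<in> labellings N t"
    using assms(1)[OF t(1)] finite_labellings[of t N] labellings_nonempty[of t N] by auto
  then show "inj_on x {..<N}" "x ` {..<N} \<in> set_pmf \<mu>"
    using t(1) by (auto simp: labellings_def bij_betw_def)
qed

text \<open>Precomposition with a permutation of the labels is a bijection on the labellings of each
  single top face, so it preserves the mixture over \<open>\<mu>\<close> as well.\<close>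

lemma labelling_pmf_exchangeable:
  assumes "\<And>t. t \<in> set_pmf \<mu> \<Longrightarrow> finite t \<and> card t = N" "\<pi> permutes {..<N}"
  shows "map_pmf (\<lambda>x. x \<circ> \<pi>) (labelling_pmf N \<mu>) = labelling_pmf N \<mu>"
  unfolding labelling_pmf_def map_bind_pmf
proof (rule bind_pmf_cong[OF refl])
  fix t assume t: "t \<in> set_pmf \<mu>"
  have *: "x \<circ> \<sigma> \<in> labellings N t" if "\<sigma> permutes {..<N}" "x \<in> labellings N t" for x \<sigma>
    using that bij_betw_trans[OF permutes_imp_bij[OF that(1)], of x t]
    by (auto simp: labellings_def permutes_def)
  have "bij_betw (\<lambda>x. x \<circ> \<pi>) (labellings N t) (labellings N t)"
  proof (rule bij_betw_byWitness[where f' = "\<lambda>x. x \<circ> inv_into UNIV \<pi>"])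
    show "(\<lambda>x. x \<circ> \<pi>) ` labellings N t \<subseteq> labellings N t"
      "(\<lambda>x. x \<circ> inv_into UNIV \<pi>) ` labellings N t \<subseteq> labellings N t"
      using *[OF assms(2)] *[OF permutes_inv[OF assms(2)]] by auto
    show "\<forall>x\<in>labellings N t. x \<circ> \<pi> \<circ> inv_into UNIV \<pi> = x" "\<forall>x\<in>labellings N t. x \<circ> inv_into UNIV \<pi> \<circ> \<pi> = x"
      using assms(2) by (auto simp: o_assoc[symmetric] permutes_inv_o)
  qed
  then show "map_pmf (\<lambda>x. x \<circ> \<pi>) (pmf_of_set (labellings N t)) = pmf_of_set (labellings N t)"
    using assms(1)[OF t] by (intro map_pmf_of_set_bij_betw labellings_nonempty finite_labellings) auto
qed

text \<open>The symmetry on the other side: the vertices of a fixed face are permuted, not the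
  labels. It carries a tuple drawn from \<open>t\<close> to any other one. The case distinction
  keeps the default values from \<open>N\<close> on untouched.\<close>

lemma map_permutation_labellings:
  assumes "finite t" "card t = N" "\<pi> permutes t"
  shows "map_pmf (\<lambda>x i. if i < N then \<pi> (x i) else x i) (pmf_of_set (labellings N t)) =
    pmf_of_set (labellings N t)"
proof -
  have *: "(\<lambda>i. if i < N then \<sigma> (x i) else x i) \<in> labellings N t"
    if \<sigma>: "\<sigma> permutes t" "x \<in> labellings N t" for x \<sigma>
  proof -
    have "bij_betw (\<sigma> \<circ> x) {..<N} t"
      using \<sigma> by (intro bij_betw_trans[of x _ t]) (auto simp: labellings_def permutes_imp_bij)
    then have "bij_betw (\<lambda>i. if i < N then \<sigma> (x i) else x i) {..<N} t"
      by (subst bij_betw_cong[of _ _ "\<sigma> \<circ> x"]) auto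
    then show ?thesis using \<sigma> by (auto simp: labellings_def)
  qed
  have "bij_betw (\<lambda>x i. if i < N then \<pi> (x i) else x i) (labellings N t) (labellings N t)"
    using *[OF assms(3)] *[OF permutes_inv[OF assms(3)]] permutes_inverses[OF assms(3)]
    by (intro bij_betw_byWitness[where f' = "\<lambda>x i. if i < N then inv_into UNIV \<pi> (x i) else x i"])
       (auto simp: fun_eq_iff)
  then show ?thesis
    using assms by (intro map_pmf_of_set_bij_betw labellings_nonempty finite_labellings) auto
qed

definition distinct_lists :: "nat \<Rightarrow> 'a set \<Rightarrow> 'a list set" where
  "distinct_lists k t = {l. distinct l \<and> length l = k \<and> set l \<subseteq> t}"

lemma distinct_lists:
  assumes "finite t" "k \<le> card t"
  shows "finite (distinct_lists k t)" "distinct_lists k t \<noteq> {}"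
    "card (distinct_lists k t) = \<Prod>{card t - k + 1..card t}"
proof -
  have "distinct_lists k t = {l. length l = k \<and> distinct l \<and> set l \<subseteq> t}"
    by (auto simp: distinct_lists_def)
  with card_lists_distinct_length_eq[OF assms]
  show "card (distinct_lists k t) = \<Prod>{card t - k + 1..card t}" by simp
  show "finite (distinct_lists k t)"
    by (rule finite_subset[OF _ finite_lists_length_eq[OF assms(1), of k]])
       (auto simp: distinct_lists_def)
  obtain u where "u \<subseteq> t" "card u = k" "finite u"
    using obtain_subset_with_card_n[OF assms(2)] by auto
  then obtain l where "set l = u" "distinct l" using finite_distinct_list by auto
  with \<open>u \<subseteq> t\<close> \<open>card u = k\<close> have "l \<in> distinct_lists k t"
    by (auto simp: distinct_lists_def distinct_card)
  then show "distinct_lists k t \<noteq> {}" by auto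
qed

lemma map_labellings_eq_distinct_lists:
  assumes "finite t" "card t = N" "j + k \<le> N"
  shows "map_pmf (\<lambda>x. map x [j..<j + k]) (pmf_of_set (labellings N t)) =
    pmf_of_set (distinct_lists k t)"
proof (rule pmf_eq_pmf_of_set_if_transitive)
  let ?p = "map_pmf (\<lambda>x. map x [j..<j + k]) (pmf_of_set (labellings N t))"
  note L = finite_labellings[OF assms(1), of N] labellings_nonempty[OF assms(1,2)]
  show "finite (distinct_lists k t)" "distinct_lists k t \<noteq> {}"
    using distinct_lists[of t k] assms by auto
  show "set_pmf ?p \<subseteq> distinct_lists k t"
  proof
    fix l assume "l \<in> set_pmf ?p"
    then obtain x where x: "x \<in> labellings N t" "l = map x [j..<j + k]" using L by auto
    then have "inj_on x {j..<j + k}" "x ` {j..<j + k} \<subseteq> t"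
      using assms(3) by (auto simp: labellings_def bij_betw_def intro: inj_on_subset)
    then show "l \<in> distinct_lists k t" by (simp add: x(2) distinct_lists_def distinct_map)
  qed
  fix a b assume "a \<in> distinct_lists k t" "b \<in> distinct_lists k t"
  then obtain \<pi> where \<pi>: "\<pi> permutes t" "map \<pi> a = b"
    using permutation_mapping_distinct_lists[OF assms(1), of a b] by (auto simp: distinct_lists_def)
  have "map_pmf (map \<pi>) ?p = map_pmf (\<lambda>x. map x [j..<j + k])
      (map_pmf (\<lambda>x i. if i < N then \<pi> (x i) else x i) (pmf_of_set (labellings N t)))"
    unfolding pmf.map_comp by (intro pmf.map_cong refl) (use assms(3) in auto)
  also have "\<dots> = ?p" using map_permutation_labellings[OF assms(1,2) \<pi>(1)] by simp
  finally show "\<exists>\<phi>. inj \<phi> \<and> map_pmf \<phi> ?p = ?p \<and> \<phi> a = b"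
    using \<pi> by (intro exI[of _ "map \<pi>"]) (auto intro: permutes_inj inj_mapI)
qed

text \<open>\<open>f\<close> plays the role of an action of the permutations of \<open>t\<close> on
  \<open>S\<close>. It is needed for subsets of \<open>t\<close> and, one level up, for families of
  subsets.\<close>

lemma map_permutation_pmf_of_subsets:
  assumes "\<pi> permutes t" "finite t" "S \<noteq> {}" "finite S" "\<And>s \<sigma>. \<sigma> permutes t \<Longrightarrow> s \<in> S \<Longrightarrow> f \<sigma> s \<in> S"
    and "\<And>\<sigma> s. \<sigma> permutes t \<Longrightarrow> f \<sigma> (f (inv_into UNIV \<sigma>) s) = s"
  shows "map_pmf (f \<pi>) (pmf_of_set S) = pmf_of_set S"
proof -
  have "bij_betw (f \<pi>) S S"
  proof (rule bij_betw_byWitness[where f' = "f (inv_into UNIV \<pi>)"])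
    show "\<forall>s\<in>S. f (inv_into UNIV \<pi>) (f \<pi> s) = s"
      using assms(6)[OF permutes_inv[OF assms(1)]] by (simp add: permutes_inv_inv[OF assms(1)])
    show "\<forall>s\<in>S. f \<pi> (f (inv_into UNIV \<pi>) s) = s" using assms(6)[OF assms(1)] by simp
    show "f \<pi> ` S \<subseteq> S" "f (inv_into UNIV \<pi>) ` S \<subseteq> S"
      using assms(5)[OF assms(1)] assms(5)[OF permutes_inv[OF assms(1)]] by auto
  qed
  then show ?thesis using assms(3,4) by (rule map_pmf_of_set_bij_betw)
qed

lemma orderings_of_finite_set:
  assumes "finite u"
  shows "finite {l. distinct l \<and> set l = u}" "{l. distinct l \<and> set l = u} \<noteq> {}"
  using finite_distinct_list[OF assms]
  by (auto intro: finite_subset[OF _ finite_subset_distinct[OF assms]])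

lemma map_permutation_orderings:
  assumes "\<pi> permutes t" "finite u"
  shows "map_pmf (map \<pi>) (pmf_of_set {l. distinct l \<and> set l = u}) =
    pmf_of_set {l. distinct l \<and> set l = \<pi> ` u}"
proof (rule map_pmf_of_set_bij_betw)
  have i: "inj \<pi>" "inj (inv_into UNIV \<pi>)"
    using assms(1) permutes_inv permutes_inj by blast+
  show "bij_betw (map \<pi>) {l. distinct l \<and> set l = u} {l. distinct l \<and> set l = \<pi> ` u}"
  proof (rule bij_betw_byWitness[where f' = "map (inv_into UNIV \<pi>)"])
    show "map \<pi> ` {l. distinct l \<and> set l = u} \<subseteq> {l. distinct l \<and> set l = \<pi> ` u}"
      by (auto simp: distinct_map inj_on_subset[OF i(1) subset_UNIV])
    show "map (inv_into UNIV \<pi>) ` {l. distinct l \<and> set l = \<pi> ` u} \<subseteq> {l. distinct l \<and> set l = u}"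
      using i(1) by (auto simp: distinct_map image_image inj_on_subset[OF i(2) subset_UNIV])
  qed (simp_all add: permutes_inv_o[OF assms(1)])
qed (rule orderings_of_finite_set[OF assms(2)])+

text \<open>Choosing a subset and then ordering it commutes with permutations of \<open>t\<close>,
  which act transitively on tuples. Only a lower bound on \<open>card t\<close> is assumed, so that
  links and the faces complex, whose top faces have other sizes, are covered.\<close>

lemma ordered_face_pmf_eq_distinct_lists:
  assumes \<nu>: "\<And>t. t \<in> set_pmf \<nu> \<Longrightarrow> finite t \<and> k + 1 \<le> card t"
  shows "ordered_face_pmf k \<nu> = bind_pmf \<nu> (\<lambda>t. pmf_of_set (distinct_lists (k + 1) t))"
  unfolding ordered_face_pmf_def face_pmf_def bind_assoc_pmf
proof (rule bind_pmf_cong[OF refl])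
  fix t assume "t \<in> set_pmf \<nu>"
  then have t: "finite t" "k + 1 \<le> card t" using \<nu> by auto
  let ?S = "{u. u \<subseteq> t \<and> card u = k + 1}"
  let ?O = "\<lambda>u. pmf_of_set {l. distinct l \<and> set l = u}"
  let ?p = "bind_pmf (pmf_of_set ?S) ?O"
  obtain u0 where "u0 \<subseteq> t" "card u0 = k + 1"
    using obtain_subset_with_card_n[OF t(2)] by metis
  then have S: "finite ?S" "?S \<noteq> {}"
    using t(1) by auto
  have fu: "finite u" if "u \<in> ?S" for u using that finite_subset[OF _ t(1)] by auto
  show "?p = pmf_of_set (distinct_lists (k + 1) t)"
  proof (rule pmf_eq_pmf_of_set_if_transitive)
    show "finite (distinct_lists (k + 1) t)" "distinct_lists (k + 1) t \<noteq> {}"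
      using distinct_lists[OF t] by auto
    show "set_pmf ?p \<subseteq> distinct_lists (k + 1) t"
    proof
      fix l assume "l \<in> set_pmf ?p"
      then obtain u where u: "u \<in> ?S" "l \<in> set_pmf (?O u)" using S by auto
      then have "distinct l" "set l = u" using orderings_of_finite_set[OF fu[OF u(1)]] by auto
      with u(1) show "l \<in> distinct_lists (k + 1) t"
        using distinct_card[of l] by (auto simp: distinct_lists_def)
    qed
    fix a b assume "a \<in> distinct_lists (k + 1) t" "b \<in> distinct_lists (k + 1) t"
    then obtain \<pi> where \<pi>: "\<pi> permutes t" "map \<pi> a = b"
      using permutation_mapping_distinct_lists[OF t(1), of a b] by (auto simp: distinct_lists_def)
    have 1: "map_pmf ((`) \<pi>) (pmf_of_set ?S) = pmf_of_set ?S"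
    proof (rule map_permutation_pmf_of_subsets[OF \<pi>(1) t(1) S(2,1)])
      fix s and \<sigma> :: "'a \<Rightarrow> 'a" assume \<sigma>: "\<sigma> permutes t"
      show "s \<in> ?S \<Longrightarrow> \<sigma> ` s \<in> ?S"
        using permutes_inj_on[OF \<sigma>, of s] permutes_in_image[OF \<sigma>] by (auto simp: card_image)
      show "\<sigma> ` (inv_into UNIV \<sigma> ` s) = s" using permutes_inverses[OF \<sigma>] by (auto simp: image_image)
    qed
    have "map_pmf (map \<pi>) ?p = bind_pmf (pmf_of_set ?S) (\<lambda>u. ?O (\<pi> ` u))"
      unfolding map_bind_pmf using S
      by (intro bind_pmf_cong[OF refl] map_permutation_orderings[OF \<pi>(1)] fu) simp
    also have "\<dots> = bind_pmf (map_pmf ((`) \<pi>) (pmf_of_set ?S)) ?O"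
      by (simp add: bind_map_pmf)
    finally have "map_pmf (map \<pi>) ?p = ?p" unfolding 1 .
    then show "\<exists>\<phi>. inj \<phi> \<and> map_pmf \<phi> ?p = ?p \<and> \<phi> a = b"
      using \<pi> by (intro exI[of _ "map \<pi>"]) (auto intro: permutes_inj inj_mapI)
  qed
qed

lemma ordered_face_pmf_eq_labelling:
  assumes "\<And>t. t \<in> set_pmf \<mu> \<Longrightarrow> finite t \<and> card t = N" "k + 1 \<le> N"
  shows "ordered_face_pmf k \<mu> = map_pmf (\<lambda>x. map x [0..<k + 1]) (labelling_pmf N \<mu>)"
proof -
  have "ordered_face_pmf k \<mu> = bind_pmf \<mu> (\<lambda>t. pmf_of_set (distinct_lists (k + 1) t))"
    using assms by (intro ordered_face_pmf_eq_distinct_lists) auto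
  also have "\<dots> = map_pmf (\<lambda>x. map x [0..<k + 1]) (labelling_pmf N \<mu>)"
    unfolding labelling_pmf_def map_bind_pmf
    using assms
    by (intro bind_pmf_cong[OF refl]
        map_labellings_eq_distinct_lists[where j = 0 and k = "k + 1", unfolded add_0, symmetric]) auto
  finally show ?thesis .
qed

lemma pmf_map_Pair: "pmf (map_pmf (Pair a') q) (a, b) = (if a' = a then pmf q b else 0)"
proof (cases "a' = a")
  case True
  then show ?thesis using pmf_map_inj'[of "Pair a" q b] by (simp add: inj_on_def)
next
  case False
  then show ?thesis by (auto intro: pmf_map_outside)
qed

lemma pmf_map_Pair_swapped: "pmf (map_pmf (\<lambda>a. (a, b')) q) (a, b) = (if b' = b then pmf q a else 0)"
proof (cases "b' = b")
  case True
  then show ?thesis using pmf_map_inj'[of "\<lambda>a. (a, b)" q a] by (simp add: inj_on_def)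
next
  case False
  then show ?thesis by (auto intro: pmf_map_outside)
qed

lemma integral_pmf_single:
  "measure_pmf.expectation q (\<lambda>x. if x = a then f x else (0::real)) = pmf q a * f a"
  by (subst integral_measure_pmf_real[where A = "{a}"]) (auto split: if_splits)

lemma pmf_bind_map_Pair:
  "pmf (bind_pmf q (\<lambda>a. map_pmf (Pair a) (E a))) (a, b) = pmf q a * pmf (E a) b"
  unfolding pmf_bind pmf_map_Pair by (rule integral_pmf_single)

lemma pmf_bind_map_Pair_swapped:
  "pmf (bind_pmf q (\<lambda>b. map_pmf (\<lambda>a. (a, b)) (E b))) (a, b) = pmf q b * pmf (E b) a"
  unfolding pmf_bind pmf_map_Pair_swapped by (rule integral_pmf_single)

lemma prob_bind_pmf:
  fixes f :: "'a \<Rightarrow> 'b pmf"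
  shows "measure_pmf.prob (bind_pmf M f) S = measure_pmf.expectation M (\<lambda>x. measure_pmf.prob (f x) S)"
proof -
  have *: "measure_pmf.prob p S = pmf (map_pmf (\<lambda>y. y \<in> S) p) True" for p :: "'b pmf"
    by (simp add: pmf_map vimage_def)
  show ?thesis unfolding * map_bind_pmf pmf_bind ..
qed

text \<open>The chain rule for sampling without replacement. The second stage draws from a set that
  depends on \<open>l\<close>, but the number of continuations depends only on the length of
  \<open>l\<close>, so all pairs have the same mass.\<close>

lemma split_distinct_lists:
  assumes t: "finite t" and kj: "k + j \<le> card t"
  shows "map_pmf (\<lambda>l. (take k l, drop k l)) (pmf_of_set (distinct_lists (k + j) t)) =
    bind_pmf (pmf_of_set (distinct_lists k t))
      (\<lambda>l. map_pmf (Pair l) (pmf_of_set (distinct_lists j (t - set l))))"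
proof -
  define S where "S = {(l, m). l \<in> distinct_lists k t \<and> m \<in> distinct_lists j (t - set l)}"
  have bij: "bij_betw (\<lambda>l. (take k l, drop k l)) (distinct_lists (k + j) t) S"
  proof (rule bij_betw_byWitness[where f' = "\<lambda>(l, m). l @ m"])
    show "(\<lambda>l. (take k l, drop k l)) ` distinct_lists (k + j) t \<subseteq> S"
    proof
      fix p assume "p \<in> (\<lambda>l. (take k l, drop k l)) ` distinct_lists (k + j) t"
      then obtain l where l: "l \<in> distinct_lists (k + j) t" "p = (take k l, drop k l)" by auto
      have "distinct (take k l @ drop k l)" "set (take k l @ drop k l) \<subseteq> t" "length l = k + j"
        using l by (auto simp: distinct_lists_def)
      then show "p \<in> S" unfolding l(2) S_def distinct_append set_append
        by (auto simp: distinct_lists_def)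
    qed
    show "(\<lambda>(l, m). l @ m) ` S \<subseteq> distinct_lists (k + j) t"
      by (auto simp: S_def distinct_lists_def)
  qed (auto simp: S_def distinct_lists_def)
  note D = distinct_lists[OF t kj]
  have k: "k \<le> card t" using kj by simp
  note K = distinct_lists[OF t k]
  have J: "finite (distinct_lists j (t - set l))" "distinct_lists j (t - set l) \<noteq> {}"
      "card (distinct_lists j (t - set l)) = \<Prod>{card t - k - j + 1..card t - k}"
    if l: "l \<in> distinct_lists k t" for l
  proof -
    have "card (t - set l) = card t - k"
      using l t by (auto simp: distinct_lists_def card_Diff_subset distinct_card)
    with distinct_lists[of "t - set l" j] t kj
    show "finite (distinct_lists j (t - set l))" "distinct_lists j (t - set l) \<noteq> {}"
      "card (distinct_lists j (t - set l)) = \<Prod>{card t - k - j + 1..card t - k}"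
      by simp_all
  qed
  have S: "finite S" "S \<noteq> {}"
    using bij D(1,2) by (auto simp: bij_betw_def)
  let ?R = "bind_pmf (pmf_of_set (distinct_lists k t))
      (\<lambda>l. map_pmf (Pair l) (pmf_of_set (distinct_lists j (t - set l))))"
  have "?R = pmf_of_set S"
  proof (rule pmf_eq_pmf_of_set_if_constant[OF S])
    show "set_pmf ?R \<subseteq> S"
    proof
      fix p assume "p \<in> set_pmf ?R"
      then have "p \<in> (\<Union>l\<in>set_pmf (pmf_of_set (distinct_lists k t)).
          Pair l ` set_pmf (pmf_of_set (distinct_lists j (t - set l))))"
        by (simp only: set_bind_pmf set_map_pmf)
      then obtain l m where lm: "p = (l, m)" "l \<in> set_pmf (pmf_of_set (distinct_lists k t))"
          "m \<in> set_pmf (pmf_of_set (distinct_lists j (t - set l)))"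
        by (elim UN_E imageE)
      then have l: "l \<in> distinct_lists k t" using K by simp
      then show "p \<in> S" using lm(1,3) J(1,2)[OF l] by (simp add: S_def)
    qed
    have const: "pmf ?R p = 1 / real (card (distinct_lists k t)) *
        (1 / real (\<Prod>{card t - k - j + 1..card t - k}))" if p: "p \<in> S" for p
    proof -
      obtain l m where lm: "p = (l, m)" "l \<in> distinct_lists k t" "m \<in> distinct_lists j (t - set l)"
        using p by (auto simp: S_def)
      have "pmf (pmf_of_set (distinct_lists k t)) l = 1 / real (card (distinct_lists k t))"
        using K(1,2) lm(2) by simp
      moreover have "pmf (pmf_of_set (distinct_lists j (t - set l))) m =
          1 / real (\<Prod>{card t - k - j + 1..card t - k})"
        unfolding J(3)[OF lm(2), symmetric] using J(1,2)[OF lm(2)] lm(3) by simp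
      ultimately show ?thesis unfolding lm(1) pmf_bind_map_Pair by simp
    qed
    show "pmf ?R a = pmf ?R b" if "a \<in> S" "b \<in> S" for a b
      by (simp only: const[OF that(1)] const[OF that(2)])
  qed
  moreover have "map_pmf (\<lambda>l. (take k l, drop k l)) (pmf_of_set (distinct_lists (k + j) t)) =
      pmf_of_set S"
    using bij D(2,1) by (rule map_pmf_of_set_bij_betw)
  ultimately show ?thesis by simp
qed

text \<open>Bayes' rule: given the tuple \<open>l\<close>, the top face containing it is distributed as \<open>\<mu>\<close>
  conditioned on containing \<open>l\<close>.\<close>

lemma sample_tuple_before_face:
  assumes \<mu>: "\<And>t. t \<in> set_pmf \<mu> \<Longrightarrow> finite t \<and> card t = N" and k: "k \<le> N"
  shows "bind_pmf \<mu> (\<lambda>t. bind_pmf (pmf_of_set (distinct_lists k t)) (\<lambda>l. K l t)) =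
    bind_pmf (bind_pmf \<mu> (\<lambda>t. pmf_of_set (distinct_lists k t)))
      (\<lambda>l. bind_pmf (cond_pmf \<mu> {t. set l \<subseteq> t}) (K l))"
proof -
  define q where "q = bind_pmf \<mu> (\<lambda>t. pmf_of_set (distinct_lists k t))"
  \<comment> \<open>The number of \<open>k\<close>-tuples without repetition from a top face. It is
    the same for all top faces, so it cancels between the mass of the pair \<open>(l, t)\<close> and
    the mass of \<open>l\<close>.\<close>
  define c where "c = real (\<Prod>{N - k + 1..N})"
  have pt: "pmf (pmf_of_set (distinct_lists k t)) l =
      (if set l \<subseteq> t then (if distinct l \<and> length l = k then 1 / c else 0) else 0)"
    if "t \<in> set_pmf \<mu>" for t l
  proof -
    have t: "finite t" "card t = N" using \<mu> that by auto
    then have "k \<le> card t" using k by simp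
    note D = distinct_lists[OF t(1) this]
    have "pmf (pmf_of_set (distinct_lists k t)) l = indicator (distinct_lists k t) l / c"
      using D t by (simp add: pmf_of_set c_def)
    then show ?thesis by (auto simp: distinct_lists_def)
  qed
  have pq: "pmf q l = measure_pmf.prob \<mu> {t. set l \<subseteq> t} / c"
    if l: "distinct l" "length l = k" for l
  proof -
    have "pmf q l = measure_pmf.expectation \<mu> (\<lambda>t. indicator {t. set l \<subseteq> t} t / c)"
      unfolding q_def pmf_bind
      by (rule integral_cong_AE) (auto simp: AE_measure_pmf_iff pt l)
    then show ?thesis by simp
  qed
  have "bind_pmf \<mu> (\<lambda>t. map_pmf (\<lambda>l. (l, t)) (pmf_of_set (distinct_lists k t))) =
      bind_pmf q (\<lambda>l. map_pmf (Pair l) (cond_pmf \<mu> {t. set l \<subseteq> t}))" (is "?J1 = ?J2")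
  proof (rule pmf_eqI, clarify)
    fix l t
    have 1: "pmf ?J1 (l, t) = pmf \<mu> t * pmf (pmf_of_set (distinct_lists k t)) l"
      by (rule pmf_bind_map_Pair_swapped)
    have 2: "pmf ?J2 (l, t) = pmf q l * pmf (cond_pmf \<mu> {t. set l \<subseteq> t}) t"
      by (rule pmf_bind_map_Pair)
    show "pmf ?J1 (l, t) = pmf ?J2 (l, t)"
    \<comment> \<open>Off the support of \<open>q\<close> the conditioning event may be empty and
      \<open>cond_pmf\<close> carries no information; there both joint masses vanish.\<close>
    proof (cases "l \<in> set_pmf q")
      case False
      then have "t \<in> set_pmf \<mu> \<Longrightarrow> l \<notin> set_pmf (pmf_of_set (distinct_lists k t))"
        by (auto simp: q_def)
      then have "pmf \<mu> t * pmf (pmf_of_set (distinct_lists k t)) l = 0"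
        by (auto simp: set_pmf_iff)
      with False show ?thesis unfolding 1 2 by (simp add: set_pmf_iff)
    next
      case True
      then obtain t' where t': "t' \<in> set_pmf \<mu>" "pmf (pmf_of_set (distinct_lists k t')) l \<noteq> 0"
        by (auto simp: q_def set_pmf_iff)
      then have l: "distinct l" "length l = k" "set l \<subseteq> t'"
        unfolding pt[OF t'(1)] by (auto split: if_splits)
      then have ne: "set_pmf \<mu> \<inter> {t. set l \<subseteq> t} \<noteq> {}" using t' by auto
      then have "measure_pmf.prob \<mu> {t. set l \<subseteq> t} \<noteq> 0"
        by (rule measure_measure_pmf_not_zero)
      then have 3: "pmf ?J2 (l, t) = (if set l \<subseteq> t then pmf \<mu> t / c else 0)"
        unfolding 2 pmf_cond[OF ne] pq[OF l(1,2)] by auto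
      show ?thesis
      proof (cases "t \<in> set_pmf \<mu>")
        case True
        then show ?thesis unfolding 1 3 pt[OF True] using l by auto
      next
        case False
        then show ?thesis unfolding 1 3 by (simp add: set_pmf_iff)
      qed
    qed
  qed
  then have "bind_pmf ?J1 (\<lambda>(l, t). K l t) = bind_pmf ?J2 (\<lambda>(l, t). K l t)" by simp
  then show ?thesis
    by (simp add: bind_assoc_pmf bind_map_pmf q_def)
qed

text \<open>Chain rule and Bayes' rule combined: given the first \<open>k\<close> vertices, the next
  \<open>j\<close> form a random ordered tuple in the link of those \<open>k\<close>. This is how
  hypotheses on links reach the labelling.\<close>

lemma labelling_pmf_split:
  assumes \<mu>: "\<And>t. t \<in> set_pmf \<mu> \<Longrightarrow> finite t \<and> card t = N" and kj: "k + j \<le> N"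
  shows "map_pmf (\<lambda>x. (map x [0..<k], map x [k..<k + j])) (labelling_pmf N \<mu>) =
    bind_pmf (map_pmf (\<lambda>x. map x [0..<k]) (labelling_pmf N \<mu>)) (\<lambda>l. map_pmf (Pair l)
      (bind_pmf (cond_pmf \<mu> {t. set l \<subseteq> t}) (\<lambda>t. pmf_of_set (distinct_lists j (t - set l)))))"
proof -
  have k: "k \<le> N" using kj by simp
  have 1: "map_pmf (\<lambda>x. map x [0..<m]) (pmf_of_set (labellings N t)) = pmf_of_set (distinct_lists m t)"
    if "t \<in> set_pmf \<mu>" "m \<le> N" for t m
    using map_labellings_eq_distinct_lists[where j = 0 and k = m, unfolded add_0] \<mu> that by metis
  have 2: "map_pmf (\<lambda>x. map x [0..<k]) (labelling_pmf N \<mu>) =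
      bind_pmf \<mu> (\<lambda>t. pmf_of_set (distinct_lists k t))"
    unfolding labelling_pmf_def map_bind_pmf by (rule bind_pmf_cong[OF refl 1[OF _ k]])
  have "map_pmf (\<lambda>x. (map x [0..<k], map x [k..<k + j])) (labelling_pmf N \<mu>) =
      bind_pmf \<mu> (\<lambda>t. map_pmf (\<lambda>l. (take k l, drop k l)) (pmf_of_set (distinct_lists (k + j) t)))"
    unfolding labelling_pmf_def map_bind_pmf
    by (rule bind_pmf_cong[OF refl], subst 1[OF _ kj, symmetric])
       (simp_all add: pmf.map_comp o_def take_map drop_map)
  also have "\<dots> = bind_pmf \<mu> (\<lambda>t. bind_pmf (pmf_of_set (distinct_lists k t))
      (\<lambda>l. map_pmf (Pair l) (pmf_of_set (distinct_lists j (t - set l)))))"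
    by (rule bind_pmf_cong[OF refl], rule split_distinct_lists) (use \<mu> kj in auto)
  also have "\<dots> = bind_pmf (bind_pmf \<mu> (\<lambda>t. pmf_of_set (distinct_lists k t)))
      (\<lambda>l. bind_pmf (cond_pmf \<mu> {t. set l \<subseteq> t})
        (\<lambda>t. map_pmf (Pair l) (pmf_of_set (distinct_lists j (t - set l)))))"
    using \<mu> k by (rule sample_tuple_before_face)
  finally show ?thesis unfolding 2 map_bind_pmf .
qed

lemma ordered_face_pmf_link:
  assumes \<mu>: "\<And>t. t \<in> set_pmf \<mu> \<Longrightarrow> finite t \<and> card t = N"
    and A: "set_pmf \<mu> \<inter> {t. A \<subseteq> t} \<noteq> {}" "card A + (i + 1) \<le> N"
  shows "ordered_face_pmf i (link_pmf \<mu> A) =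
    bind_pmf (cond_pmf \<mu> {t. A \<subseteq> t}) (\<lambda>t. pmf_of_set (distinct_lists (i + 1) (t - A)))"
proof -
  have "ordered_face_pmf i (link_pmf \<mu> A) =
      bind_pmf (link_pmf \<mu> A) (\<lambda>t. pmf_of_set (distinct_lists (i + 1) t))"
  proof (rule ordered_face_pmf_eq_distinct_lists)
    fix t assume "t \<in> set_pmf (link_pmf \<mu> A)"
    then obtain s where s: "s \<in> set_pmf \<mu>" "A \<subseteq> s" "t = s - A"
      using A(1) by (auto simp: link_pmf_def)
    then show "finite t \<and> i + 1 \<le> card t"
      using \<mu>[OF s(1)] A(2) finite_subset[OF s(2)] by (auto simp: card_Diff_subset)
  qed
  then show ?thesis by (simp add: link_pmf_def bind_map_pmf)
qed

text \<open>Measurability with respect to the labels in \<open>I\<close>. Once these are frozen,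
  \<open>F x\<close> is a fixed function, to which an inequality in the link can be applied.\<close>

definition depends_only_on :: "'i set \<Rightarrow> (('i \<Rightarrow> 'a) \<Rightarrow> 'b) \<Rightarrow> bool" where
  "depends_only_on I F \<longleftrightarrow> (\<forall>x y. (\<forall>i\<in>I. x i = y i) \<longrightarrow> F x = F y)"

section \<open>Probabilities of events on the random labelling\<close>

locale random_labelling =
  fixes d :: nat and X :: "'a set set" and \<mu> :: "'a set pmf"
  assumes W: "weighted_complex d X \<mu>"
begin

definition P :: "(nat \<Rightarrow> 'a) pmf" where "P = labelling_pmf (d + 1) \<mu>"

abbreviation pr :: "((nat \<Rightarrow> 'a) \<Rightarrow> bool) \<Rightarrow> real" where
  "pr \<phi> \<equiv> measure_pmf.prob P {x. \<phi> x}"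

lemma top: "t \<in> set_pmf \<mu> \<Longrightarrow> finite t \<and> card t = d + 1"
  using top_face[OF W] by auto

lemma down: "s \<in> X \<Longrightarrow> t \<subseteq> s \<Longrightarrow> t \<in> X"
  using W by (auto simp: weighted_complex_def)

lemma top_in_X: "t \<in> set_pmf \<mu> \<Longrightarrow> t \<in> X"
  using top_face[OF W] by auto

lemma extends_to_top: "s \<in> X \<Longrightarrow> \<exists>t\<in>set_pmf \<mu>. s \<subseteq> t"
  using W by (auto simp: weighted_complex_def)

lemma P_inj: "x \<in> set_pmf P \<Longrightarrow> inj_on x {..<d + 1}"
  using set_labelling_pmf(1)[OF top] by (auto simp: P_def)

lemma P_image: "x \<in> set_pmf P \<Longrightarrow> I \<subseteq> {..<d + 1} \<Longrightarrow> x ` I \<in> X"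
  using set_labelling_pmf(2)[OF top, where x = x] down[OF top_in_X, of "x ` {..<d + 1}" "x ` I"]
  by (simp add: P_def image_mono)

lemma card_image_P: "x \<in> set_pmf P \<Longrightarrow> I \<subseteq> {..<d + 1} \<Longrightarrow> card (x ` I) = card I"
  by (rule card_image[OF inj_on_subset[OF P_inj]])

text \<open>Consequently the probability of an event about images of index sets depends only on how
  these sets intersect, and later arguments may pick any free indices.\<close>

lemma pr_permute: "\<pi> permutes {..<d + 1} \<Longrightarrow> pr (\<lambda>x. \<Psi> (x \<circ> \<pi>)) = pr \<Psi>"
proof -
  assume "\<pi> permutes {..<d + 1}"
  then have "map_pmf (\<lambda>x. x \<circ> \<pi>) P = P"
    unfolding P_def by (intro labelling_pmf_exchangeable top)
  then have "pr \<Psi> = measure_pmf.prob (map_pmf (\<lambda>x. x \<circ> \<pi>) P) {x. \<Psi> x}" by simp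
  then show ?thesis by (simp add: vimage_def)
qed

lemma pr_mono: "(\<And>x. x \<in> set_pmf P \<Longrightarrow> \<phi> x \<Longrightarrow> \<psi> x) \<Longrightarrow> pr \<phi> \<le> pr \<psi>"
  by (rule measure_pmf.finite_measure_mono_AE) (auto simp: AE_measure_pmf_iff)

lemma pr_cong: "(\<And>x. x \<in> set_pmf P \<Longrightarrow> \<phi> x \<longleftrightarrow> \<psi> x) \<Longrightarrow> pr \<phi> = pr \<psi>"
  by (rule measure_pmf.finite_measure_eq_AE) (auto simp: AE_measure_pmf_iff)

lemma pr_disj: "pr \<phi> \<le> a \<Longrightarrow> pr \<psi> \<le> b \<Longrightarrow> pr (\<lambda>x. \<phi> x \<or> \<psi> x) \<le> a + b"
proof -
  assume "pr \<phi> \<le> a" "pr \<psi> \<le> b"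
  moreover have "{x. \<phi> x \<or> \<psi> x} = {x. \<phi> x} \<union> {x. \<psi> x}" by auto
  ultimately show ?thesis
    using measure_Un_le[of "{x. \<phi> x}" "measure_pmf P" "{x. \<psi> x}"] by simp
qed

lemma pr_le:
  assumes "\<And>x. x \<in> set_pmf P \<Longrightarrow> \<phi> x \<Longrightarrow> \<psi> x" "pr \<psi> \<le> a"
  shows "pr \<phi> \<le> a"
  using pr_mono[of \<phi> \<psi>] assms by force

lemma finite_set_P: "finite (set_pmf P)"
proof -
  have "finite (set_pmf \<mu>)" using W by (auto simp: weighted_complex_def faces_def)
  moreover have "set_pmf P \<subseteq> (\<Union>t\<in>set_pmf \<mu>. labellings (d + 1) t)"
  proof
    fix x assume "x \<in> set_pmf P"
    then obtain t where t: "t \<in> set_pmf \<mu>" "x \<in> set_pmf (pmf_of_set (labellings (d + 1) t))"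
      by (auto simp: P_def labelling_pmf_def)
    then show "x \<in> (\<Union>t\<in>set_pmf \<mu>. labellings (d + 1) t)"
      using finite_labellings[of t "d + 1"] labellings_nonempty[of t "d + 1"] top[OF t(1)] by auto
  qed
  ultimately show ?thesis
    using top finite_labellings by (meson finite_UN_I finite_subset)
qed

lemma pr_split:
  assumes "k + (i + 1) \<le> d + 1"
  shows "pr (\<lambda>x. map x [k..<k + (i + 1)] \<in> S (map x [0..<k])) =
    measure_pmf.expectation P (\<lambda>x. measure_pmf.prob (ordered_face_pmf i (link_pmf \<mu> (x ` {..<k}))) (S (map x [0..<k])))"
proof -
  let ?D = "\<lambda>l. bind_pmf (cond_pmf \<mu> {t. set l \<subseteq> t}) (\<lambda>t. pmf_of_set (distinct_lists (i + 1) (t - set l)))"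
  have eq: "map_pmf (\<lambda>x. (map x [0..<k], map x [k..<k + (i + 1)])) P =
      bind_pmf P (\<lambda>x. map_pmf (Pair (map x [0..<k])) (?D (map x [0..<k])))"
    unfolding P_def by (subst labelling_pmf_split[OF top assms]) (simp_all only: bind_map_pmf)
  have "pr (\<lambda>x. map x [k..<k + (i + 1)] \<in> S (map x [0..<k])) =
      measure_pmf.prob (map_pmf (\<lambda>x. (map x [0..<k], map x [k..<k + (i + 1)])) P) {(l, m). m \<in> S l}"
    by (simp add: vimage_def del: upt_Suc)
  also have "\<dots> = measure_pmf.prob (bind_pmf P (\<lambda>x. map_pmf (Pair (map x [0..<k])) (?D (map x [0..<k])))) {(l, m). m \<in> S l}"
    unfolding eq ..
  also have "\<dots> = measure_pmf.expectation P (\<lambda>x. measure_pmf.prob (?D (map x [0..<k])) (S (map x [0..<k])))"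
    by (simp only: prob_bind_pmf measure_map_pmf vimage_def mem_Collect_eq split_conv Collect_mem_eq)
  also have "\<dots> = measure_pmf.expectation P (\<lambda>x. measure_pmf.prob (ordered_face_pmf i (link_pmf \<mu> (x ` {..<k}))) (S (map x [0..<k])))"
  proof (rule integral_cong_AE)
    show "AE x in P. measure_pmf.prob (?D (map x [0..<k])) (S (map x [0..<k])) =
      measure_pmf.prob (ordered_face_pmf i (link_pmf \<mu> (x ` {..<k}))) (S (map x [0..<k]))"
    proof (rule AE_pmfI)
      fix x assume x: "x \<in> set_pmf P"
      have s: "set (map x [0..<k]) = x ` {..<k}" by (simp add: lessThan_atLeast0)
      have "card (x ` {..<k}) = k"
        using card_image_P[OF x, of "{..<k}"] assms by simp
      moreover have "set_pmf \<mu> \<inter> {t. x ` {..<k} \<subseteq> t} \<noteq> {}"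
        using extends_to_top[OF P_image[OF x, of "{..<k}"]] assms by auto
      ultimately have "ordered_face_pmf i (link_pmf \<mu> (x ` {..<k})) = ?D (map x [0..<k])"
        unfolding s using assms by (intro ordered_face_pmf_link[OF top]) auto
      then show "measure_pmf.prob (?D (map x [0..<k])) (S (map x [0..<k])) =
        measure_pmf.prob (ordered_face_pmf i (link_pmf \<mu> (x ` {..<k}))) (S (map x [0..<k]))"
        by simp
    qed
  qed auto
  finally show ?thesis .
qed

text \<open>An inequality that holds in every link is averaged over the link. The two sides have
  separate dimensions because a vertex event is bounded by an edge event (plurality), or an edge
  event by a triangle event (coboundary expansion).\<close>

lemma pr_le_from_links:
  assumes "k + (i + 1) \<le> d + 1" "k + (j + 1) \<le> d + 1"
    and "\<And>x. x \<in> set_pmf P \<Longrightarrow>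
      b * measure_pmf.prob (ordered_face_pmf i (link_pmf \<mu> (x ` {..<k}))) (S (map x [0..<k])) \<le>
      c * measure_pmf.prob (ordered_face_pmf j (link_pmf \<mu> (x ` {..<k}))) (T (map x [0..<k]))"
  shows "b * pr (\<lambda>x. map x [k..<k + (i + 1)] \<in> S (map x [0..<k])) \<le>
    c * pr (\<lambda>x. map x [k..<k + (j + 1)] \<in> T (map x [0..<k]))"
proof -
  have "measure_pmf.expectation P (\<lambda>x. b * measure_pmf.prob (ordered_face_pmf i (link_pmf \<mu> (x ` {..<k}))) (S (map x [0..<k])))
    \<le> measure_pmf.expectation P (\<lambda>x. c * measure_pmf.prob (ordered_face_pmf j (link_pmf \<mu> (x ` {..<k}))) (T (map x [0..<k])))"
    by (rule integral_mono_AE)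
       (use assms(3) in \<open>auto simp: AE_measure_pmf_iff intro: integrable_measure_pmf_finite finite_set_P\<close>)
  then show ?thesis unfolding pr_split[OF assms(1)] pr_split[OF assms(2)] by simp
qed

text \<open>\<open>pr_split\<close> conditions on an initial segment of the labels; this moves an
  arbitrary index set there and the indices in \<open>l\<close> right behind it. The order inside
  \<open>I\<close> stays arbitrary.\<close>

lemma exists_aligning_permutation:
  assumes "finite I" "distinct l" "set l \<inter> I = {}" "I \<union> set l \<subseteq> {..<d + 1}"
  shows "\<exists>\<pi>. \<pi> permutes {..<d + 1} \<and> \<pi> ` {..<card I} = I \<and>
    (\<forall>i<length l. \<pi> (card I + i) = l ! i)"
proof -
  obtain e where e: "set e = I" "distinct e" using assms(1) finite_distinct_list by auto
  then have le: "length e = card I" using distinct_card[OF e(2)] by simp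
  have "set (e @ l) \<subseteq> {..<d + 1}" "distinct (e @ l)" using e assms by auto
  moreover from this have "length (e @ l) \<le> d + 1"
    by (metis card_lessThan card_mono distinct_card finite_lessThan)
  ultimately obtain \<pi> where \<pi>: "\<pi> permutes {..<d + 1}" "map \<pi> [0..<length (e @ l)] = e @ l"
    using permutation_mapping_distinct_lists[of "{..<d + 1}" "[0..<length (e @ l)]" "e @ l"]
    by (auto simp: atLeast0LessThan)
  have \<pi>i: "\<pi> i = (e @ l) ! i" if "i < length (e @ l)" for i
    using arg_cong[OF \<pi>(2), of "\<lambda>z. z ! i"] that by simp
  have "\<pi> ` {..<card I} = set e"
    using \<pi>i by (force simp: nth_append le[symmetric] in_set_conv_nth)
  moreover have "\<pi> (card I + i) = l ! i" if "i < length l" for i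
    using \<pi>i[of "card I + i"] that by (simp add: nth_append le)
  ultimately show ?thesis using \<pi>(1) e(1) by blast
qed

end

subsection \<open>Consequences of local expansion for random labellings\<close>

locale spectral_labelling = random_labelling +
  fixes lam :: real
  assumes spectral: "two_sided_local_spectral_expander d X \<mu> lam" and lam: "lam \<le> 1 / 2"
begin

text \<open>The weighted graph of the link has as weights the laws of \<open>x 0\<close> and
  \<open>(x 0, x 1)\<close> for a random labelling of its top faces, so exchangeability makes the
  weights symmetric. The bound on \<open>card A\<close> says that \<open>A\<close> has dimension at
  most \<open>d - 2\<close>.\<close>

lemma link_plurality:
  fixes F :: "'a \<Rightarrow> 'c"
  assumes A: "A \<in> X" "card A + 2 \<le> d + 1"
  shows "\<exists>v. measure_pmf.prob (ordered_face_pmf 0 (link_pmf \<mu> A)) {m. F (m ! 0) \<noteq> F v} \<le>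
    2 * measure_pmf.prob (ordered_face_pmf 1 (link_pmf \<mu> A)) {m. F (m ! 0) \<noteq> F (m ! 1)}"
proof -
  define \<nu> where "\<nu> = link_pmf \<mu> A"
  define N where "N = d + 1 - card A"
  define V where "V = {v. {v} \<in> link_faces X A}"
  have fA: "finite A" using W A(1) by (auto simp: weighted_complex_def)
  have ne: "set_pmf \<mu> \<inter> {t. A \<subseteq> t} \<noteq> {}" using extends_to_top[OF A(1)] by auto
  have s\<nu>: "set_pmf \<nu> = (\<lambda>t. t - A) ` (set_pmf \<mu> \<inter> {t. A \<subseteq> t})"
    using ne by (simp add: \<nu>_def link_pmf_def)
  have \<nu>: "finite t \<and> card t = N" if "t \<in> set_pmf \<nu>" for t
    using that top fA by (auto simp: s\<nu> N_def card_Diff_subset)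
  have N: "2 \<le> N" using A(2) by (simp add: N_def)
  define L where "L = labelling_pmf N \<nu>"
  have o0: "ordered_face_pmf 0 \<nu> = map_pmf (\<lambda>x. [x 0]) L"
    using ordered_face_pmf_eq_labelling[OF \<nu>, where k = 0] N by (simp add: L_def)
  have o1: "ordered_face_pmf 1 \<nu> = map_pmf (\<lambda>x. [x 0, x 1]) L"
    using ordered_face_pmf_eq_labelling[OF \<nu>, where k = 1] N by (simp add: L_def)
  define w where "w u v = pmf (ordered_face_pmf 1 \<nu>) [u, v]" for u v
  define w1 where "w1 u = pmf (ordered_face_pmf 0 \<nu>) [u]" for u
  have w: "w u v = measure_pmf.prob L {x. x 0 = u \<and> x 1 = v}" for u v
    unfolding w_def o1 pmf_map by (auto simp: vimage_def)
  have w1: "w1 u = measure_pmf.prob L {x. x 0 = u}" for u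
    unfolding w1_def o0 pmf_map by (auto simp: vimage_def)
  have LV: "x i \<in> V" if "x \<in> set_pmf L" "i < N" for x i
  proof -
    have "x ` {..<N} \<in> set_pmf \<nu>"
      using set_labelling_pmf(2)[OF \<nu>] that(1) by (auto simp: L_def)
    then obtain t where t: "t \<in> set_pmf \<mu>" "A \<subseteq> t" "x ` {..<N} = t - A" by (auto simp: s\<nu>)
    then have xi: "x i \<in> t - A" using that(2) by blast
    then have "insert (x i) A \<in> X" using down[OF top_in_X[OF t(1)]] t(2) by auto
    then show ?thesis using xi by (auto simp: V_def link_faces_def intro!: exI[of _ "insert (x i) A"])
  qed
  have finX: "finite (\<Union>X)" using W by (auto simp: weighted_complex_def)
  have "V \<subseteq> \<Union>X" by (auto simp: V_def link_faces_def)
  then have fV: "finite V" using finX finite_subset by auto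
  obtain x0 where "x0 \<in> set_pmf L" using set_pmf_not_empty by fast
  then have neV: "V \<noteq> {}" using LV[of x0 0] N by auto
  have sym: "w u v = w v u" for u v
  proof -
    have tr: "Transposition.transpose 0 1 permutes {..<N}"
      using N by (intro permutes_swap_id) auto
    have "L = map_pmf (\<lambda>x. x \<circ> Transposition.transpose 0 1) L"
      unfolding L_def using labelling_pmf_exchangeable[OF \<nu> tr] by simp
    then have "w u v = measure_pmf.prob (map_pmf (\<lambda>x. x \<circ> Transposition.transpose 0 1) L) {x. x 0 = u \<and> x 1 = v}"
      unfolding w by simp
    also have "\<dots> = measure_pmf.prob L {x. x 1 = u \<and> x 0 = v}"
      by (simp add: vimage_def)
    finally show ?thesis unfolding w by (simp add: conj_commute)
  qed
  have nonneg: "0 \<le> w u v" for u v by (simp add: w_def)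
  have sumV: "measure_pmf.prob L {x. Q x} = (\<Sum>v\<in>V. measure_pmf.prob L {x. Q x \<and> x i = v})"
    if i: "i < N" for Q i
  proof -
    have "measure_pmf.prob L {x. Q x} = measure_pmf.prob L (\<Union>v\<in>V. {x. Q x \<and> x i = v})"
      by (rule measure_pmf.finite_measure_eq_AE) (use LV i in \<open>auto simp: AE_measure_pmf_iff\<close>)
    also have "\<dots> = (\<Sum>v\<in>V. measure_pmf.prob L {x. Q x \<and> x i = v})"
      by (rule measure_pmf.finite_measure_finite_Union) (use fV in \<open>auto simp: disjoint_family_on_def\<close>)
    finally show ?thesis .
  qed
  have w1s: "w1 u = (\<Sum>v\<in>V. w u v)" for u
    unfolding w1 w using sumV[of 1 "\<lambda>x. x 0 = u"] N by simp
  \<comment> \<open>Full support of \<open>\<mu>\<close> enters here: \<open>u\<close> together with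
    \<open>A\<close> lies in a top face of positive probability.\<close>
  have pos: "0 < w1 u" if u: "u \<in> V" for u
  proof -
    obtain s where s: "s \<in> X" "A \<subseteq> s" "{u} = s - A" using u by (auto simp: V_def link_faces_def)
    obtain t where t: "t \<in> set_pmf \<mu>" "s \<subseteq> t" using extends_to_top[OF s(1)] by auto
    have ut: "u \<in> t - A" using s t by auto
    have t\<nu>: "t - A \<in> set_pmf \<nu>" using s t by (auto simp: s\<nu>)
    note D = distinct_lists[of "t - A" 1]
    have "[u] \<in> set_pmf (pmf_of_set (distinct_lists 1 (t - A)))"
      using D(1,2) \<nu>[OF t\<nu>] N ut by (subst set_pmf_of_set) (auto simp: distinct_lists_def)
    then have "[u] \<in> set_pmf (ordered_face_pmf 0 \<nu>)"
      using t\<nu> \<nu> N by (subst ordered_face_pmf_eq_distinct_lists) auto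
    then show ?thesis by (simp add: w1_def pmf_positive)
  qed
  have total: "(\<Sum>u\<in>V. w1 u) = 1"
    unfolding w1 using sumV[of 0 "\<lambda>_. True"] N by simp
  have eig: "\<theta> \<le> 1 / 2"
    if e: "\<forall>u\<in>V. (\<Sum>v\<in>V. w u v * g v) = \<theta> * (w1 u * g u)" "\<exists>u\<in>V. \<exists>v\<in>V. g u \<noteq> g v"
    for \<theta> and g :: "'a \<Rightarrow> real"
  proof -
    have "(\<Sum>v\<in>V. adj \<nu> u v * g v) = \<theta> * g u" if u: "u \<in> V" for u
    proof -
      have "(\<Sum>v\<in>V. adj \<nu> u v * g v) = (\<Sum>v\<in>V. w u v * g v) / w1 u"
        unfolding sum_divide_distrib by (rule sum.cong[OF refl]) (simp add: adj_def w_def w1_def)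
      also have "\<dots> = \<theta> * g u" using e(1) u pos[OF u] by simp
      finally show ?thesis .
    qed
    then have "nontrivial_eigenvalue (link_faces X A) \<nu> \<theta>"
      unfolding nontrivial_eigenvalue_def V_def[symmetric]
      using e(2) by (intro exI[of _ g]) (auto simp: V_def)
    moreover have "A \<in> faces X (int (card A) - 1)" using A(1) by (simp add: faces_def)
    moreover have "int (card A) - 1 \<in> {-1..int d - 2}" using A(2) by simp
    ultimately have "\<bar>\<theta>\<bar> \<le> lam"
      using spectral unfolding two_sided_local_spectral_expander_def \<nu>_def by blast
    then show ?thesis using lam by linarith
  qed
  from fV neV sym nonneg w1s pos total eig
  have "\<exists>v0\<in>V. (\<Sum>u\<in>V. if F u \<noteq> F v0 then w1 u else 0) \<le>
      2 * (\<Sum>u\<in>V. \<Sum>v\<in>V. if F u \<noteq> F v then w u v else 0)"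
    by (intro plurality_from_eigenvalues[where ?w1.0 = w1])
  then obtain v0 where v0: "(\<Sum>u\<in>V. if F u \<noteq> F v0 then w1 u else 0) \<le>
      2 * (\<Sum>u\<in>V. \<Sum>v\<in>V. if F u \<noteq> F v then w u v else 0)"
    by blast
  have "measure_pmf.prob (ordered_face_pmf 0 \<nu>) {m. F (m ! 0) \<noteq> F v0} =
      measure_pmf.prob L {x. F (x 0) \<noteq> F v0}"
    unfolding o0 by (simp add: vimage_def)
  also have "\<dots> = (\<Sum>u\<in>V. measure_pmf.prob L {x. F (x 0) \<noteq> F v0 \<and> x 0 = u})"
    by (rule sumV) (use N in simp)
  also have "\<dots> = (\<Sum>u\<in>V. if F u \<noteq> F v0 then w1 u else 0)"
  proof (rule sum.cong[OF refl])
    fix u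
    have "{x :: nat \<Rightarrow> 'a. F (x 0) \<noteq> F v0 \<and> x 0 = u} = (if F u \<noteq> F v0 then {x. x 0 = u} else {})" by auto
    then show "measure_pmf.prob L {x. F (x 0) \<noteq> F v0 \<and> x 0 = u} = (if F u \<noteq> F v0 then w1 u else 0)"
      by (simp add: w1)
  qed
  finally have a: "measure_pmf.prob (ordered_face_pmf 0 \<nu>) {m. F (m ! 0) \<noteq> F v0} =
      (\<Sum>u\<in>V. if F u \<noteq> F v0 then w1 u else 0)" .
  have "measure_pmf.prob (ordered_face_pmf 1 \<nu>) {m. F (m ! 0) \<noteq> F (m ! 1)} =
      measure_pmf.prob L {x. F (x 0) \<noteq> F (x 1)}"
    unfolding o1 by (simp add: vimage_def)
  also have "\<dots> = (\<Sum>u\<in>V. measure_pmf.prob L {x. F (x 0) \<noteq> F (x 1) \<and> x 0 = u})"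
    by (rule sumV) (use N in simp)
  also have "\<dots> = (\<Sum>u\<in>V. \<Sum>v\<in>V. measure_pmf.prob L {x. (F (x 0) \<noteq> F (x 1) \<and> x 0 = u) \<and> x 1 = v})"
    by (rule sum.cong[OF refl], rule sumV) (use N in auto)
  also have "\<dots> = (\<Sum>u\<in>V. \<Sum>v\<in>V. if F u \<noteq> F v then w u v else 0)"
  proof (rule sum.cong[OF refl], rule sum.cong[OF refl])
    fix u v
    have "{x :: nat \<Rightarrow> 'a. (F (x 0) \<noteq> F (x 1) \<and> x 0 = u) \<and> x 1 = v} =
        (if F u \<noteq> F v then {x. x 0 = u \<and> x 1 = v} else {})" by auto
    then show "measure_pmf.prob L {x. (F (x 0) \<noteq> F (x 1) \<and> x 0 = u) \<and> x 1 = v} =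
        (if F u \<noteq> F v then w u v else 0)"
      by (simp only: w split: if_split) simp
  qed
  finally show ?thesis using v0 a by (intro exI[of _ v0]) (simp add: \<nu>_def)
qed

text \<open>That \<open>C\<close> sees \<open>x\<close> only through \<open>x ` I\<close> and \<open>F x\<close> is what makes the approximating constants
  cochains later on.\<close>

lemma vertex_plurality:
  "\<exists>C :: 'a set \<Rightarrow> ('a \<Rightarrow> 'c) \<Rightarrow> 'c. (\<forall>A F. C A F \<in> range F) \<and>
    (\<forall>I a b F. depends_only_on I F \<longrightarrow> finite I \<longrightarrow> a \<noteq> b \<longrightarrow> a \<notin> I \<longrightarrow> b \<notin> I \<longrightarrow>
       insert a (insert b I) \<subseteq> {..<d + 1} \<longrightarrow>
       pr (\<lambda>x. F x (x a) \<noteq> C (x ` I) (F x)) \<le> 2 * pr (\<lambda>x. F x (x a) \<noteq> F x (x b)))"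
proof -
  define good where "good A F v \<longleftrightarrow>
    measure_pmf.prob (ordered_face_pmf 0 (link_pmf \<mu> A)) {m. F (m ! 0) \<noteq> F v} \<le>
    2 * measure_pmf.prob (ordered_face_pmf 1 (link_pmf \<mu> A)) {m. F (m ! 0) \<noteq> F (m ! 1)}"
    for A and F :: "'a \<Rightarrow> 'c" and v
  \<comment> \<open>Choosing a vertex and returning its value keeps \<open>C A F\<close> in the
    range of \<open>F\<close> even where no good vertex exists. Later this puts plurality values
    into the carrier of the group.\<close>
  define C where "C A F = F (SOME v. good A F v)" for A F
  have good: "measure_pmf.prob (ordered_face_pmf 0 (link_pmf \<mu> A)) {m. F (m ! 0) \<noteq> C A F} \<le>
    2 * measure_pmf.prob (ordered_face_pmf 1 (link_pmf \<mu> A)) {m. F (m ! 0) \<noteq> F (m ! 1)}"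
    if "A \<in> X" "card A + 2 \<le> d + 1" for A F
    using link_plurality[OF that, of F] someI_ex[of "good A F"] by (simp add: good_def C_def)
  have "pr (\<lambda>x. F x (x a) \<noteq> C (x ` I) (F x)) \<le> 2 * pr (\<lambda>x. F x (x a) \<noteq> F x (x b))"
    if F: "depends_only_on I F" and I: "finite I" "a \<noteq> b" "a \<notin> I" "b \<notin> I" "insert a (insert b I) \<subseteq> {..<d + 1}"
    for I a b F
  proof -
    define k where "k = card I"
    have "card (insert a (insert b I)) \<le> card {..<d + 1}" using I(5) by (intro card_mono) auto
    then have k: "k + 2 \<le> d + 1" using I by (simp add: k_def)
    obtain \<pi> where \<pi>: "\<pi> permutes {..<d + 1}" "\<pi> ` {..<k} = I"
        "\<forall>i<length [a, b]. \<pi> (k + i) = [a, b] ! i"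
      using exists_aligning_permutation[of I "[a, b]"] I unfolding k_def by auto
    have \<pi>ab: "\<pi> k = a" "\<pi> (Suc k) = b" using \<pi>(3)[rule_format, of 0] \<pi>(3)[rule_format, of 1] by auto
    \<comment> \<open>\<open>F\<close> rewritten as a function of the list of conditioned vertices.
      Indices outside \<open>I\<close> read meaningless list entries, which \<open>F\<close> does
      not see.\<close>
    define F' where "F' l = F (\<lambda>i. l ! (inv_into UNIV \<pi> i))" for l
    have F': "F' (map (x \<circ> \<pi>) [0..<k]) = F x" for x
    proof -
      have "(map (x \<circ> \<pi>) [0..<k]) ! (inv_into UNIV \<pi> i) = x i" if i: "i \<in> I" for i
      proof -
        obtain j where j: "j < k" "i = \<pi> j" using i \<pi>(2) by auto
        then show ?thesis by (simp add: permutes_inverses[OF \<pi>(1)])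
      qed
      then show ?thesis
        unfolding F'_def by (intro F[unfolded depends_only_on_def, rule_format])
    qed
    have i: "(x \<circ> \<pi>) ` {..<k} = x ` I" for x unfolding image_comp[symmetric] \<pi>(2) ..
    have "1 * pr (\<lambda>x. map x [k..<k + (0 + 1)] \<in> {m. F' (map x [0..<k]) (m ! 0) \<noteq> C (set (map x [0..<k])) (F' (map x [0..<k]))}) \<le>
        2 * pr (\<lambda>x. map x [k..<k + (1 + 1)] \<in> {m. F' (map x [0..<k]) (m ! 0) \<noteq> F' (map x [0..<k]) (m ! 1)})"
    proof (rule pr_le_from_links)
      fix x assume x: "x \<in> set_pmf P"
      have s: "set (map x [0..<k]) = x ` {..<k}" by (simp add: lessThan_atLeast0)
      have "card (x ` {..<k}) = k"
        using card_image_P[OF x, of "{..<k}"] k by simp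
      then have c: "card (x ` {..<k}) + 2 \<le> d + 1" using k by simp
      have xX: "x ` {..<k} \<in> X" by (rule P_image[OF x]) (use k in auto)
      show "1 * measure_pmf.prob (ordered_face_pmf 0 (link_pmf \<mu> (x ` {..<k})))
         {m. F' (map x [0..<k]) (m ! 0) \<noteq> C (set (map x [0..<k])) (F' (map x [0..<k]))}
        \<le> 2 * measure_pmf.prob (ordered_face_pmf 1 (link_pmf \<mu> (x ` {..<k})))
            {m. F' (map x [0..<k]) (m ! 0) \<noteq> F' (map x [0..<k]) (m ! 1)}"
        using good[OF xX c] by (simp only: s mult_1)
    qed (use k in auto)
    then have "pr (\<lambda>x. F' (map x [0..<k]) (x k) \<noteq> C (x ` {..<k}) (F' (map x [0..<k]))) \<le>
        2 * pr (\<lambda>x. F' (map x [0..<k]) (x k) \<noteq> F' (map x [0..<k]) (x (Suc k)))"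
      by (simp add: lessThan_atLeast0 nth_append)
    moreover have "pr (\<lambda>x. F x (x a) \<noteq> C (x ` I) (F x)) =
        pr (\<lambda>x. F' (map x [0..<k]) (x k) \<noteq> C (x ` {..<k}) (F' (map x [0..<k])))"
      using pr_permute[OF \<pi>(1), of "\<lambda>x. F' (map x [0..<k]) (x k) \<noteq> C (x ` {..<k}) (F' (map x [0..<k]))"]
      by (simp only: F' i o_apply \<pi>ab)
    moreover have "pr (\<lambda>x. F x (x a) \<noteq> F x (x b)) =
        pr (\<lambda>x. F' (map x [0..<k]) (x k) \<noteq> F' (map x [0..<k]) (x (Suc k)))"
      using pr_permute[OF \<pi>(1), of "\<lambda>x. F' (map x [0..<k]) (x k) \<noteq> F' (map x [0..<k]) (x (Suc k))"]
      by (simp only: F' i o_apply \<pi>ab)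
    ultimately show ?thesis by simp
  qed
  then show ?thesis by (intro exI[of _ C]) (auto simp: C_def)
qed

lemma pr_swap:
  assumes "a < d + 1" "b < d + 1"
  shows "pr (\<lambda>x. \<Psi> (x \<circ> Transposition.transpose a b)) = pr \<Psi>"
  using assms by (intro pr_permute permutes_swap_id) auto

text \<open>Induction on \<open>|U|\<close>: approximate \<open>F\<close> by a function of one vertex, then that by a constant.\<close>

lemma set_plurality:
  "\<exists>C :: 'a set \<Rightarrow> ('a set \<Rightarrow> 'c) \<Rightarrow> 'c. (\<forall>A F. C A F \<in> range F) \<and>
    (\<forall>I U a b F. depends_only_on I F \<longrightarrow> finite I \<longrightarrow> finite U \<longrightarrow> card U = m \<longrightarrow> I \<inter> U = {} \<longrightarrow>
       a \<noteq> b \<longrightarrow> a \<notin> I \<union> U \<longrightarrow> b \<notin> I \<union> U \<longrightarrow> insert a (insert b (I \<union> U)) \<subseteq> {..<d + 1} \<longrightarrow>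
       pr (\<lambda>x. F x (x ` insert a U) \<noteq> C (x ` I) (F x)) \<le>
         7 ^ (m + 1) * pr (\<lambda>x. F x (x ` insert a U) \<noteq> F x (x ` insert b U)))"
proof (induction m)
  case 0
  obtain C :: "'a set \<Rightarrow> ('a \<Rightarrow> 'c) \<Rightarrow> 'c" where C: "\<forall>A F. C A F \<in> range F"
    "\<forall>I a b F. depends_only_on I F \<longrightarrow> finite I \<longrightarrow> a \<noteq> b \<longrightarrow> a \<notin> I \<longrightarrow> b \<notin> I \<longrightarrow>
       insert a (insert b I) \<subseteq> {..<d + 1} \<longrightarrow>
       pr (\<lambda>x. F x (x a) \<noteq> C (x ` I) (F x)) \<le> 2 * pr (\<lambda>x. F x (x a) \<noteq> F x (x b))"
    using vertex_plurality[where ?'c = 'c] by (elim exE conjE) (rule that; assumption)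
  show ?case
  proof (intro exI[of _ "\<lambda>A F. C A (\<lambda>v. F {v})"] conjI allI impI)
    fix A and F :: "'a set \<Rightarrow> 'c"
    show "C A (\<lambda>v. F {v}) \<in> range F" using C(1)[rule_format, of A "\<lambda>v. F {v}"] by auto
  next
    fix I U :: "nat set" and a b and F :: "(nat \<Rightarrow> 'a) \<Rightarrow> 'a set \<Rightarrow> 'c"
    assume as: "depends_only_on I F" "finite I" "finite U" "card U = 0" "a \<noteq> b" "a \<notin> I \<union> U"
      "b \<notin> I \<union> U" "insert a (insert b (I \<union> U)) \<subseteq> {..<d + 1}"
    have "depends_only_on I (\<lambda>x v. F x {v})" using as(1) by (simp add: depends_only_on_def) metis
    then have "pr (\<lambda>x. F x {x a} \<noteq> C (x ` I) (\<lambda>v. F x {v})) \<le> 2 * pr (\<lambda>x. F x {x a} \<noteq> F x {x b})"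
      using C(2)[rule_format, of I "\<lambda>x v. F x {v}" a b] as by auto
    also have "\<dots> \<le> 7 * pr (\<lambda>x. F x {x a} \<noteq> F x {x b})" by (intro mult_right_mono) auto
    finally show "pr (\<lambda>x. F x (x ` insert a U) \<noteq> C (x ` I) (\<lambda>v. F x {v})) \<le>
        7 ^ (0 + 1) * pr (\<lambda>x. F x (x ` insert a U) \<noteq> F x (x ` insert b U))"
      using as(3,4) by simp
  qed
next
  case (Suc m)
  obtain C0 :: "'a set \<Rightarrow> ('a \<Rightarrow> 'c) \<Rightarrow> 'c" where C0: "\<forall>A F. C0 A F \<in> range F"
    "\<forall>I a b F. depends_only_on I F \<longrightarrow> finite I \<longrightarrow> a \<noteq> b \<longrightarrow> a \<notin> I \<longrightarrow> b \<notin> I \<longrightarrow>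
       insert a (insert b I) \<subseteq> {..<d + 1} \<longrightarrow>
       pr (\<lambda>x. F x (x a) \<noteq> C0 (x ` I) (F x)) \<le> 2 * pr (\<lambda>x. F x (x a) \<noteq> F x (x b))"
    using vertex_plurality[where ?'c = 'c] by (elim exE conjE) (rule that; assumption)
  obtain C :: "'a set \<Rightarrow> ('a set \<Rightarrow> 'c) \<Rightarrow> 'c" where C: "\<forall>A F. C A F \<in> range F"
    "\<forall>I U a b F. depends_only_on I F \<longrightarrow> finite I \<longrightarrow> finite U \<longrightarrow> card U = m \<longrightarrow> I \<inter> U = {} \<longrightarrow>
       a \<noteq> b \<longrightarrow> a \<notin> I \<union> U \<longrightarrow> b \<notin> I \<union> U \<longrightarrow> insert a (insert b (I \<union> U)) \<subseteq> {..<d + 1} \<longrightarrow>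
       pr (\<lambda>x. F x (x ` insert a U) \<noteq> C (x ` I) (F x)) \<le>
         7 ^ (m + 1) * pr (\<lambda>x. F x (x ` insert a U) \<noteq> F x (x ` insert b U))"
    using Suc.IH by (elim exE conjE) (rule that; assumption)
  \<comment> \<open>With \<open>v\<close> frozen the induction hypothesis applies over the larger
    conditioning set \<open>insert q I\<close>, where \<open>q\<close> is the label of
    \<open>v\<close>.\<close>
  define c where "c A F v = C (insert v A) (\<lambda>u. F (insert v u))" for A v and F :: "'a set \<Rightarrow> 'c"
  show ?case
  proof (intro exI[of _ "\<lambda>A F. C0 A (c A F)"] conjI allI impI)
    fix A and F :: "'a set \<Rightarrow> 'c"
    obtain v where "C0 A (c A F) = c A F v" using C0(1)[rule_format, of A "c A F"] by auto
    moreover have "c A F v \<in> range (\<lambda>u. F (insert v u))" unfolding c_def using C(1) by blast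
    ultimately show "C0 A (c A F) \<in> range F" by auto
  next
    fix I U' :: "nat set" and a b and F :: "(nat \<Rightarrow> 'a) \<Rightarrow> 'a set \<Rightarrow> 'c"
    assume as: "depends_only_on I F" "finite I" "finite U'" "card U' = Suc m" "I \<inter> U' = {}"
      "a \<noteq> b" "a \<notin> I \<union> U'" "b \<notin> I \<union> U'" "insert a (insert b (I \<union> U')) \<subseteq> {..<d + 1}"
    then obtain e U where U: "U' = insert e U" "e \<notin> U" "card U = m" "finite U"
      by (metis card_Suc_eq finite_insert)
    define E where "E = pr (\<lambda>x. F x (x ` insert a U') \<noteq> F x (x ` insert b U'))"
    have dep: "F (x \<circ> Transposition.transpose p q) = F x" if "p \<notin> I" "q \<notin> I" for x p q
    proof -
      have "\<forall>i\<in>I. (x \<circ> Transposition.transpose p q) i = x i"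
        using that by (metis comp_apply transpose_apply_other)
      then show ?thesis using as(1) unfolding depends_only_on_def by blast
    qed
    have IH: "pr (\<lambda>x. F x (x ` insert q (insert p U)) \<noteq> c (x ` I) (F x) (x q)) \<le>
        7 ^ (m + 1) * pr (\<lambda>x. F x (x ` insert q (insert p U)) \<noteq> F x (x ` insert q (insert s U)))"
      if "p \<noteq> q" "p \<noteq> s" "q \<noteq> s" "p \<notin> I \<union> U" "q \<notin> I \<union> U" "s \<notin> I \<union> U" "{p, q, s} \<subseteq> {..<d + 1}" for p q s
    proof -
      have "depends_only_on (insert q I) (\<lambda>x u. F x (insert (x q) u))"
        unfolding depends_only_on_def
      proof (intro allI impI)
        fix x y :: "nat \<Rightarrow> 'a" assume xy: "\<forall>i\<in>insert q I. x i = y i"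
        then have "F x = F y" using as(1) unfolding depends_only_on_def by blast
        then show "(\<lambda>u. F x (insert (x q) u)) = (\<lambda>u. F y (insert (y q) u))" using xy by simp
      qed
      from C(2)[rule_format, OF this, of U p s] that as U
      show ?thesis by (auto simp: c_def)
    qed
    have depc: "depends_only_on I (\<lambda>x. c (x ` I) (F x))"
      unfolding depends_only_on_def
    proof (intro allI impI)
      fix x y :: "nat \<Rightarrow> 'a" assume xy: "\<forall>i\<in>I. x i = y i"
      then have "F x = F y" using as(1) unfolding depends_only_on_def by blast
      moreover have "x ` I = y ` I" using xy by (auto simp: image_def)
      ultimately show "c (x ` I) (F x) = c (y ` I) (F y)" by simp
    qed
    have ne: "e \<noteq> a" "e \<noteq> b" using as(7,8) U by auto
    have lt: "a < d + 1" "b < d + 1" "e < d + 1" using as(9) U by auto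
    have nI: "a \<notin> I \<union> U" "b \<notin> I \<union> U" "e \<notin> I \<union> U" using as U by auto
    have tU: "(x \<circ> Transposition.transpose p q) ` U = x ` U" if "p \<notin> U" "q \<notin> U" for p q x
      by (rule image_cong[OF refl]) (use that in \<open>metis comp_apply transpose_apply_other\<close>)
    \<comment> \<open>The one-vertex function \<open>c\<close> is compared at the labels
      \<open>e\<close> and \<open>b\<close> through the sets with labels
      \<open>{e, a} \<union> U\<close> and \<open>{b, a} \<union> U\<close>. Each disagreement that
      occurs is \<open>E\<close> up to a transposition among \<open>a\<close>, \<open>b\<close>,
      \<open>e\<close>, and these labels lie outside \<open>I\<close>.\<close>
    have 1: "pr (\<lambda>x. F x (x ` insert e (insert a U)) \<noteq> c (x ` I) (F x) (x e)) \<le> 7 ^ (m + 1) * E"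
      using IH[of a e b] as(6) ne nI lt unfolding E_def U(1) by (auto simp: insert_commute)
    have "pr (\<lambda>x. F x (x ` insert b (insert a U)) \<noteq> c (x ` I) (F x) (x b)) \<le>
        7 ^ (m + 1) * pr (\<lambda>x. F x (x ` insert b (insert a U)) \<noteq> F x (x ` insert b (insert e U)))"
      using IH[of a b e] as(6) ne nI lt by auto
    also have "pr (\<lambda>x. F x (x ` insert b (insert a U)) \<noteq> F x (x ` insert b (insert e U))) = E"
      unfolding E_def U(1)
      using pr_swap[of b e "\<lambda>x. F x (x ` insert a (insert e U)) \<noteq> F x (x ` insert b (insert e U))"] lt
        as(6) ne nI
      by (simp add: dep tU tU[unfolded o_def] insert_commute transpose_apply_other)
    finally have 2: "pr (\<lambda>x. F x (x ` insert b (insert a U)) \<noteq> c (x ` I) (F x) (x b)) \<le> 7 ^ (m + 1) * E" .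
    have 3: "pr (\<lambda>x. F x (x ` insert e (insert a U)) \<noteq> F x (x ` insert b (insert a U))) \<le> E"
      unfolding E_def U(1)
      using pr_swap[of a e "\<lambda>x. F x (x ` insert a (insert e U)) \<noteq> F x (x ` insert b (insert e U))"] lt
        as(6) ne nI
      by (simp add: dep tU tU[unfolded o_def] insert_commute transpose_apply_other)
    have "pr (\<lambda>x. c (x ` I) (F x) (x e) \<noteq> C0 (x ` I) (c (x ` I) (F x))) \<le>
        2 * pr (\<lambda>x. c (x ` I) (F x) (x e) \<noteq> c (x ` I) (F x) (x b))"
      using C0(2)[rule_format, OF depc, of e b] as ne nI lt by auto
    also have "pr (\<lambda>x. c (x ` I) (F x) (x e) \<noteq> c (x ` I) (F x) (x b)) \<le> 7 ^ (m + 1) * E + (7 ^ (m + 1) * E + E)"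
      by (rule pr_le[OF _ pr_disj[OF 1 pr_disj[OF 2 3]]]) auto
    finally have 4: "pr (\<lambda>x. c (x ` I) (F x) (x e) \<noteq> C0 (x ` I) (c (x ` I) (F x))) \<le>
        2 * (7 ^ (m + 1) * E + (7 ^ (m + 1) * E + E))" by simp
    have "pr (\<lambda>x. F x (x ` insert e (insert a U)) \<noteq> C0 (x ` I) (c (x ` I) (F x))) \<le>
        7 ^ (m + 1) * E + 2 * (7 ^ (m + 1) * E + (7 ^ (m + 1) * E + E))"
      by (rule pr_le[OF _ pr_disj[OF 1 4]]) auto
    \<comment> \<open>Base 7 comes from this recursion: a factor \<open>K\<close> becomes
      \<open>5 * K + 2\<close>, which is at most \<open>7 * K\<close> once
      \<open>1 \<le> K\<close>.\<close>
    also have "\<dots> = 5 * (7 ^ (m + 1) * E) + 2 * E" by simp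
    also have "\<dots> \<le> 7 ^ (Suc m + 1) * E"
    proof -
      have "(1 :: real) \<le> 7 ^ (m + 1)" by (rule one_le_power) simp
      then have "1 * E \<le> 7 ^ (m + 1) * E" by (rule mult_right_mono) (simp add: E_def)
      moreover have "(7 :: real) ^ (Suc m + 1) * E = 7 * (7 ^ (m + 1) * E)" by simp
      ultimately show ?thesis by linarith
    qed
    finally show "pr (\<lambda>x. F x (x ` insert a U') \<noteq> C0 (x ` I) (c (x ` I) (F x))) \<le>
        7 ^ (Suc m + 1) * pr (\<lambda>x. F x (x ` insert a U') \<noteq> F x (x ` insert b U'))"
      unfolding E_def U(1) by (simp add: insert_commute)
  qed
qed

end

section \<open>Cochain identities in a nonabelian group\<close>

context group
begin

lemma inv_cancel_left: "x \<in> carrier G \<Longrightarrow> y \<in> carrier G \<Longrightarrow> inv x \<otimes> (x \<otimes> y) = y"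
  by (simp add: m_assoc[symmetric])

lemma inv_cancel_left': "x \<in> carrier G \<Longrightarrow> y \<in> carrier G \<Longrightarrow> x \<otimes> (inv x \<otimes> y) = y"
  by (simp add: m_assoc[symmetric])

lemmas group_word_simps = m_assoc inv_cancel_left inv_cancel_left' inv_mult_group

text \<open>The 1-cochain condition for total functions. It includes the diagonal, where it says
  that \<open>f s s\<close> is its own inverse.\<close>

definition antisymmetric :: "('v \<Rightarrow> 'v \<Rightarrow> 'a) \<Rightarrow> bool" where
  "antisymmetric f \<longleftrightarrow> (\<forall>s t. f s t \<in> carrier G \<and> f s t = inv f t s)"

text \<open>The cocycle condition on one triangle, solved for the third edge so that it can be used
  as a rewriting of \<open>f s u\<close>.\<close>

definition flat :: "('v \<Rightarrow> 'v \<Rightarrow> 'a) \<Rightarrow> 'v \<Rightarrow> 'v \<Rightarrow> 'v \<Rightarrow> bool" where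
  "flat f s t u \<longleftrightarrow> f s u = f s t \<otimes> f t u"

lemma antisymmetricD: "antisymmetric f \<Longrightarrow> f s t \<in> carrier G" "antisymmetric f \<Longrightarrow> inv f t s = f s t"
  unfolding antisymmetric_def by metis+

lemma flat_rev: "antisymmetric f \<Longrightarrow> flat f s t u \<Longrightarrow> flat f u t s"
  unfolding flat_def
  by (metis antisymmetricD inv_mult_group)

lemma flat_iff_coboundary1:
  assumes "f s t \<in> carrier G" "f t u \<in> carrier G" "f u s \<in> carrier G" "f s u = inv f u s"
  shows "coboundary1 G f s t u = \<one> \<longleftrightarrow> flat f s t u"
  using assms unfolding coboundary1_def flat_def
  by (metis inv_equality inv_inv m_closed r_inv l_inv)

text \<open>Four flat triangles around \<open>c\<close> fill the quadrilateral
  \<open>p, q, q', p'\<close>. So \<open>f p q\<close> is \<open>f p' q'\<close> transported along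
  the sides \<open>p p'\<close> and \<open>q q'\<close>; these are differences of potentials, and
  conjugating by the potentials cancels the transport.\<close>

lemma flat_quadrilateral:
  assumes f: "antisymmetric f" and car: "a \<in> carrier G" "a' \<in> carrier G" "b \<in> carrier G" "b' \<in> carrier G"
    and t: "flat f p c q" "flat f p' c q'" "flat f p p' c" "flat f q q' c"
    and e: "f p p' = a \<otimes> inv a'" "f q q' = b \<otimes> inv b'"
  shows "inv a \<otimes> f p q \<otimes> b = inv a' \<otimes> f p' q' \<otimes> b'"
proof -
  note c = antisymmetricD(1)[OF f]
  have 1: "f p q = f p c \<otimes> f c q" "f p' q' = f p' c \<otimes> f c q'" "f p c = f p p' \<otimes> f p' c"
    using t(1-3) by (simp_all add: flat_def)
  have "f c q = f c q' \<otimes> f q' q"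
    using flat_rev[OF f t(4)] by (simp add: flat_def)
  moreover have "f q' q = b' \<otimes> inv b"
    using e(2) antisymmetricD(2)[OF f, of q q'] car by (simp add: inv_mult_group)
  ultimately show ?thesis
    unfolding 1(1,2) unfolding 1(3) e(1) using car c by (simp add: group_word_simps)
qed

end

context random_labelling
begin

lemma fresh_index:
  assumes "card S \<le> d" "S \<subseteq> {..<d + 1}"
  shows "\<exists>c. c < d + 1 \<and> c \<notin> S"
proof (rule ccontr)
  assume "\<not> ?thesis"
  then have "S = {..<d + 1}" using assms(2) by auto
  then show False using assms(1) by simp
qed

lemma image_remove: "x \<in> set_pmf P \<Longrightarrow> S \<subseteq> {..<d + 1} \<Longrightarrow> a \<in> S \<Longrightarrow> x ` S - {x a} = x ` (S - {a})"
  using inj_on_image_set_diff[OF P_inj, of x S "{a}"] by auto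

lemma pr_sum_eq: "(\<Sum>i\<in>A. pr (\<phi> i)) = measure_pmf.expectation P (\<lambda>x. \<Sum>i\<in>A. of_bool (\<phi> i x))"
proof -
  have "pr (\<phi> i) = measure_pmf.expectation P (\<lambda>x. of_bool (\<phi> i x))" for i
  proof -
    have "(\<lambda>x. of_bool (\<phi> i x)) = (indicator {x. \<phi> i x} :: _ \<Rightarrow> real)" by (auto simp: indicator_def)
    then show ?thesis by simp
  qed
  then show ?thesis
    by (simp add: Bochner_Integration.integral_sum integrable_measure_pmf_finite finite_set_P)
qed

text \<open>Enumerate each set \<open>s\<close> as \<open>en s 0, \<dots>, en s (m - 1)\<close>; some index \<open>i\<close> is as good as a random
  element of \<open>s\<close>.\<close>

lemma select_good_element:
  fixes R :: "'a set \<Rightarrow> 'a \<Rightarrow> 'a \<Rightarrow> bool"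
  assumes m: "1 \<le> m" "m \<le> d + 1" and e: "0 \<le> e"
    and R: "\<And>S a b. card S = m \<Longrightarrow> S \<subseteq> {..<d + 1} \<Longrightarrow> a \<in> S \<Longrightarrow> b \<in> S \<Longrightarrow> a \<noteq> b \<Longrightarrow>
      pr (\<lambda>x. R (x ` S) (x a) (x b)) \<le> e"
  shows "\<exists>y. \<forall>S b. card S = m \<longrightarrow> S \<subseteq> {..<d + 1} \<longrightarrow> b \<in> S \<longrightarrow>
    pr (\<lambda>x. y (x ` S) \<noteq> x b \<and> R (x ` S) (y (x ` S)) (x b)) \<le> e"
proof -
  define S0 where "S0 = {..<m}"
  define b0 where "b0 = m - 1"
  have S0: "card S0 = m" "S0 \<subseteq> {..<d + 1}" "b0 \<in> S0" "finite S0" using m by (auto simp: S0_def b0_def)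
  have "\<exists>h. bij_betw h {..<m} s" if "card s = m" for s :: "'a set"
  proof -
    have "finite s" using that m by (intro card_ge_0_finite) simp
    then show ?thesis using that by (metis card_lessThan finite_lessThan finite_same_card_bij)
  qed
  then obtain en :: "'a set \<Rightarrow> nat \<Rightarrow> 'a" where en: "\<And>s. card s = m \<Longrightarrow> bij_betw (en s) {..<m} s"
    by metis
  define \<phi> where "\<phi> i x = (en (x ` S0) i \<noteq> x b0 \<and> R (x ` S0) (en (x ` S0) i) (x b0))" for i and x :: "nat \<Rightarrow> 'a"
  define \<psi> where "\<psi> j x = (x j \<noteq> x b0 \<and> R (x ` S0) (x j) (x b0))" for j :: nat and x :: "nat \<Rightarrow> 'a"
  \<comment> \<open>For each \<open>x\<close> both sums run over the vertices of the same face, once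
    in the order given by \<open>en\<close> and once in that of the labels. Hence some
    \<open>i\<close> does at most as badly as the average label.\<close>
  have "(\<Sum>i<m. pr (\<phi> i)) = (\<Sum>j\<in>S0. pr (\<psi> j))"
    unfolding pr_sum_eq
  proof (rule integral_cong_AE)
    show "AE x in P. (\<Sum>i<m. of_bool (\<phi> i x)) = (\<Sum>j\<in>S0. (of_bool (\<psi> j x) :: real))"
    proof (rule AE_pmfI)
      fix x assume x: "x \<in> set_pmf P"
      define q where "q v = (of_bool (v \<noteq> x b0 \<and> R (x ` S0) v (x b0)) :: real)" for v
      have "(\<Sum>i<m. q (en (x ` S0) i)) = (\<Sum>v\<in>x ` S0. q v)"
        by (rule sum.reindex_bij_betw[OF en]) (simp add: card_image_P[OF x S0(2)] S0(1))
      also have "\<dots> = (\<Sum>j\<in>S0. q (x j))"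
        using sum.reindex[OF inj_on_subset[OF P_inj[OF x] S0(2)], of q] by simp
      finally show "(\<Sum>i<m. of_bool (\<phi> i x)) = (\<Sum>j\<in>S0. (of_bool (\<psi> j x) :: real))"
        by (simp add: q_def \<phi>_def \<psi>_def)
    qed
  qed auto
  also have "\<dots> \<le> (\<Sum>j\<in>S0. e)"
  proof (rule sum_mono)
    fix j assume j: "j \<in> S0"
    show "pr (\<psi> j) \<le> e"
    proof (cases "j = b0")
      case True
      then show ?thesis using e by (simp add: \<psi>_def)
    next
      case False
      then show ?thesis
        by (intro pr_le[OF _ R[OF S0(1,2) j S0(3)]]) (auto simp: \<psi>_def)
    qed
  qed
  finally have sum: "(\<Sum>i<m. pr (\<phi> i)) \<le> real m * e" using S0(1) by simp
  have "\<exists>i<m. pr (\<phi> i) \<le> e"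
  proof (rule ccontr)
    assume "\<not> ?thesis"
    then have "(\<Sum>i<m. e) < (\<Sum>i<m. pr (\<phi> i))" using m by (intro sum_strict_mono) (auto simp: lessThan_empty_iff)
    then show False using sum by simp
  qed
  then obtain i where i: "pr (\<phi> i) \<le> e" by auto
  have "pr (\<lambda>x. en (x ` S) i \<noteq> x b \<and> R (x ` S) (en (x ` S) i) (x b)) \<le> e"
    if S: "card S = m" "S \<subseteq> {..<d + 1}" "b \<in> S" for S b
  proof -
    have fS: "finite S" using S(2) finite_subset by auto
    have "\<exists>\<pi>. \<pi> permutes {..<d + 1} \<and> \<pi> ` {..<card (S - {b})} = S - {b} \<and>
        (\<forall>i<length [b]. \<pi> (card (S - {b}) + i) = [b] ! i)"
      by (rule exists_aligning_permutation) (use fS S in auto)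
    then obtain \<pi> where \<pi>: "\<pi> permutes {..<d + 1}" "\<pi> ` {..<card (S - {b})} = S - {b}"
        "\<forall>i<length [b]. \<pi> (card (S - {b}) + i) = [b] ! i"
      by blast
    have c: "card (S - {b}) = b0" using S fS by (simp add: b0_def)
    have b: "\<pi> b0 = b" using \<pi>(3) c by auto
    have "S0 = insert b0 {..<b0}" using m by (auto simp: S0_def b0_def)
    then have "\<pi> ` S0 = S" using \<pi>(2) c b S(3) by auto
    then have im: "(x \<circ> \<pi>) ` S0 = x ` S" for x :: "nat \<Rightarrow> 'a" by (simp only: image_comp[symmetric])
    have "pr (\<lambda>x. \<phi> i (x \<circ> \<pi>)) = pr (\<phi> i)" by (rule pr_permute[OF \<pi>(1)])
    then show ?thesis using i by (simp only: \<phi>_def im o_apply b)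
  qed
  then show ?thesis by (intro exI[of _ "\<lambda>s. en s i"]) auto
qed

end

subsection \<open>From local to global coboundaries\<close>

locale coboundary_labelling = spectral_labelling d X \<mu> lam + group G
  for d :: nat and X :: "'a set set" and \<mu> :: "'a set pmf" and lam :: real and G :: "nat monoid" (structure) +
  fixes r :: nat and \<beta> :: real
  assumes \<beta>: "0 < \<beta>" "\<beta> \<le> 1" and r: "1 \<le> r" "7 * r + 7 \<le> d"
    and links: "\<And>A. A \<in> X \<Longrightarrow> card A \<le> r + 1 \<Longrightarrow>
      coboundary_expander_over G (link_faces X A) (link_pmf \<mu> A) \<beta>"
begin

text \<open>A potential is chosen in every link of a face with at most \<open>r + 1\<close>
  vertices, and the expansion inequalities of the links are averaged over the image of
  \<open>I\<close>. The same \<open>g\<close> serves all index sets, since it depends on the face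
  alone.\<close>

lemma coboundary_approximation:
  fixes F :: "'a set \<Rightarrow> 'a \<Rightarrow> 'a \<Rightarrow> nat"
  assumes F: "\<And>A. antisymmetric (F A)"
  shows "\<exists>g. (\<forall>A v. g A v \<in> carrier G) \<and> (\<forall>I a b c. card I \<le> r + 1 \<longrightarrow> distinct [a, b, c] \<longrightarrow>
    {a, b, c} \<inter> I = {} \<longrightarrow> {a, b, c} \<union> I \<subseteq> {..<d + 1} \<longrightarrow>
    \<beta> * pr (\<lambda>x. F (x ` I) (x a) (x b) \<noteq> g (x ` I) (x a) \<otimes> inv g (x ` I) (x b)) \<le>
      pr (\<lambda>x. \<not> flat (F (x ` I)) (x a) (x b) (x c)))"
proof -
  define good where "good A h \<longleftrightarrow> h \<in> cochains0 (link_faces X A) G \<and>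
      \<beta> * cochain_dist (link_pmf \<mu> A) (F A) (coboundary0 G h) \<le> coboundary1_weight (link_pmf \<mu> A) G (F A)"
    for A h
  define g0 where "g0 A = (SOME h. good A h)" for A
  \<comment> \<open>The default makes \<open>g\<close> total with values in the carrier. On sampled
    vertices it is never taken, because they are vertices of the link, where \<open>g0\<close> is a
    0-cochain.\<close>
  define g where "g A v = (if g0 A v \<in> carrier G then g0 A v else \<one>)" for A v
  have Fc: "F A \<in> cochains1 Y G" for A Y
    using F[of A] unfolding cochains1_def antisymmetric_def by blast
  have good: "good A (g0 A)" if A: "A \<in> X" "card A \<le> r + 1" for A
  proof -
    have "\<exists>h. good A h"
      using links[OF A] Fc[of A] unfolding coboundary_expander_over_def good_def by blast
    then show ?thesis unfolding g0_def by (rule someI_ex)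
  qed
  have "\<beta> * pr (\<lambda>x. F (x ` I) (x a) (x b) \<noteq> g (x ` I) (x a) \<otimes> inv g (x ` I) (x b)) \<le>
      pr (\<lambda>x. \<not> flat (F (x ` I)) (x a) (x b) (x c))"
    if I: "card I \<le> r + 1" "distinct [a, b, c]" "{a, b, c} \<inter> I = {}" "{a, b, c} \<union> I \<subseteq> {..<d + 1}"
    for I a b c
  proof -
    define k where "k = card I"
    have fI: "finite I" using finite_subset[OF I(4)] by simp
    have "\<exists>\<pi>. \<pi> permutes {..<d + 1} \<and> \<pi> ` {..<card I} = I \<and>
        (\<forall>i<length [a, b, c]. \<pi> (card I + i) = [a, b, c] ! i)"
      by (rule exists_aligning_permutation) (use fI I in auto)
    then obtain \<pi> where \<pi>: "\<pi> permutes {..<d + 1}" "\<pi> ` {..<k} = I"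
        "\<forall>i<length [a, b, c]. \<pi> (k + i) = [a, b, c] ! i"
      unfolding k_def by blast
    have \<pi>abc: "\<pi> k = a" "\<pi> (Suc k) = b" "\<pi> (Suc (Suc k)) = c"
      using \<pi>(3)[rule_format, of 0] \<pi>(3)[rule_format, of 1] \<pi>(3)[rule_format, of 2] by auto
    have i: "(x \<circ> \<pi>) ` {..<k} = x ` I" for x :: "nat \<Rightarrow> 'a" unfolding image_comp[symmetric] \<pi>(2) ..
    have k: "k \<le> r + 1" "k + 3 \<le> d + 1" using I(1) r by (auto simp: k_def)
    have set_upt: "set (map x [0..<k]) = x ` {..<k}" for x :: "nat \<Rightarrow> 'a" by (simp add: lessThan_atLeast0)
    let ?S = "\<lambda>l. {[u, v] | u v. F (set l) u v \<noteq> coboundary0 G (g0 (set l)) u v}"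
    let ?T = "\<lambda>l. {[u, v, w] | u v w. coboundary1 G (F (set l)) u v w \<noteq> \<one>}"
    have "\<beta> * pr (\<lambda>x. map x [k..<k + (1 + 1)] \<in> ?S (map x [0..<k])) \<le>
        1 * pr (\<lambda>x. map x [k..<k + (2 + 1)] \<in> ?T (map x [0..<k]))"
    proof (rule pr_le_from_links)
      fix x assume x: "x \<in> set_pmf P"
      have "card (x ` {..<k}) = k" using card_image_P[OF x, of "{..<k}"] k by simp
      moreover have "x ` {..<k} \<in> X" by (rule P_image[OF x]) (use k in auto)
      ultimately have "good (x ` {..<k}) (g0 (x ` {..<k}))" using good k by simp
      then show "\<beta> * measure_pmf.prob (ordered_face_pmf 1 (link_pmf \<mu> (x ` {..<k}))) (?S (map x [0..<k])) \<le>
          1 * measure_pmf.prob (ordered_face_pmf 2 (link_pmf \<mu> (x ` {..<k}))) (?T (map x [0..<k]))"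
        unfolding good_def cochain_dist_def coboundary1_weight_def set_upt mult_1 by (rule conjunct2)
    qed (use k in auto)
    moreover have "map x [k..<k + (1 + 1)] = [x k, x (Suc k)]" for x :: "nat \<Rightarrow> 'a"
      by (simp add: upt_rec)
    moreover have "map x [k..<k + (2 + 1)] = [x k, x (Suc k), x (Suc (Suc k))]" for x :: "nat \<Rightarrow> 'a"
      by (simp add: upt_rec)
    ultimately have "\<beta> * pr (\<lambda>x. F (x ` {..<k}) (x k) (x (Suc k)) \<noteq> coboundary0 G (g0 (x ` {..<k})) (x k) (x (Suc k))) \<le>
        pr (\<lambda>x. coboundary1 G (F (x ` {..<k})) (x k) (x (Suc k)) (x (Suc (Suc k))) \<noteq> \<one>)"
      by (simp add: set_upt lessThan_atLeast0)
    also have "pr (\<lambda>x. coboundary1 G (F (x ` {..<k})) (x k) (x (Suc k)) (x (Suc (Suc k))) \<noteq> \<one>) =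
        pr (\<lambda>x. coboundary1 G (F (x ` I)) (x a) (x b) (x c) \<noteq> \<one>)"
      using pr_permute[OF \<pi>(1), of "\<lambda>x. coboundary1 G (F (x ` {..<k})) (x k) (x (Suc k)) (x (Suc (Suc k))) \<noteq> \<one>"]
      by (simp only: i o_apply \<pi>abc)
    also have "pr (\<lambda>x. F (x ` {..<k}) (x k) (x (Suc k)) \<noteq> coboundary0 G (g0 (x ` {..<k})) (x k) (x (Suc k))) =
        pr (\<lambda>x. F (x ` I) (x a) (x b) \<noteq> coboundary0 G (g0 (x ` I)) (x a) (x b))"
      using pr_permute[OF \<pi>(1), of "\<lambda>x. F (x ` {..<k}) (x k) (x (Suc k)) \<noteq> coboundary0 G (g0 (x ` {..<k})) (x k) (x (Suc k))"]
      by (simp only: i o_apply \<pi>abc)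
    also have "\<dots> = pr (\<lambda>x. F (x ` I) (x a) (x b) \<noteq> g (x ` I) (x a) \<otimes> inv g (x ` I) (x b))"
    proof (rule pr_cong)
      fix x assume x: "x \<in> set_pmf P"
      have xI: "x ` I \<in> X" "card (x ` I) \<le> r + 1"
        using P_image[OF x, of I] card_image_P[OF x, of I] I by auto
      have "g0 (x ` I) (x j) \<in> carrier G" if j: "j \<in> {a, b}" for j
      proof -
        have ins: "insert (x j) (x ` I) \<in> X"
          using P_image[OF x, of "insert j I"] j I by auto
        have "x j \<notin> x ` I"
          using inj_on_image_mem_iff[OF P_inj[OF x], of j I] j I by auto
        then have "{x j} \<in> link_faces X (x ` I)"
          using ins by (auto simp: link_faces_def intro!: exI[of _ "insert (x j) (x ` I)"])
        then show ?thesis using good[OF xI] by (auto simp: good_def cochains0_def)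
      qed
      then show "(F (x ` I) (x a) (x b) \<noteq> coboundary0 G (g0 (x ` I)) (x a) (x b)) =
          (F (x ` I) (x a) (x b) \<noteq> g (x ` I) (x a) \<otimes> inv g (x ` I) (x b))"
        by (simp add: coboundary0_def g_def)
    qed
    also have "pr (\<lambda>x. coboundary1 G (F (x ` I)) (x a) (x b) (x c) \<noteq> \<one>) =
        pr (\<lambda>x. \<not> flat (F (x ` I)) (x a) (x b) (x c))"
      using F by (intro pr_cong) (simp add: flat_iff_coboundary1 antisymmetricD)
    finally show ?thesis .
  qed
  then show ?thesis by (intro exI[of _ g]) (auto simp: g_def)
qed

text \<open>\<open>set_plurality\<close>, equivariantly under swapping \<open>s\<close> and \<open>t\<close>: the swap is resolved by an
  arbitrary choice of one of the two orders.\<close>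

lemma oriented_plurality:
  fixes Q :: "'a set \<Rightarrow> 'a set \<Rightarrow> 'a set \<Rightarrow> nat"
  assumes Q: "\<And>u. antisymmetric (\<lambda>s t. Q s t u)"
  shows "\<exists>f. antisymmetric f \<and> (\<forall>S T U a b. card U = m \<longrightarrow> (S \<union> T) \<inter> U = {} \<longrightarrow> a \<noteq> b \<longrightarrow>
    {a, b} \<inter> (S \<union> T \<union> U) = {} \<longrightarrow> {a, b} \<union> S \<union> T \<union> U \<subseteq> {..<d + 1} \<longrightarrow>
    pr (\<lambda>x. Q (x ` S) (x ` T) (x ` insert a U) \<noteq> f (x ` S) (x ` T)) \<le>
      7 ^ (m + 1) * pr (\<lambda>x. Q (x ` S) (x ` T) (x ` insert a U) \<noteq> Q (x ` S) (x ` T) (x ` insert b U)))"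
proof -
  obtain C :: "'a set \<Rightarrow> ('a set \<Rightarrow> nat) \<Rightarrow> nat" where C: "\<forall>A F. C A F \<in> range F"
    "\<forall>I U a b F. depends_only_on I F \<longrightarrow> finite I \<longrightarrow> finite U \<longrightarrow> card U = m \<longrightarrow> I \<inter> U = {} \<longrightarrow>
       a \<noteq> b \<longrightarrow> a \<notin> I \<union> U \<longrightarrow> b \<notin> I \<union> U \<longrightarrow> insert a (insert b (I \<union> U)) \<subseteq> {..<d + 1} \<longrightarrow>
       pr (\<lambda>x. F x (x ` insert a U) \<noteq> C (x ` I) (F x)) \<le>
         7 ^ (m + 1) * pr (\<lambda>x. F x (x ` insert a U) \<noteq> F x (x ` insert b U))"
    using set_plurality[where ?'c = nat and m = m] by (elim exE conjE) (rule that; assumption)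
  define ori where "ori s t = (SOME p. p = (s, t) \<or> p = (t, s))" for s t :: "'a set"
  have ori: "ori s t = (s, t) \<or> ori s t = (t, s)" for s t
    unfolding ori_def by (rule someI[where x = "(s, t)"]) simp
  have ori_sym: "ori s t = ori t s" for s t
    unfolding ori_def by (rule arg_cong[where f = Eps]) auto
  define F0 where "F0 s t = Q (fst (ori s t)) (snd (ori s t))" for s t
  define c where "c s t = C (s \<union> t) (F0 s t)" for s t
  define f where "f s t = (if ori s t = (s, t) then c s t else inv (c s t))" for s t
  have Qc: "Q s t u \<in> carrier G" "inv Q s t u = Q t s u" for s t u
    using antisymmetricD[OF Q] by auto
  have c_eq: "\<exists>u. c s t = F0 s t u" for s t
    using C(1)[rule_format, of "s \<union> t" "F0 s t"] by (auto simp: c_def)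
  then have cc: "c s t \<in> carrier G" for s t
    using Qc by (metis F0_def)
  have csym: "c s t = c t s" for s t
    by (simp add: c_def F0_def ori_sym[of s t] Un_commute)
  \<comment> \<open>Off the diagonal exactly one of the two orders is the chosen one, and the other
    receives the inverse. On the diagonal the value must be its own inverse: it is some
    \<open>Q s s u\<close>, which antisymmetry makes an involution or the identity.\<close>
  have "f s t \<in> carrier G \<and> f s t = inv f t s" for s t
  proof (cases "s = t")
    case True
    obtain u where "c s s = F0 s s u" using c_eq by blast
    then have "inv c s s = c s s" using Qc(2)[of s s u] ori[of s s] by (simp add: F0_def)
    then show ?thesis using cc True by (simp add: f_def)
  next
    case False
    then show ?thesis using cc ori[of s t] ori_sym[of s t] csym[of s t] by (auto simp: f_def)
  qed
  then have f: "antisymmetric f" unfolding antisymmetric_def by blast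
  have fQ: "Q s t u = f s t" if "F0 s t u = c s t" for s t u
    using ori[of s t] Qc that unfolding f_def F0_def by (metis fst_conv snd_conv)
  have "pr (\<lambda>x. Q (x ` S) (x ` T) (x ` insert a U) \<noteq> f (x ` S) (x ` T)) \<le>
      7 ^ (m + 1) * pr (\<lambda>x. Q (x ` S) (x ` T) (x ` insert a U) \<noteq> Q (x ` S) (x ` T) (x ` insert b U))"
    if as: "card U = m" "(S \<union> T) \<inter> U = {}" "a \<noteq> b"
      "{a, b} \<inter> (S \<union> T \<union> U) = {}" "{a, b} \<union> S \<union> T \<union> U \<subseteq> {..<d + 1}" for S T U a b
  proof -
    have fin: "finite U" "finite (S \<union> T)" using finite_subset[OF as(5)] by simp_all
    have dep: "depends_only_on (S \<union> T) (\<lambda>x. F0 (x ` S) (x ` T))"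
      unfolding depends_only_on_def
    proof (intro allI impI)
      fix x y :: "nat \<Rightarrow> 'a" assume "\<forall>i\<in>S \<union> T. x i = y i"
      then have "x ` S = y ` S" "x ` T = y ` T" by (auto intro!: image_cong)
      then show "F0 (x ` S) (x ` T) = F0 (y ` S) (y ` T)" by simp
    qed
    have "pr (\<lambda>x. Q (x ` S) (x ` T) (x ` insert a U) \<noteq> f (x ` S) (x ` T)) \<le>
        pr (\<lambda>x. F0 (x ` S) (x ` T) (x ` insert a U) \<noteq> C (x ` (S \<union> T)) (F0 (x ` S) (x ` T)))"
      using fQ by (intro pr_mono) (auto simp: c_def image_Un)
    also have "\<dots> \<le> 7 ^ (m + 1) * pr (\<lambda>x. F0 (x ` S) (x ` T) (x ` insert a U) \<noteq> F0 (x ` S) (x ` T) (x ` insert b U))"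
      by (rule C(2)[rule_format, OF dep]) (use as fin in auto)
    also have "\<dots> \<le> 7 ^ (m + 1) * pr (\<lambda>x. Q (x ` S) (x ` T) (x ` insert a U) \<noteq> Q (x ` S) (x ` T) (x ` insert b U))"
    proof (intro mult_left_mono pr_mono)
      fix x assume "F0 (x ` S) (x ` T) (x ` insert a U) \<noteq> F0 (x ` S) (x ` T) (x ` insert b U)"
      then show "Q (x ` S) (x ` T) (x ` insert a U) \<noteq> Q (x ` S) (x ` T) (x ` insert b U)"
        using ori[of "x ` S" "x ` T"] Qc(2) unfolding F0_def by (metis fst_conv snd_conv)
    qed simp
    finally show ?thesis .
  qed
  then show ?thesis using f by (intro exI[of _ f]) blast
qed

end

section \<open>Descent on the Johnson graph\<close>

context group
begin

lemma conjugate_eq_imp_eq: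
  assumes "f \<in> carrier G" "a \<in> carrier G" "a' \<in> carrier G" "b \<in> carrier G" "b' \<in> carrier G"
    and "inv a \<otimes> f \<otimes> a' = b \<otimes> inv b'"
  shows "f = (a \<otimes> b) \<otimes> inv (a' \<otimes> b')"
proof -
  have "f = a \<otimes> (inv a \<otimes> f \<otimes> a') \<otimes> inv a'"
    using assms(1-5) by (simp add: group_word_simps)
  also have "\<dots> = (a \<otimes> b) \<otimes> inv (a' \<otimes> b')"
    unfolding assms(6) using assms(1-5) by (simp add: group_word_simps)
  finally show ?thesis .
qed

end

context random_labelling
begin

text \<open>Generic position: \<open>D\<close> is the part that the faces have in common, and
  \<open>l\<close> lists the additional vertices by which they differ or that serve for
  testing.\<close>

definition good_indices :: "nat \<Rightarrow> nat set \<Rightarrow> nat list \<Rightarrow> bool" where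
  "good_indices k D l \<longleftrightarrow> card D = k \<and> finite D \<and> distinct l \<and> set l \<inter> D = {} \<and> set l \<union> D \<subseteq> {..<d + 1}"

lemma extend_good_indices:
  assumes "good_indices k D l" "k + length l \<le> d"
  shows "\<exists>c. good_indices k D (c # l)"
proof -
  have "card (set l \<union> D) \<le> d"
    using assms card_Un_le[of "set l" D] card_length[of l] by (simp add: good_indices_def)
  then obtain c where "c < d + 1" "c \<notin> set l \<union> D"
    using fresh_index[of "set l \<union> D"] assms by (auto simp: good_indices_def)
  then show ?thesis using assms by (intro exI[of _ c]) (auto simp: good_indices_def)
qed

end

context coboundary_labelling
begin

text \<open>Triangles of the Johnson graph on \<open>(k+1)\<close>-faces: three faces containing a common \<open>k\<close>-set, or
  three faces contained in a common \<open>(k+2)\<close>-set.\<close>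

definition star_flat :: "nat \<Rightarrow> ('a set \<Rightarrow> 'a set \<Rightarrow> nat) \<Rightarrow> real \<Rightarrow> bool" where
  "star_flat k f e \<longleftrightarrow> (\<forall>D a b c. good_indices k D [a, b, c] \<longrightarrow>
    pr (\<lambda>x. \<not> flat f (x ` insert a D) (x ` insert b D) (x ` insert c D)) \<le> e)"

definition costar_flat :: "nat \<Rightarrow> ('a set \<Rightarrow> 'a set \<Rightarrow> nat) \<Rightarrow> real \<Rightarrow> bool" where
  "costar_flat k f e \<longleftrightarrow> (\<forall>j D a b c. k = Suc j \<longrightarrow> good_indices j D [a, b, c] \<longrightarrow>
    pr (\<lambda>x. \<not> flat f (x ` insert a (insert b D)) (x ` insert b (insert c D)) (x ` insert a (insert c D))) \<le> e)"

text \<open>Faces of one more vertex that contain the image of \<open>D\<close> are the vertices of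
  its link. On them \<open>f\<close> is an ordinary 1-cochain of the link, and star triangles are
  triangles of the link.\<close>

lemma star_coboundary:
  assumes k: "k \<le> r + 1" and f: "antisymmetric f" and star: "star_flat k f e"
  shows "\<exists>g. (\<forall>A v. g A v \<in> carrier G) \<and> (\<forall>D a b. good_indices k D [a, b] \<longrightarrow>
    pr (\<lambda>x. f (x ` insert a D) (x ` insert b D) \<noteq> g (x ` D) (x a) \<otimes> inv g (x ` D) (x b)) \<le> e / \<beta>)"
proof -
  define F where "F A u v = f (insert u A) (insert v A)" for A u v
  have "antisymmetric (F A)" for A
    using f unfolding antisymmetric_def F_def by blast
  from coboundary_approximation[where F = F, OF this]
  obtain g where g: "\<forall>A v. g A v \<in> carrier G" "\<forall>I a b c. card I \<le> r + 1 \<longrightarrow> distinct [a, b, c] \<longrightarrow>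
    {a, b, c} \<inter> I = {} \<longrightarrow> {a, b, c} \<union> I \<subseteq> {..<d + 1} \<longrightarrow>
    \<beta> * pr (\<lambda>x. F (x ` I) (x a) (x b) \<noteq> g (x ` I) (x a) \<otimes> inv g (x ` I) (x b)) \<le>
      pr (\<lambda>x. \<not> flat (F (x ` I)) (x a) (x b) (x c))"
    by (elim exE conjE) (rule that; assumption)
  have "pr (\<lambda>x. f (x ` insert a D) (x ` insert b D) \<noteq> g (x ` D) (x a) \<otimes> inv g (x ` D) (x b)) \<le> e / \<beta>"
    if D: "good_indices k D [a, b]" for D a b
  proof -
    obtain c where c: "good_indices k D [c, a, b]"
      using extend_good_indices[OF D] k r by auto
    have "\<beta> * pr (\<lambda>x. F (x ` D) (x a) (x b) \<noteq> g (x ` D) (x a) \<otimes> inv g (x ` D) (x b)) \<le>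
        pr (\<lambda>x. \<not> flat (F (x ` D)) (x a) (x b) (x c))"
      by (rule g(2)[rule_format]) (use c k in \<open>auto simp: good_indices_def\<close>)
    also have "\<dots> = pr (\<lambda>x. \<not> flat f (x ` insert a D) (x ` insert b D) (x ` insert c D))"
      by (simp add: flat_def F_def)
    also have "\<dots> \<le> e"
      by (rule star[unfolded star_flat_def, rule_format]) (use c in \<open>auto simp: good_indices_def\<close>)
    finally show ?thesis using \<beta> by (simp add: F_def field_simps)
  qed
  then show ?thesis using g(1) by blast
qed

text \<open>In the link of \<open>s\<close> the cochain \<open>f\<close> is nearly the coboundary of \<open>g s\<close>, so
  \<open>(g s v)^-1 * f (s + v) (t + v) * g t v\<close> hardly depends on \<open>v\<close> and defines a cocycle on faces with one
  vertex less.  If that one is the coboundary of \<open>h\<close>, then \<open>f\<close> is that of \<open>s + v \<mapsto> g s v * h s\<close>; the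
  triangles inside a \<open>(k+3)\<close>-set show that this value hardly depends on the removed vertex \<open>v\<close>.\<close>

lemma johnson_step:
  assumes k: "Suc k \<le> r" and f: "antisymmetric f" and e: "0 \<le> e"
    and star: "star_flat (Suc k) f e" and costar: "costar_flat (Suc k) f e"
    and IH: "\<And>f' e'. antisymmetric f' \<Longrightarrow> 0 \<le> e' \<Longrightarrow> star_flat k f' e' \<Longrightarrow> costar_flat k f' e' \<Longrightarrow>
      \<exists>h. (\<forall>s. h s \<in> carrier G) \<and> (\<forall>D a b. good_indices k D [a, b] \<longrightarrow>
        pr (\<lambda>x. f' (x ` insert a D) (x ` insert b D) \<noteq> h (x ` insert a D) \<otimes> inv h (x ` insert b D)) \<le> M * e')"
    and M: "1 \<le> M"
  shows "\<exists>h. (\<forall>s. h s \<in> carrier G) \<and> (\<forall>D a b. good_indices (Suc k) D [a, b] \<longrightarrow>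
        pr (\<lambda>x. f (x ` insert a D) (x ` insert b D) \<noteq> h (x ` insert a D) \<otimes> inv h (x ` insert b D)) \<le> (513 / \<beta>) * M * e)"
proof -
  note fc = antisymmetricD[OF f]
  obtain g where gc: "\<And>A v. g A v \<in> carrier G" and g: "\<And>D a b. good_indices (Suc k) D [a, b] \<Longrightarrow>
      pr (\<lambda>x. f (x ` insert a D) (x ` insert b D) \<noteq> g (x ` D) (x a) \<otimes> inv g (x ` D) (x b)) \<le> e / \<beta>"
    using star_coboundary[OF _ f star] k by auto
  \<comment> \<open>The test vertex is passed as a singleton because
    \<open>oriented_plurality\<close> speaks of sets; it is used with \<open>m = 0\<close>.\<close>
  define Q where "Q s t u = inv g s (the_elem u) \<otimes> f (s \<union> u) (t \<union> u) \<otimes> g t (the_elem u)" for s t u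
  have Q: "Q (x ` S) (x ` T) (x ` insert y {}) =
      inv g (x ` S) (x y) \<otimes> f (x ` insert y S) (x ` insert y T) \<otimes> g (x ` T) (x y)" for S T x y
    by (simp add: Q_def)
  have Qa: "antisymmetric (\<lambda>s t. Q s t u)" for u
    unfolding antisymmetric_def Q_def
    using gc fc by (simp add: inv_mult_group m_assoc)
  define \<epsilon> where "\<epsilon> = e / \<beta>"
  have \<epsilon>: "e \<le> \<epsilon>" "0 \<le> \<epsilon>"
    using e \<beta> by (auto simp: \<epsilon>_def field_simps mult_left_le_one_le mult_left_le)
  have Qstep: "pr (\<lambda>x. Q (x ` insert a D) (x ` insert b D) (x ` insert y {}) \<noteq>
      Q (x ` insert a D) (x ` insert b D) (x ` insert z {})) \<le> 6 * \<epsilon>"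
    if D: "good_indices k D [a, b, y, z]" for D a b y z
  proof -
    \<comment> \<open>With \<open>s\<close>, \<open>t\<close> the images of
      \<open>insert a D\<close>, \<open>insert b D\<close>, the quadrilateral has the corners s+y,
      t+y, t+z, s+z and the centre \<open>s \<union> t\<close>. Two of the four triangles lie in a
      common larger face, the other two contain \<open>s\<close> or \<open>t\<close>, and the sides
      at \<open>s\<close> and \<open>t\<close> are given by the potentials: four losses
      \<open>e\<close> and two losses \<open>e / \<beta>\<close>, hence
      \<open>6 * \<epsilon>\<close>.\<close>
    have 1: "pr (\<lambda>x. \<not> flat f (x ` insert y (insert a D)) (x ` insert a (insert b D)) (x ` insert y (insert b D))) \<le> e"
      by (rule costar[unfolded costar_flat_def, rule_format, OF refl]) (use D in \<open>auto simp: good_indices_def\<close>)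
    have 2: "pr (\<lambda>x. \<not> flat f (x ` insert z (insert a D)) (x ` insert a (insert b D)) (x ` insert z (insert b D))) \<le> e"
      by (rule costar[unfolded costar_flat_def, rule_format, OF refl]) (use D in \<open>auto simp: good_indices_def\<close>)
    have 3: "pr (\<lambda>x. \<not> flat f (x ` insert y (insert a D)) (x ` insert z (insert a D)) (x ` insert b (insert a D))) \<le> e"
      by (rule star[unfolded star_flat_def, rule_format]) (use D in \<open>auto simp: good_indices_def\<close>)
    have 4: "pr (\<lambda>x. \<not> flat f (x ` insert y (insert b D)) (x ` insert z (insert b D)) (x ` insert a (insert b D))) \<le> e"
      by (rule star[unfolded star_flat_def, rule_format]) (use D in \<open>auto simp: good_indices_def\<close>)
    have 5: "pr (\<lambda>x. f (x ` insert y (insert a D)) (x ` insert z (insert a D)) \<noteq>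
        g (x ` insert a D) (x y) \<otimes> inv g (x ` insert a D) (x z)) \<le> e / \<beta>"
      by (rule g) (use D in \<open>auto simp: good_indices_def\<close>)
    have 6: "pr (\<lambda>x. f (x ` insert y (insert b D)) (x ` insert z (insert b D)) \<noteq>
        g (x ` insert b D) (x y) \<otimes> inv g (x ` insert b D) (x z)) \<le> e / \<beta>"
      by (rule g) (use D in \<open>auto simp: good_indices_def\<close>)
    have "pr (\<lambda>x. Q (x ` insert a D) (x ` insert b D) (x ` insert y {}) \<noteq>
        Q (x ` insert a D) (x ` insert b D) (x ` insert z {})) \<le> e + (e + (e + (e + (e / \<beta> + e / \<beta>))))"
    proof (rule pr_le[OF _ pr_disj[OF 1 pr_disj[OF 2 pr_disj[OF 3 pr_disj[OF 4 pr_disj[OF 5 6]]]]]], rule ccontr)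
      fix x
      assume "Q (x ` insert a D) (x ` insert b D) (x ` insert y {}) \<noteq>
          Q (x ` insert a D) (x ` insert b D) (x ` insert z {})"
      moreover assume "\<not> (\<not> flat f (x ` insert y (insert a D)) (x ` insert a (insert b D)) (x ` insert y (insert b D)) \<or>
        \<not> flat f (x ` insert z (insert a D)) (x ` insert a (insert b D)) (x ` insert z (insert b D)) \<or>
        \<not> flat f (x ` insert y (insert a D)) (x ` insert z (insert a D)) (x ` insert b (insert a D)) \<or>
        \<not> flat f (x ` insert y (insert b D)) (x ` insert z (insert b D)) (x ` insert a (insert b D)) \<or>
        f (x ` insert y (insert a D)) (x ` insert z (insert a D)) \<noteq>
        g (x ` insert a D) (x y) \<otimes> inv g (x ` insert a D) (x z) \<or>
        f (x ` insert y (insert b D)) (x ` insert z (insert b D)) \<noteq>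
        g (x ` insert b D) (x y) \<otimes> inv g (x ` insert b D) (x z))"
      ultimately show False
        unfolding Q using flat_quadrilateral[OF f gc gc gc gc, where p = "x ` insert y (insert a D)"
            and c = "x ` insert a (insert b D)" and q = "x ` insert y (insert b D)"
            and p' = "x ` insert z (insert a D)" and q' = "x ` insert z (insert b D)"]
        unfolding insert_commute[of b a] by blast
    qed
    also have "\<dots> \<le> 6 * \<epsilon>" using \<epsilon> by (simp add: \<epsilon>_def)
    finally show ?thesis .
  qed
  obtain f' where f': "antisymmetric f'" and f'_pl: "\<forall>S T U a b. card U = 0 \<longrightarrow> (S \<union> T) \<inter> U = {} \<longrightarrow> a \<noteq> b \<longrightarrow>
    {a, b} \<inter> (S \<union> T \<union> U) = {} \<longrightarrow> {a, b} \<union> S \<union> T \<union> U \<subseteq> {..<d + 1} \<longrightarrow>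
    pr (\<lambda>x. Q (x ` S) (x ` T) (x ` insert a U) \<noteq> f' (x ` S) (x ` T)) \<le>
      7 ^ (0 + 1) * pr (\<lambda>x. Q (x ` S) (x ` T) (x ` insert a U) \<noteq> Q (x ` S) (x ` T) (x ` insert b U))"
    using oriented_plurality[where Q = Q and m = 0, OF Qa] by (elim exE conjE) (rule that; assumption)
  \<comment> \<open>42 = 7 * 6. The plurality is over a single vertex, so its factor 7 does not grow
    with \<open>r\<close>.\<close>
  have Qf': "pr (\<lambda>x. Q (x ` insert a D) (x ` insert b D) (x ` insert y {}) \<noteq> f' (x ` insert a D) (x ` insert b D)) \<le> 42 * \<epsilon>"
    if D: "good_indices k D [a, b, y]" for D a b y
  proof -
    obtain z where z: "good_indices k D [z, a, b, y]"
      using extend_good_indices[OF D] k r by auto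
    have "pr (\<lambda>x. Q (x ` insert a D) (x ` insert b D) (x ` insert y {}) \<noteq> f' (x ` insert a D) (x ` insert b D)) \<le>
        7 ^ (0 + 1) * pr (\<lambda>x. Q (x ` insert a D) (x ` insert b D) (x ` insert y {}) \<noteq>
          Q (x ` insert a D) (x ` insert b D) (x ` insert z {}))"
      by (rule f'_pl[rule_format]) (use z in \<open>auto simp: good_indices_def\<close>)
    also have "\<dots> \<le> 7 ^ (0 + 1) * (6 * \<epsilon>)"
      by (intro mult_left_mono Qstep) (use z in \<open>auto simp: good_indices_def\<close>)
    finally show ?thesis by simp
  qed
  \<comment> \<open>With a common test vertex the conjugating factors at \<open>t\<close> cancel, so
    flatness of \<open>f\<close> on the enlarged faces passes to \<open>f'\<close>. Three
    replacements of \<open>Q\<close> by \<open>f'\<close> and one triangle give 127 = 3 * 42 + 1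
    below.\<close>
  have tri: "f' s u = f' s t \<otimes> f' t u"
    if "Q s t w = f' s t" "Q t u w = f' t u" "Q s u w = f' s u" "flat f (s \<union> w) (t \<union> w) (u \<union> w)" for s t u w
    unfolding that(1-3)[symmetric] Q_def that(4)[unfolded flat_def]
    using gc fc by (simp add: group_word_simps)
  have star': "star_flat k f' (127 * \<epsilon>)"
    unfolding star_flat_def
  proof (intro allI impI)
    fix D a b c assume D: "good_indices k D [a, b, c]"
    obtain y where y: "good_indices k D [y, a, b, c]"
      using extend_good_indices[OF D] k r by auto
    have 1: "pr (\<lambda>x. \<not> flat f (x ` insert a (insert y D)) (x ` insert b (insert y D)) (x ` insert c (insert y D))) \<le> e"
      by (rule star[unfolded star_flat_def, rule_format]) (use y in \<open>auto simp: good_indices_def\<close>)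
    have 2: "pr (\<lambda>x. Q (x ` insert a D) (x ` insert b D) (x ` insert y {}) \<noteq> f' (x ` insert a D) (x ` insert b D)) \<le> 42 * \<epsilon>"
      by (rule Qf') (use y in \<open>auto simp: good_indices_def\<close>)
    have 3: "pr (\<lambda>x. Q (x ` insert b D) (x ` insert c D) (x ` insert y {}) \<noteq> f' (x ` insert b D) (x ` insert c D)) \<le> 42 * \<epsilon>"
      by (rule Qf') (use y in \<open>auto simp: good_indices_def\<close>)
    have 4: "pr (\<lambda>x. Q (x ` insert a D) (x ` insert c D) (x ` insert y {}) \<noteq> f' (x ` insert a D) (x ` insert c D)) \<le> 42 * \<epsilon>"
      by (rule Qf') (use y in \<open>auto simp: good_indices_def\<close>)
    have "pr (\<lambda>x. \<not> flat f' (x ` insert a D) (x ` insert b D) (x ` insert c D)) \<le> e + (42 * \<epsilon> + (42 * \<epsilon> + 42 * \<epsilon>))"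
    proof (rule pr_le[OF _ pr_disj[OF 1 pr_disj[OF 2 pr_disj[OF 3 4]]]], rule ccontr)
      fix x :: "nat \<Rightarrow> 'a"
      have "x ` insert p D \<union> x ` insert y {} = x ` insert p (insert y D)" for p by auto
      moreover assume "\<not> flat f' (x ` insert a D) (x ` insert b D) (x ` insert c D)"
        "\<not> (\<not> flat f (x ` insert a (insert y D)) (x ` insert b (insert y D)) (x ` insert c (insert y D)) \<or>
          Q (x ` insert a D) (x ` insert b D) (x ` insert y {}) \<noteq> f' (x ` insert a D) (x ` insert b D) \<or>
          Q (x ` insert b D) (x ` insert c D) (x ` insert y {}) \<noteq> f' (x ` insert b D) (x ` insert c D) \<or>
          Q (x ` insert a D) (x ` insert c D) (x ` insert y {}) \<noteq> f' (x ` insert a D) (x ` insert c D))"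
      ultimately show False
        using tri[of "x ` insert a D" "x ` insert b D" "x ` insert y {}" "x ` insert c D"]
        unfolding flat_def[of f'] by metis
    qed
    then show "pr (\<lambda>x. \<not> flat f' (x ` insert a D) (x ` insert b D) (x ` insert c D)) \<le> 127 * \<epsilon>"
      using \<epsilon> by linarith
  qed
  have costar': "costar_flat k f' (127 * \<epsilon>)"
    unfolding costar_flat_def
  proof (intro allI impI)
    fix j D a b c assume j: "k = Suc j" and D: "good_indices j D [a, b, c]"
    obtain y where y: "good_indices j D [y, a, b, c]"
      using extend_good_indices[OF D] k j r by auto
    have 1: "pr (\<lambda>x. \<not> flat f (x ` insert a (insert b (insert y D))) (x ` insert b (insert c (insert y D))) (x ` insert a (insert c (insert y D)))) \<le> e"
      by (rule costar[unfolded costar_flat_def, rule_format, OF refl]) (use y j in \<open>auto simp: good_indices_def\<close>)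
    have 2: "pr (\<lambda>x. Q (x ` insert a (insert b D)) (x ` insert c (insert b D)) (x ` insert y {}) \<noteq>
        f' (x ` insert a (insert b D)) (x ` insert c (insert b D))) \<le> 42 * \<epsilon>"
      by (rule Qf') (use y j in \<open>auto simp: good_indices_def\<close>)
    have 3: "pr (\<lambda>x. Q (x ` insert b (insert c D)) (x ` insert a (insert c D)) (x ` insert y {}) \<noteq>
        f' (x ` insert b (insert c D)) (x ` insert a (insert c D))) \<le> 42 * \<epsilon>"
      by (rule Qf') (use y j in \<open>auto simp: good_indices_def\<close>)
    have 4: "pr (\<lambda>x. Q (x ` insert b (insert a D)) (x ` insert c (insert a D)) (x ` insert y {}) \<noteq>
        f' (x ` insert b (insert a D)) (x ` insert c (insert a D))) \<le> 42 * \<epsilon>"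
      by (rule Qf') (use y j in \<open>auto simp: good_indices_def\<close>)
    have "pr (\<lambda>x. \<not> flat f' (x ` insert a (insert b D)) (x ` insert b (insert c D)) (x ` insert a (insert c D))) \<le>
        e + (42 * \<epsilon> + (42 * \<epsilon> + 42 * \<epsilon>))"
    proof (rule pr_le[OF _ pr_disj[OF 1 pr_disj[OF 2 pr_disj[OF 3 4]]]], rule ccontr)
      fix x :: "nat \<Rightarrow> 'a"
      have "x ` insert p (insert q D) \<union> x ` insert y {} = x ` insert p (insert q (insert y D))" for p q by auto
      moreover have "x ` insert c (insert b D) = x ` insert b (insert c D)"
        "x ` insert b (insert a D) = x ` insert a (insert b D)"
        "x ` insert c (insert a D) = x ` insert a (insert c D)" by auto
      moreover assume "\<not> flat f' (x ` insert a (insert b D)) (x ` insert b (insert c D)) (x ` insert a (insert c D))"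
        "\<not> (\<not> flat f (x ` insert a (insert b (insert y D))) (x ` insert b (insert c (insert y D))) (x ` insert a (insert c (insert y D))) \<or>
          Q (x ` insert a (insert b D)) (x ` insert c (insert b D)) (x ` insert y {}) \<noteq>
            f' (x ` insert a (insert b D)) (x ` insert c (insert b D)) \<or>
          Q (x ` insert b (insert c D)) (x ` insert a (insert c D)) (x ` insert y {}) \<noteq>
            f' (x ` insert b (insert c D)) (x ` insert a (insert c D)) \<or>
          Q (x ` insert b (insert a D)) (x ` insert c (insert a D)) (x ` insert y {}) \<noteq>
            f' (x ` insert b (insert a D)) (x ` insert c (insert a D)))"
      ultimately show False
        using tri[of "x ` insert a (insert b D)" "x ` insert b (insert c D)" "x ` insert y {}" "x ` insert a (insert c D)"]
        unfolding flat_def[of f'] by metis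
    qed
    then show "pr (\<lambda>x. \<not> flat f' (x ` insert a (insert b D)) (x ` insert b (insert c D)) (x ` insert a (insert c D))) \<le> 127 * \<epsilon>"
      using \<epsilon> by linarith
  qed
  obtain h where hc: "\<And>s. h s \<in> carrier G" and h: "\<And>D a b. good_indices k D [a, b] \<Longrightarrow>
      pr (\<lambda>x. f' (x ` insert a D) (x ` insert b D) \<noteq> h (x ` insert a D) \<otimes> inv h (x ` insert b D)) \<le> M * (127 * \<epsilon>)"
    using IH[OF f' _ star' costar'] \<epsilon> by auto
  define L where "L s y = g (s - {y}) y \<otimes> h (s - {y})" for s y
  have Lc: "L s y \<in> carrier G" for s y using gc hc by (simp add: L_def)
  \<comment> \<open>The 45 consists of 42 for replacing \<open>Q\<close> by \<open>f'\<close>, one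
    triangle, and two uses of the potentials.\<close>
  define \<eta> where "\<eta> = M * (127 * \<epsilon>) + 45 * \<epsilon>"
  have \<eta>0: "0 \<le> \<eta>" using \<epsilon> M by (simp add: \<eta>_def)
  have LL: "pr (\<lambda>x. L (x ` S) (x a) \<noteq> L (x ` S) (x b)) \<le> \<eta>"
    if S: "card S = Suc (Suc k)" "S \<subseteq> {..<d + 1}" "a \<in> S" "b \<in> S" "a \<noteq> b" for S a b
  proof -
    define D where "D = S - {a, b}"
    have fS: "finite S" using finite_subset[OF S(2)] by simp
    have SD: "S = insert a (insert b D)" using S by (auto simp: D_def)
    have "good_indices k D [a, b]"
      using S fS by (auto simp: good_indices_def D_def card_Diff_subset)
    \<comment> \<open>Let s and t be the images of \<open>insert a D\<close> and
      \<open>insert b D\<close>. In the triangle s+z, \<open>s \<union> t\<close>, t+z both sides at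
      \<open>s \<union> t\<close> are given by the potentials of s and t, so \<open>Q\<close> at z
      no longer involves z: it is the inverse of \<open>g s b\<close> times \<open>g t a\<close>.
      Comparing with \<open>h s\<close> times the inverse of \<open>h t\<close> gives the equality
      of the two values of \<open>L\<close>.\<close>
    then obtain z where z: "good_indices k D [z, a, b]"
      using extend_good_indices[of k D "[a, b]"] k r by auto
    have 1: "pr (\<lambda>x. f' (x ` insert a D) (x ` insert b D) \<noteq> h (x ` insert a D) \<otimes> inv h (x ` insert b D)) \<le> M * (127 * \<epsilon>)"
      by (rule h) (use z in \<open>auto simp: good_indices_def\<close>)
    have 2: "pr (\<lambda>x. Q (x ` insert a D) (x ` insert b D) (x ` insert z {}) \<noteq> f' (x ` insert a D) (x ` insert b D)) \<le> 42 * \<epsilon>"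
      by (rule Qf') (use z in \<open>auto simp: good_indices_def\<close>)
    have 3: "pr (\<lambda>x. \<not> flat f (x ` insert z (insert a D)) (x ` insert a (insert b D)) (x ` insert z (insert b D))) \<le> e"
      by (rule costar[unfolded costar_flat_def, rule_format, OF refl]) (use z in \<open>auto simp: good_indices_def\<close>)
    have 4: "pr (\<lambda>x. f (x ` insert z (insert a D)) (x ` insert b (insert a D)) \<noteq>
        g (x ` insert a D) (x z) \<otimes> inv g (x ` insert a D) (x b)) \<le> e / \<beta>"
      by (rule g) (use z in \<open>auto simp: good_indices_def\<close>)
    have 5: "pr (\<lambda>x. f (x ` insert a (insert b D)) (x ` insert z (insert b D)) \<noteq>
        g (x ` insert b D) (x a) \<otimes> inv g (x ` insert b D) (x z)) \<le> e / \<beta>"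
      by (rule g) (use z in \<open>auto simp: good_indices_def\<close>)
    have "pr (\<lambda>x. L (x ` S) (x a) \<noteq> L (x ` S) (x b)) \<le> M * (127 * \<epsilon>) + (42 * \<epsilon> + (e + (e / \<beta> + e / \<beta>)))"
    proof (rule pr_le[OF _ pr_disj[OF 1 pr_disj[OF 2 pr_disj[OF 3 pr_disj[OF 4 5]]]]], rule ccontr)
      fix x assume x: "x \<in> set_pmf P"
      have "S - {a} = insert b D" "S - {b} = insert a D"
        using z by (auto simp: SD good_indices_def)
      then have xS: "x ` S - {x a} = x ` insert b D" "x ` S - {x b} = x ` insert a D"
        using image_remove[OF x S(2)] S(3,4) by auto
      assume "\<not> (f' (x ` insert a D) (x ` insert b D) \<noteq> h (x ` insert a D) \<otimes> inv h (x ` insert b D) \<or>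
        Q (x ` insert a D) (x ` insert b D) (x ` insert z {}) \<noteq> f' (x ` insert a D) (x ` insert b D) \<or>
        \<not> flat f (x ` insert z (insert a D)) (x ` insert a (insert b D)) (x ` insert z (insert b D)) \<or>
        f (x ` insert z (insert a D)) (x ` insert b (insert a D)) \<noteq>
        g (x ` insert a D) (x z) \<otimes> inv g (x ` insert a D) (x b) \<or>
        f (x ` insert a (insert b D)) (x ` insert z (insert b D)) \<noteq>
        g (x ` insert b D) (x a) \<otimes> inv g (x ` insert b D) (x z))"
      then have e1: "f' (x ` insert a D) (x ` insert b D) = h (x ` insert a D) \<otimes> inv h (x ` insert b D)"
        and e2: "Q (x ` insert a D) (x ` insert b D) (x ` insert z {}) = f' (x ` insert a D) (x ` insert b D)"
        and e3: "f (x ` insert z (insert a D)) (x ` insert z (insert b D)) =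
          f (x ` insert z (insert a D)) (x ` insert a (insert b D)) \<otimes> f (x ` insert a (insert b D)) (x ` insert z (insert b D))"
        and e4: "f (x ` insert z (insert a D)) (x ` insert a (insert b D)) =
          g (x ` insert a D) (x z) \<otimes> inv g (x ` insert a D) (x b)"
        and e5: "f (x ` insert a (insert b D)) (x ` insert z (insert b D)) =
          g (x ` insert b D) (x a) \<otimes> inv g (x ` insert b D) (x z)"
        unfolding flat_def insert_commute[of b a] by blast+
      have "h (x ` insert a D) \<otimes> inv h (x ` insert b D) = inv g (x ` insert a D) (x b) \<otimes> g (x ` insert b D) (x a)"
        unfolding e1[symmetric] e2[symmetric] Q e3 e4 e5 using gc by (simp add: group_word_simps)
      then have "g (x ` insert a D) (x b) \<otimes> (h (x ` insert a D) \<otimes> inv h (x ` insert b D)) \<otimes> h (x ` insert b D) =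
          g (x ` insert a D) (x b) \<otimes> (inv g (x ` insert a D) (x b) \<otimes> g (x ` insert b D) (x a)) \<otimes> h (x ` insert b D)"
        by simp
      then have "L (x ` S) (x b) = L (x ` S) (x a)"
        unfolding L_def xS using gc hc by (simp add: group_word_simps)
      moreover assume "L (x ` S) (x a) \<noteq> L (x ` S) (x b)"
      ultimately show False by simp
    qed
    also have "\<dots> \<le> \<eta>" using \<epsilon> by (simp add: \<eta>_def \<epsilon>_def)
    finally show ?thesis .
  qed
  obtain y where y: "\<forall>S b. card S = Suc (Suc k) \<longrightarrow> S \<subseteq> {..<d + 1} \<longrightarrow> b \<in> S \<longrightarrow>
    pr (\<lambda>x. y (x ` S) \<noteq> x b \<and> L (x ` S) (y (x ` S)) \<noteq> L (x ` S) (x b)) \<le> \<eta>"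
    using select_good_element[where m = "Suc (Suc k)" and e = \<eta> and R = "\<lambda>s a b. L s a \<noteq> L s b", OF _ _ \<eta>0 LL] k r
    by auto
  define H where "H s = L s (y s)" for s
  have "pr (\<lambda>x. f (x ` insert v A) (x ` insert w A) \<noteq> H (x ` insert v A) \<otimes> inv H (x ` insert w A)) \<le> (513 / \<beta>) * M * e"
    if A: "good_indices (Suc k) A [v, w]" for A v w
  proof -
    \<comment> \<open>A vertex \<open>a\<close> common to both faces is removed: \<open>Q\<close> at
      \<open>a\<close> recovers \<open>f\<close> from the coboundary of \<open>h\<close>, and the
      selected vertices of the two faces are exchanged for \<open>a\<close> at the price
      \<open>\<eta>\<close> each.\<close>
    have "A \<noteq> {}" using A by (auto simp: good_indices_def)
    then obtain a D where aD: "A = insert a D" "a \<notin> D" by (metis Set.set_insert all_not_in_conv)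
    have D: "good_indices k D [v, w, a]"
      using A aD by (auto simp: good_indices_def)
    have 1: "pr (\<lambda>x. Q (x ` insert v D) (x ` insert w D) (x ` insert a {}) \<noteq> f' (x ` insert v D) (x ` insert w D)) \<le> 42 * \<epsilon>"
      by (rule Qf'[OF D])
    have 2: "pr (\<lambda>x. f' (x ` insert v D) (x ` insert w D) \<noteq> h (x ` insert v D) \<otimes> inv h (x ` insert w D)) \<le> M * (127 * \<epsilon>)"
      by (rule h) (use D in \<open>auto simp: good_indices_def\<close>)
    have 3: "pr (\<lambda>x. y (x ` insert v A) \<noteq> x a \<and> L (x ` insert v A) (y (x ` insert v A)) \<noteq> L (x ` insert v A) (x a)) \<le> \<eta>"
      by (rule y[rule_format]) (use A aD in \<open>auto simp: good_indices_def\<close>)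
    have 4: "pr (\<lambda>x. y (x ` insert w A) \<noteq> x a \<and> L (x ` insert w A) (y (x ` insert w A)) \<noteq> L (x ` insert w A) (x a)) \<le> \<eta>"
      by (rule y[rule_format]) (use A aD in \<open>auto simp: good_indices_def\<close>)
    have "pr (\<lambda>x. f (x ` insert v A) (x ` insert w A) \<noteq> H (x ` insert v A) \<otimes> inv H (x ` insert w A)) \<le>
        42 * \<epsilon> + (M * (127 * \<epsilon>) + (\<eta> + \<eta>))"
    proof (rule pr_le[OF _ pr_disj[OF 1 pr_disj[OF 2 pr_disj[OF 3 4]]]], rule ccontr)
      fix x assume x: "x \<in> set_pmf P"
      have sub: "insert v A \<subseteq> {..<d + 1}" "insert w A \<subseteq> {..<d + 1}" using A by (auto simp: good_indices_def)
      have "insert v A - {a} = insert v D" "insert w A - {a} = insert w D"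
        using D aD by (auto simp: good_indices_def)
      then have xS: "x ` insert v A - {x a} = x ` insert v D" "x ` insert w A - {x a} = x ` insert w D"
        using image_remove[OF x sub(1), of a] image_remove[OF x sub(2), of a] aD by auto
      have xA: "x ` insert p A = x ` insert a (insert p D)" for p using aD by auto
      assume "\<not> (Q (x ` insert v D) (x ` insert w D) (x ` insert a {}) \<noteq> f' (x ` insert v D) (x ` insert w D) \<or>
        f' (x ` insert v D) (x ` insert w D) \<noteq> h (x ` insert v D) \<otimes> inv h (x ` insert w D) \<or>
        y (x ` insert v A) \<noteq> x a \<and> L (x ` insert v A) (y (x ` insert v A)) \<noteq> L (x ` insert v A) (x a) \<or>
        y (x ` insert w A) \<noteq> x a \<and> L (x ` insert w A) (y (x ` insert w A)) \<noteq> L (x ` insert w A) (x a))"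
      then have e: "Q (x ` insert v D) (x ` insert w D) (x ` insert a {}) = h (x ` insert v D) \<otimes> inv h (x ` insert w D)"
        "H (x ` insert v A) = L (x ` insert v A) (x a)" "H (x ` insert w A) = L (x ` insert w A) (x a)"
        unfolding H_def by metis+
      have "f (x ` insert v A) (x ` insert w A) =
          (g (x ` insert v D) (x a) \<otimes> h (x ` insert v D)) \<otimes> inv (g (x ` insert w D) (x a) \<otimes> h (x ` insert w D))"
        unfolding xA by (rule conjugate_eq_imp_eq) (use e(1)[unfolded Q] gc hc fc in auto)
      then have "f (x ` insert v A) (x ` insert w A) = H (x ` insert v A) \<otimes> inv H (x ` insert w A)"
        unfolding e(2,3) L_def xS .
      moreover assume "f (x ` insert v A) (x ` insert w A) \<noteq> H (x ` insert v A) \<otimes> inv H (x ` insert w A)"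
      ultimately show False by simp
    qed
    \<comment> \<open>381 = 3 * 127 and 132 = 42 + 2 * 45. Since \<open>1 \<le> M\<close>, their sum
      513 bounds the loss of one descent step.\<close>
    also have "\<dots> = 381 * (M * \<epsilon>) + 132 * \<epsilon>" by (simp add: \<eta>_def algebra_simps)
    also have "\<dots> \<le> 513 * (M * \<epsilon>)" using mult_right_mono[OF M \<epsilon>(2)] by simp
    also have "\<dots> = (513 / \<beta>) * M * e" by (simp add: \<epsilon>_def)
    finally show ?thesis .
  qed
  then show ?thesis using Lc by (intro exI[of _ H]) (auto simp: H_def)
qed

text \<open>Each size of the common part, from \<open>k\<close> down to 0, uses the expansion of
  links once and costs one factor 513 / \<beta>, so the exponent is the number of vertices of the
  faces.\<close>

theorem johnson_cocycle_is_coboundary: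
  assumes "k \<le> r" "antisymmetric f" "0 \<le> e" "star_flat k f e" "costar_flat k f e"
  shows "\<exists>h. (\<forall>s. h s \<in> carrier G) \<and> (\<forall>D a b. good_indices k D [a, b] \<longrightarrow>
    pr (\<lambda>x. f (x ` insert a D) (x ` insert b D) \<noteq> h (x ` insert a D) \<otimes> inv h (x ` insert b D)) \<le>
      (513 / \<beta>) ^ (k + 1) * e)"
  using assms
proof (induction k arbitrary: f e)
  case 0
  \<comment> \<open>Here the common part is empty and the faces are single vertices, so the
    potential in the link of the empty face is already the desired \<open>h\<close>.\<close>
  obtain g where gc: "\<And>A v. g A v \<in> carrier G" and g: "\<And>D a b. good_indices 0 D [a, b] \<Longrightarrow>
      pr (\<lambda>x. f (x ` insert a D) (x ` insert b D) \<noteq> g (x ` D) (x a) \<otimes> inv g (x ` D) (x b)) \<le> e / \<beta>"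
    using star_coboundary[OF _ 0(2,4)] by auto
  have "pr (\<lambda>x. f (x ` insert a D) (x ` insert b D) \<noteq>
      g {} (the_elem (x ` insert a D)) \<otimes> inv g {} (the_elem (x ` insert b D))) \<le> (513 / \<beta>) ^ (0 + 1) * e"
    if D: "good_indices 0 D [a, b]" for D a b
  proof -
    have "D = {}" using D by (auto simp: good_indices_def card_eq_0_iff)
    then have "pr (\<lambda>x. f (x ` insert a D) (x ` insert b D) \<noteq>
      g {} (the_elem (x ` insert a D)) \<otimes> inv g {} (the_elem (x ` insert b D))) \<le> e / \<beta>"
      using g[OF D] by simp
    also have "\<dots> \<le> (513 / \<beta>) ^ (0 + 1) * e" using 0(3) \<beta> by (simp add: field_simps)
    finally show ?thesis .
  qed
  then show ?case using gc by (intro exI[of _ "\<lambda>s. g {} (the_elem s)"]) auto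
next
  case (Suc k)
  have "1 \<le> 513 / \<beta>" using \<beta> by (simp add: field_simps)
  then have M: "1 \<le> (513 / \<beta>) ^ (k + 1)" by (rule one_le_power)
  have "\<exists>h. (\<forall>s. h s \<in> carrier G) \<and> (\<forall>D a b. good_indices (Suc k) D [a, b] \<longrightarrow>
        pr (\<lambda>x. f (x ` insert a D) (x ` insert b D) \<noteq> h (x ` insert a D) \<otimes> inv h (x ` insert b D)) \<le>
          (513 / \<beta>) * (513 / \<beta>) ^ (k + 1) * e)"
    using Suc.prems(1) by (intro johnson_step[OF Suc.prems Suc.IH M]) auto
  then show ?case by simp
qed

end

section \<open>From disjoint faces to the Johnson graph and back\<close>

context random_labelling
begin

lemma fresh_block:
  assumes "card S + n \<le> d + 1" "S \<subseteq> {..<d + 1}"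
  shows "\<exists>W. card W = n \<and> W \<subseteq> {..<d + 1} \<and> W \<inter> S = {}"
proof -
  have "card ({..<d + 1} - S) = d + 1 - card S"
    using assms(2) by (simp add: card_Diff_subset finite_subset)
  then have "n \<le> card ({..<d + 1} - S)" using assms(1) by simp
  then obtain W where "W \<subseteq> {..<d + 1} - S" "card W = n"
    using obtain_subset_with_card_n by metis
  then show ?thesis by blast
qed

end

context coboundary_labelling
begin

lemma blocks_nonempty: "card S = r + 1 \<Longrightarrow> \<exists>a U. S = insert a U \<and> a \<notin> U \<and> card U = r \<and> finite U"
proof -
  assume S: "card S = r + 1"
  then obtain a where a: "a \<in> S" by (metis add_is_0 card.empty ex_in_conv one_neq_zero)
  have "finite S" using S by (intro card_ge_0_finite) simp
  then show ?thesis using S a by (intro exI[of _ a] exI[of _ "S - {a}"]) auto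
qed

text \<open>A cocycle on pairs of disjoint faces extends to pairs \<open>(s, t)\<close> of adjacent vertices of the
  Johnson graph by \<open>f s u * f u t\<close> for \<open>u\<close> disjoint from both, and the extension is a coboundary
  \<open>h s * (h t)^-1\<close>.  Then \<open>(h s)^-1 * f s u * h u\<close> is nearly independent of \<open>s\<close>; as it equals some
  \<open>c u\<close>, the cocycle identity \<open>c t * c u = c u\<close> makes it trivial.\<close>

theorem disjoint_cocycle_is_coboundary:
  fixes f :: "'a set \<Rightarrow> 'a set \<Rightarrow> nat"
  assumes f: "antisymmetric f" and e: "0 \<le> e"
    and flat: "\<And>S T U. card S = r + 1 \<Longrightarrow> card T = r + 1 \<Longrightarrow> card U = r + 1 \<Longrightarrow> S \<inter> T = {} \<Longrightarrow> S \<inter> U = {} \<Longrightarrow>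
      T \<inter> U = {} \<Longrightarrow> S \<union> T \<union> U \<subseteq> {..<d + 1} \<Longrightarrow> pr (\<lambda>x. \<not> flat f (x ` S) (x ` T) (x ` U)) \<le> e"
  shows "\<exists>h. (\<forall>s. h s \<in> carrier G) \<and> (\<forall>S T. card S = r + 1 \<longrightarrow> card T = r + 1 \<longrightarrow> S \<inter> T = {} \<longrightarrow>
    S \<union> T \<subseteq> {..<d + 1} \<longrightarrow>
    pr (\<lambda>x. f (x ` S) (x ` T) \<noteq> h (x ` S) \<otimes> inv h (x ` T)) \<le> (1231713 / \<beta>) ^ (r + 1) * e)"
proof -
  note fc = antisymmetricD[OF f]
  define Q where "Q s t u = f s u \<otimes> f u t" for s t u
  have Qa: "antisymmetric (\<lambda>s t. Q s t u)" for u
    unfolding antisymmetric_def Q_def using fc by (simp add: inv_mult_group)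
  obtain f1 where f1: "antisymmetric f1" and f1_pl: "\<forall>S T U a b. card U = r \<longrightarrow> (S \<union> T) \<inter> U = {} \<longrightarrow> a \<noteq> b \<longrightarrow>
    {a, b} \<inter> (S \<union> T \<union> U) = {} \<longrightarrow> {a, b} \<union> S \<union> T \<union> U \<subseteq> {..<d + 1} \<longrightarrow>
    pr (\<lambda>x. Q (x ` S) (x ` T) (x ` insert a U) \<noteq> f1 (x ` S) (x ` T)) \<le>
      7 ^ (r + 1) * pr (\<lambda>x. Q (x ` S) (x ` T) (x ` insert a U) \<noteq> Q (x ` S) (x ` T) (x ` insert b U))"
    using oriented_plurality[where Q = Q and m = r, OF Qa] by (elim exE conjE) (rule that; assumption)
  \<comment> \<open>Four triangles to replace one vertex of the test face, times the plurality
    factor for faces of \<open>r + 1\<close> vertices.\<close>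
  define \<delta> where "\<delta> = 4 * 7 ^ (r + 1) * e"
  have \<delta>0: "0 \<le> \<delta>" using e by (simp add: \<delta>_def)
  have Qf1: "pr (\<lambda>x. Q (x ` S) (x ` T) (x ` U) \<noteq> f1 (x ` S) (x ` T)) \<le> \<delta>"
    if S: "card S = r + 1" "card T = r + 1" "card U = r + 1" "card (S \<union> T) \<le> r + 2" "(S \<union> T) \<inter> U = {}"
      "S \<union> T \<union> U \<subseteq> {..<d + 1}" for S T U
  proof -
    obtain a U0 where U: "U = insert a U0" "a \<notin> U0" "card U0 = r" "finite U0"
      using blocks_nonempty[OF S(3)] by auto
    have fST: "finite (S \<union> T)" using finite_subset[OF S(6)] by simp
    have cST: "card (S \<union> T \<union> U) \<le> 2 * r + 3"
      using card_Un_le[of "S \<union> T" U] S(3,4) by simp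
    then obtain b where b: "b < d + 1" "b \<notin> S \<union> T \<union> U"
      using fresh_index[of "S \<union> T \<union> U"] S(6) r by auto
    \<comment> \<open>The test faces \<open>insert a U0\<close> and \<open>insert b U0\<close>
      overlap, so no triangle of \<open>f\<close> contains both. A face \<open>W\<close> disjoint
      from everything mediates: both values of \<open>Q\<close> agree with the one at
      \<open>W\<close>. The indices fit because \<open>3 * r + 5 \<le> d + 1\<close>.\<close>
    have "card (insert b (S \<union> T \<union> U)) \<le> 2 * r + 4"
      using cST card_insert_le_m1[of "2 * r + 4" "S \<union> T \<union> U" b] by simp
    then obtain W where W: "card W = r + 1" "W \<subseteq> {..<d + 1}" "W \<inter> insert b (S \<union> T \<union> U) = {}"
      using fresh_block[of "insert b (S \<union> T \<union> U)" "r + 1"] S(6) b(1) r by auto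
    have bU: "card (insert b U0) = r + 1" using U b by simp
    have 1: "pr (\<lambda>x. \<not> flat f (x ` S) (x ` W) (x ` insert a U0)) \<le> e"
      by (rule flat) (use S W U in auto)
    have 2: "pr (\<lambda>x. \<not> flat f (x ` insert a U0) (x ` W) (x ` T)) \<le> e"
      by (rule flat) (use S W U in auto)
    have 3: "pr (\<lambda>x. \<not> flat f (x ` S) (x ` W) (x ` insert b U0)) \<le> e"
      by (rule flat) (use S W U b bU in auto)
    have 4: "pr (\<lambda>x. \<not> flat f (x ` insert b U0) (x ` W) (x ` T)) \<le> e"
      by (rule flat) (use S W U b bU in auto)
    have QW: "Q s t u = f s w \<otimes> f w t" if "flat f s w u" "flat f u w t" for s t u w
    proof -
      have "f w u = inv f u w" using fc by simp
      then show ?thesis unfolding Q_def that[unfolded flat_def] using fc(1) by (simp add: group_word_simps)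
    qed
    have "pr (\<lambda>x. Q (x ` S) (x ` T) (x ` insert a U0) \<noteq> Q (x ` S) (x ` T) (x ` insert b U0)) \<le> e + (e + (e + e))"
      by (rule pr_le[OF _ pr_disj[OF 1 pr_disj[OF 2 pr_disj[OF 3 4]]]]) (metis QW)
    then have "7 ^ (r + 1) * pr (\<lambda>x. Q (x ` S) (x ` T) (x ` insert a U0) \<noteq> Q (x ` S) (x ` T) (x ` insert b U0)) \<le>
        7 ^ (r + 1) * (e + (e + (e + e)))"
      by (rule mult_left_mono) simp
    moreover have "pr (\<lambda>x. Q (x ` S) (x ` T) (x ` insert a U0) \<noteq> f1 (x ` S) (x ` T)) \<le>
      7 ^ (r + 1) * pr (\<lambda>x. Q (x ` S) (x ` T) (x ` insert a U0) \<noteq> Q (x ` S) (x ` T) (x ` insert b U0))"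
      by (rule f1_pl[rule_format]) (use S U b in auto)
    moreover have "\<delta> = 7 ^ (r + 1) * (e + (e + (e + e)))" by (simp add: \<delta>_def)
    ultimately show ?thesis unfolding U(1) by linarith
  qed
  have tri: "pr (\<lambda>x. \<not> flat f1 (x ` S) (x ` T) (x ` V)) \<le> 3 * \<delta>"
    if S: "card S = r + 1" "card T = r + 1" "card V = r + 1"
      "card (S \<union> T) \<le> r + 2" "card (T \<union> V) \<le> r + 2" "card (S \<union> V) \<le> r + 2"
      "S \<union> T \<union> V \<subseteq> {..<d + 1}" for S T V
  proof -
    have "card (S \<union> T \<union> V) \<le> 2 * r + 3"
      using card_Un_le[of "S \<union> T" V] S by simp
    then obtain U where U: "card U = r + 1" "U \<subseteq> {..<d + 1}" "U \<inter> (S \<union> T \<union> V) = {}"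
      using fresh_block[of "S \<union> T \<union> V" "r + 1"] S(7) r by auto
    have 1: "pr (\<lambda>x. Q (x ` S) (x ` T) (x ` U) \<noteq> f1 (x ` S) (x ` T)) \<le> \<delta>"
      by (rule Qf1) (use S U in auto)
    have 2: "pr (\<lambda>x. Q (x ` T) (x ` V) (x ` U) \<noteq> f1 (x ` T) (x ` V)) \<le> \<delta>"
      by (rule Qf1) (use S U in auto)
    have 3: "pr (\<lambda>x. Q (x ` S) (x ` V) (x ` U) \<noteq> f1 (x ` S) (x ` V)) \<le> \<delta>"
      by (rule Qf1) (use S U in auto)
    \<comment> \<open>For a common \<open>u\<close> this is exact, as \<open>f u t\<close> and
      \<open>f t u\<close> cancel. The losses come from replacing \<open>Q\<close> by
      \<open>f1\<close>.\<close>
    have Q3: "Q s v u = Q s t u \<otimes> Q t v u" for s t v u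
    proof -
      have "f u t = inv f t u" using fc by simp
      then show ?thesis unfolding Q_def using fc(1) by (simp add: group_word_simps)
    qed
    have "pr (\<lambda>x. \<not> flat f1 (x ` S) (x ` T) (x ` V)) \<le> \<delta> + (\<delta> + \<delta>)"
      by (rule pr_le[OF _ pr_disj[OF 1 pr_disj[OF 2 3]]]) (metis Q3 flat_def)
    then show ?thesis by simp
  qed
  have star: "star_flat r f1 (3 * \<delta>)"
    unfolding star_flat_def
  proof (intro allI impI)
    fix D a b c assume D: "good_indices r D [a, b, c]"
    have un: "insert p D \<union> insert q D = insert p (insert q D)" for p q by auto
    show "pr (\<lambda>x. \<not> flat f1 (x ` insert a D) (x ` insert b D) (x ` insert c D)) \<le> 3 * \<delta>"
      by (rule tri) (use D in \<open>auto simp: good_indices_def un\<close>)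
  qed
  have costar: "costar_flat r f1 (3 * \<delta>)"
    unfolding costar_flat_def
  proof (intro allI impI)
    fix j D a b c assume j: "r = Suc j" and D: "good_indices j D [a, b, c]"
    have un: "insert a (insert b D) \<union> insert b (insert c D) = insert a (insert b (insert c D))"
      "insert b (insert c D) \<union> insert a (insert c D) = insert a (insert b (insert c D))"
      "insert a (insert b D) \<union> insert a (insert c D) = insert a (insert b (insert c D))" by auto
    have "card (insert a (insert b (insert c D))) = r + 2"
      using D j by (auto simp: good_indices_def)
    then show "pr (\<lambda>x. \<not> flat f1 (x ` insert a (insert b D)) (x ` insert b (insert c D)) (x ` insert a (insert c D))) \<le> 3 * \<delta>"
      using D j by (intro tri) (simp_all only: un order_refl, auto simp: good_indices_def)
  qed
  define M where "M = (513 / \<beta>) ^ (r + 1)"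
  have "1 \<le> 513 / \<beta>" using \<beta> by (simp add: field_simps)
  then have M: "1 \<le> M" unfolding M_def by (rule one_le_power)
  obtain h where hc: "\<And>s. h s \<in> carrier G" and h: "\<And>D a b. good_indices r D [a, b] \<Longrightarrow>
      pr (\<lambda>x. f1 (x ` insert a D) (x ` insert b D) \<noteq> h (x ` insert a D) \<otimes> inv h (x ` insert b D)) \<le> M * (3 * \<delta>)"
    using johnson_cocycle_is_coboundary[OF order_refl f1 _ star costar] \<delta>0 unfolding M_def by auto
  define K where "K u s = inv h s \<otimes> f s u \<otimes> h u" for u s
  obtain C :: "'a set \<Rightarrow> ('a set \<Rightarrow> nat) \<Rightarrow> nat" where C: "\<forall>A F. C A F \<in> range F"
    "\<forall>I U a b F. depends_only_on I F \<longrightarrow> finite I \<longrightarrow> finite U \<longrightarrow> card U = r \<longrightarrow> I \<inter> U = {} \<longrightarrow>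
       a \<noteq> b \<longrightarrow> a \<notin> I \<union> U \<longrightarrow> b \<notin> I \<union> U \<longrightarrow> insert a (insert b (I \<union> U)) \<subseteq> {..<d + 1} \<longrightarrow>
       pr (\<lambda>x. F x (x ` insert a U) \<noteq> C (x ` I) (F x)) \<le>
         7 ^ (r + 1) * pr (\<lambda>x. F x (x ` insert a U) \<noteq> F x (x ` insert b U))"
    using set_plurality[where ?'c = nat and m = r] by (elim exE conjE) (rule that; assumption)
  define c where "c u = C u (K u)" for u
  have cc: "c u \<in> carrier G" for u
    using C(1)[rule_format, of u "K u"] hc fc by (auto simp: c_def K_def)
  \<comment> \<open>\<open>4 * (M * \<delta>)\<close> bounds
    \<open>\<delta> + 3 * M * \<delta>\<close>, the chance that \<open>K u\<close> changes when one
    vertex of its argument is replaced; the power of 7 is the second plurality over whole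
    faces.\<close>
  define \<delta>2 where "\<delta>2 = 7 ^ (r + 1) * (4 * (M * \<delta>))"
  have Kc: "pr (\<lambda>x. K (x ` U) (x ` S) \<noteq> c (x ` U)) \<le> \<delta>2"
    if S: "card S = r + 1" "card U = r + 1" "S \<inter> U = {}" "S \<union> U \<subseteq> {..<d + 1}" for S U
  proof -
    obtain a S0 where S0: "S = insert a S0" "a \<notin> S0" "card S0 = r" "finite S0"
      using blocks_nonempty[OF S(1)] by auto
    have fU: "finite U" using finite_subset[OF S(4)] by simp
    have "card (S \<union> U) \<le> d" using card_Un_le[of S U] S r by simp
    then obtain b where b: "b < d + 1" "b \<notin> S \<union> U" using fresh_index[of "S \<union> U"] S(4) by auto
    have dep: "depends_only_on U (\<lambda>x. K (x ` U))"
      unfolding depends_only_on_def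
    proof (intro allI impI)
      fix x y :: "nat \<Rightarrow> 'a" assume "\<forall>i\<in>U. x i = y i"
      then have "x ` U = y ` U" by (auto intro!: image_cong)
      then show "K (x ` U) = K (y ` U)" by simp
    qed
    have un: "insert a S0 \<union> insert b S0 = insert a (insert b S0)" by auto
    have 1: "pr (\<lambda>x. Q (x ` insert a S0) (x ` insert b S0) (x ` U) \<noteq> f1 (x ` insert a S0) (x ` insert b S0)) \<le> \<delta>"
      by (rule Qf1) (use S S0 b un in auto)
    have 2: "pr (\<lambda>x. f1 (x ` insert a S0) (x ` insert b S0) \<noteq> h (x ` insert a S0) \<otimes> inv h (x ` insert b S0)) \<le> M * (3 * \<delta>)"
      by (rule h) (use S S0 b in \<open>auto simp: good_indices_def\<close>)
    \<comment> \<open>The conjugated cochain agrees at \<open>s\<close> and \<open>t\<close> as soon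
      as the path from \<open>s\<close> to \<open>t\<close> through \<open>u\<close> has the value
      predicted by \<open>h\<close>.\<close>
    have KQ: "K u s = K u t" if "Q s t u = h s \<otimes> inv h t" for s t u
    proof -
      have ft: "f u t = inv f t u" using fc by simp
      have "K u s = inv h s \<otimes> Q s t u \<otimes> f t u \<otimes> h u"
        unfolding K_def Q_def ft using fc(1) hc by (simp add: group_word_simps)
      also have "\<dots> = K u t"
        unfolding that K_def using fc(1) hc by (simp add: group_word_simps)
      finally show ?thesis .
    qed
    have "pr (\<lambda>x. K (x ` U) (x ` insert a S0) \<noteq> K (x ` U) (x ` insert b S0)) \<le> \<delta> + M * (3 * \<delta>)"
      by (rule pr_le[OF _ pr_disj[OF 1 2]]) (metis KQ)
    also have "\<dots> \<le> 4 * (M * \<delta>)" using mult_right_mono[OF M \<delta>0] by simp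
    finally have "7 ^ (r + 1) * pr (\<lambda>x. K (x ` U) (x ` insert a S0) \<noteq> K (x ` U) (x ` insert b S0)) \<le> \<delta>2"
      unfolding \<delta>2_def by (rule mult_left_mono) simp
    moreover have "pr (\<lambda>x. K (x ` U) (x ` insert a S0) \<noteq> C (x ` U) (K (x ` U))) \<le>
      7 ^ (r + 1) * pr (\<lambda>x. K (x ` U) (x ` insert a S0) \<noteq> K (x ` U) (x ` insert b S0))"
      by (rule C(2)[rule_format, OF dep]) (use S S0 b fU in auto)
    ultimately show ?thesis unfolding S0(1) c_def by simp
  qed
  have "pr (\<lambda>x. f (x ` S) (x ` T) \<noteq> h (x ` S) \<otimes> inv h (x ` T)) \<le> (1231713 / \<beta>) ^ (r + 1) * e"
    if S: "card S = r + 1" "card T = r + 1" "S \<inter> T = {}" "S \<union> T \<subseteq> {..<d + 1}" for S T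
  proof -
    have "card (S \<union> T) + (r + 1) \<le> d + 1" using card_Un_le[of S T] S r by simp
    then obtain U where U: "card U = r + 1" "U \<subseteq> {..<d + 1}" "U \<inter> (S \<union> T) = {}"
      using fresh_block[of "S \<union> T" "r + 1"] S(4) by auto
    have 1: "pr (\<lambda>x. \<not> flat f (x ` S) (x ` T) (x ` U)) \<le> e"
      by (rule flat) (use S U in auto)
    have 2: "pr (\<lambda>x. K (x ` T) (x ` S) \<noteq> c (x ` T)) \<le> \<delta>2"
      by (rule Kc) (use S U in auto)
    have 3: "pr (\<lambda>x. K (x ` U) (x ` T) \<noteq> c (x ` U)) \<le> \<delta>2"
      by (rule Kc) (use S U in auto)
    have 4: "pr (\<lambda>x. K (x ` U) (x ` S) \<noteq> c (x ` U)) \<le> \<delta>2"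
      by (rule Kc) (use S U in auto)
    have triv: "f s t = h s \<otimes> inv h t"
      if as: "flat f s t u" "K t s = c t" "K u t = c u" "K u s = c u" for s t u
    proof -
      have "K t s \<otimes> K u t = K u s"
        unfolding K_def as(1)[unfolded flat_def] using fc(1) hc by (simp add: group_word_simps)
      then have "c t \<otimes> c u = c u" unfolding as(2-4) .
      then have "c t = \<one>" using cc by simp
      then have "K t s = \<one>" using as(2) by simp
      have "f s t = h s \<otimes> K t s \<otimes> inv h t"
        unfolding K_def using fc(1) hc by (simp add: group_word_simps)
      also have "\<dots> = h s \<otimes> inv h t"
        unfolding \<open>K t s = \<one>\<close> using hc by simp
      finally show ?thesis .
    qed
    have "pr (\<lambda>x. f (x ` S) (x ` T) \<noteq> h (x ` S) \<otimes> inv h (x ` T)) \<le> e + (\<delta>2 + (\<delta>2 + \<delta>2))"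
      by (rule pr_le[OF _ pr_disj[OF 1 pr_disj[OF 2 pr_disj[OF 3 4]]]]) (metis triv)
    \<comment> \<open>48 = 3 * 4 * 4, from three uses of \<open>\<delta>2\<close> and the factors 4
      in \<open>\<delta>2\<close> and \<open>\<delta>\<close>. The prefactor 49 is then absorbed
      into one more power \<open>49 ^ (r + 1)\<close>, so that the bound becomes a pure
      \<open>(r + 1)\<close>-st power times \<open>e\<close>.\<close>
    also have "\<dots> = e + 48 * ((7 ^ (r + 1) * 7 ^ (r + 1)) * M * e)"
      unfolding \<delta>2_def \<delta>_def by (simp add: algebra_simps)
    also have "(7 :: real) ^ (r + 1) * 7 ^ (r + 1) = 49 ^ (r + 1)"
      by (simp only: power_mult_distrib[symmetric]) simp
    also have "e + 48 * (49 ^ (r + 1) * M * e) \<le> 49 * (49 ^ (r + 1) * M * e)"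
    proof -
      have "1 \<le> (49 :: real) ^ (r + 1)" by (rule one_le_power) simp
      then have "1 * 1 \<le> 49 ^ (r + 1) * M" using M by (intro mult_mono) auto
      then have "1 * e \<le> 49 ^ (r + 1) * M * e" using e by (intro mult_right_mono) auto
      then show ?thesis by linarith
    qed
    also have "\<dots> \<le> 49 ^ (r + 1) * (49 ^ (r + 1) * M * e)"
    proof (rule mult_right_mono)
      have "(49 :: real) ^ 1 \<le> 49 ^ (r + 1)" by (rule power_increasing) auto
      then show "(49 :: real) \<le> 49 ^ (r + 1)" by simp
    qed (use M e in auto)
    also have "\<dots> = (49 * 49 * (513 / \<beta>)) ^ (r + 1) * e"
      unfolding M_def power_mult_distrib by (simp only: mult.assoc)
    also have "49 * 49 * (513 / \<beta>) = 1231713 / \<beta>" by simp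
    finally show ?thesis .
  qed
  then show ?thesis using hc by blast
qed

end

subsection \<open>The faces complex\<close>

text \<open>Images of consecutive blocks under a random labelling model a random ordered face of the
  faces complex.\<close>

definition block :: "nat \<Rightarrow> nat \<Rightarrow> nat set" where
  "block n j = {j * n..<(j + 1) * n}"

lemma card_block [simp]: "card (block n j) = n"
  by (simp add: block_def)

lemma block_disjoint: "i \<noteq> j \<Longrightarrow> block n i \<inter> block n j = {}"
proof -
  have "block n i \<inter> block n j = {}" if "i < j" for i j
  proof -
    have "(i + 1) * n \<le> j * n" using that by (intro mult_right_mono) auto
    then show ?thesis by (auto simp: block_def)
  qed
  then show "i \<noteq> j \<Longrightarrow> block n i \<inter> block n j = {}"
    by (metis inf_commute nat_neq_iff)
qed

lemma block_subset: "(j + 1) * n \<le> N \<Longrightarrow> block n j \<subseteq> {..<N}"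
  by (auto simp: block_def)

text \<open>Disjointness is imposed on positions rather than on the underlying set, so that a
  nonempty set cannot occur twice.\<close>

definition disjoint_lists :: "nat \<Rightarrow> nat \<Rightarrow> 'a set \<Rightarrow> 'a set list set" where
  "disjoint_lists n k t = {l. length l = k \<and> (\<forall>s\<in>set l. s \<subseteq> t \<and> card s = n) \<and>
     (\<forall>i<k. \<forall>j<k. i \<noteq> j \<longrightarrow> l ! i \<inter> l ! j = {})}"

definition disjoint_families :: "nat \<Rightarrow> nat \<Rightarrow> 'a set \<Rightarrow> 'a set set set" where
  "disjoint_families n q t = {S. (\<forall>s\<in>S. s \<subseteq> t \<and> card s = n) \<and> disjoint S \<and> card S = q}"

lemma inj_image_set: "inj F \<Longrightarrow> inj ((`) F)"
  by (rule injI) (simp add: inj_image_eq_iff)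

lemma map_permutation_distinct_lists:
  assumes F: "inj F" and S: "finite S" "k \<le> card S"
  shows "map_pmf (map F) (pmf_of_set (distinct_lists k S)) = pmf_of_set (distinct_lists k (F ` S))"
proof (rule map_pmf_of_set_bij_betw)
  show "bij_betw (map F) (distinct_lists k S) (distinct_lists k (F ` S))"
  proof (rule bij_betw_byWitness[where f' = "map (inv_into UNIV F)"])
    have i: "inv_into UNIV F (F x) = x" for x using F by simp
    then show "\<forall>l\<in>distinct_lists k S. map (inv_into UNIV F) (map F l) = l"
      by (simp add: o_def)
    show "\<forall>l\<in>distinct_lists k (F ` S). map F (map (inv_into UNIV F) l) = l"
      using i by (auto simp: distinct_lists_def intro!: map_idI)
    show "map F ` distinct_lists k S \<subseteq> distinct_lists k (F ` S)"
      by (auto simp: distinct_lists_def distinct_map inj_on_subset[OF F subset_UNIV] intro!: imageI)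
    have "inj_on (inv_into UNIV F) (F ` S)" by (simp add: inj_on_inv_into image_mono)
    then show "map (inv_into UNIV F) ` distinct_lists k (F ` S) \<subseteq> distinct_lists k S"
      using i by (auto simp: distinct_lists_def distinct_map intro: inj_on_subset) (metis imageE subsetD)
  qed
qed (use distinct_lists[OF S] in auto)

lemma finite_disjoint_lists: "finite t \<Longrightarrow> finite (disjoint_lists n k t)"
  by (rule finite_subset[OF _ finite_lists_length_eq[of "Pow t" k]]) (auto simp: disjoint_lists_def)

lemma blocks_in_disjoint_lists:
  assumes "x \<in> labellings N t" "k * n \<le> N"
  shows "map (\<lambda>j. x ` block n j) [0..<k] \<in> disjoint_lists n k t"
proof -
  have x: "inj_on x {..<N}" "x ` {..<N} = t"
    using assms(1) by (auto simp: labellings_def bij_betw_def)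
  have sub: "block n j \<subseteq> {..<N}" if "j < k" for j
  proof (rule block_subset)
    have "(j + 1) * n \<le> k * n" using that by (intro mult_right_mono) auto
    then show "(j + 1) * n \<le> N" using assms(2) by simp
  qed
  have "card (x ` block n j) = n" if "j < k" for j
    using card_image[OF inj_on_subset[OF x(1) sub[OF that]]] by simp
  moreover have "x ` block n j \<subseteq> t" if "j < k" for j
    using sub[OF that] x(2) by blast
  moreover have "x ` block n i \<inter> x ` block n j = {}" if "i < k" "j < k" "i \<noteq> j" for i j
    using inj_on_image_Int[OF x(1) sub[OF that(1)] sub[OF that(2)]] block_disjoint[OF that(3), of n] by simp
  ultimately show ?thesis by (auto simp: disjoint_lists_def)
qed

lemma disjoint_lists_transitive:
  assumes "finite t" "a \<in> disjoint_lists n k t" "b \<in> disjoint_lists n k t"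
  shows "\<exists>\<pi>. \<pi> permutes t \<and> map ((`) \<pi>) a = b"
proof (rule permutation_mapping_disjoint_sets[OF assms(1)])
  show "card (a ! i) = card (b ! i)" if "i < length a" for i
    using assms(2,3) that nth_mem[of i a] nth_mem[of i b] by (simp add: disjoint_lists_def)
qed (use assms(2,3) in \<open>simp_all add: disjoint_lists_def\<close>)

lemma map_labellings_eq_disjoint_lists:
  assumes "finite t" "card t = N" "k * n \<le> N"
  shows "map_pmf (\<lambda>x. map (\<lambda>j. x ` block n j) [0..<k]) (pmf_of_set (labellings N t)) =
    pmf_of_set (disjoint_lists n k t)"
proof (rule pmf_eq_pmf_of_set_if_transitive)
  let ?p = "map_pmf (\<lambda>x. map (\<lambda>j. x ` block n j) [0..<k]) (pmf_of_set (labellings N t))"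
  note L = finite_labellings[OF assms(1), of N] labellings_nonempty[OF assms(1,2)]
  show "finite (disjoint_lists n k t)" by (rule finite_disjoint_lists[OF assms(1)])
  show sub: "set_pmf ?p \<subseteq> disjoint_lists n k t"
    using blocks_in_disjoint_lists[OF _ assms(3)] L by auto
  then show "disjoint_lists n k t \<noteq> {}" using set_pmf_not_empty[of ?p] by blast
  fix a b assume "a \<in> disjoint_lists n k t" "b \<in> disjoint_lists n k t"
  then obtain \<pi> where \<pi>: "\<pi> permutes t" "map ((`) \<pi>) a = b"
    using disjoint_lists_transitive[OF assms(1)] by blast
  have "map_pmf (map ((`) \<pi>)) ?p = map_pmf (\<lambda>x. map (\<lambda>j. x ` block n j) [0..<k])
      (map_pmf (\<lambda>x i. if i < N then \<pi> (x i) else x i) (pmf_of_set (labellings N t)))"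
    unfolding pmf.map_comp
  proof (rule pmf.map_cong[OF refl])
    fix x
    have "\<pi> ` x ` block n j = (\<lambda>i. if i < N then \<pi> (x i) else x i) ` block n j" if "j < k" for j
    proof -
      have "(j + 1) * n \<le> k * n" using that by (intro mult_right_mono) auto
      then have "block n j \<subseteq> {..<N}" using assms(3) by (intro block_subset) simp
      then show ?thesis unfolding image_image by (intro image_cong) auto
    qed
    then show "(map ((`) \<pi>) \<circ> (\<lambda>x. map (\<lambda>j. x ` block n j) [0..<k])) x =
        ((\<lambda>x. map (\<lambda>j. x ` block n j) [0..<k]) \<circ> (\<lambda>x i. if i < N then \<pi> (x i) else x i)) x"
      by simp
  qed
  also have "\<dots> = ?p" using map_permutation_labellings[OF assms(1,2) \<pi>(1)] by simp
  finally show "\<exists>\<phi>. inj \<phi> \<and> map_pmf \<phi> ?p = ?p \<and> \<phi> a = b"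
    using \<pi> by (intro exI[of _ "map ((`) \<pi>)"]) (auto intro: permutes_inj inj_mapI inj_image_set)
qed

lemma disjoint_families:
  assumes "finite t" "card t = N" "q * n \<le> N" "1 \<le> n"
  shows "finite (disjoint_families n q t)" "disjoint_families n q t \<noteq> {}"
proof -
  have "disjoint_families n q t \<subseteq> Pow (Pow t)" by (auto simp: disjoint_families_def)
  then show "finite (disjoint_families n q t)" using assms(1) by (meson finite_Pow_iff finite_subset)
  obtain x where "x \<in> labellings N t" using labellings_nonempty[OF assms(1,2)] by auto
  then have "disjoint_lists n q t \<noteq> {}" using blocks_in_disjoint_lists[OF _ assms(3)] by blast
  then obtain l where "l \<in> disjoint_lists n q t" by blast
  then have l: "length l = q" "\<forall>s\<in>set l. s \<subseteq> t \<and> card s = n"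
      "\<forall>i<q. \<forall>j<q. i \<noteq> j \<longrightarrow> l ! i \<inter> l ! j = {}"
    unfolding disjoint_lists_def by blast+
  have "distinct l"
    unfolding distinct_conv_nth
  proof (intro allI impI)
    fix i j assume ij: "i < length l" "j < length l" "i \<noteq> j"
    then have "l ! i \<inter> l ! j = {}" "card (l ! i) = n" using l by auto
    then show "l ! i \<noteq> l ! j" using assms(4) by auto
  qed
  then have "card (set l) = q" using distinct_card l(1) by fastforce
  moreover have "disjoint (set l)"
    unfolding disjoint_def
  proof (intro ballI impI)
    fix a b assume ab: "a \<in> set l" "b \<in> set l" "a \<noteq> b"
    then obtain i j where "i < q" "a = l ! i" "j < q" "b = l ! j"
      using l(1) by (auto simp: in_set_conv_nth)
    then show "a \<inter> b = {}" using l(3) ab(3) by blast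
  qed
  ultimately have "set l \<in> disjoint_families n q t" using l(2) by (simp add: disjoint_families_def)
  then show "disjoint_families n q t \<noteq> {}" by auto
qed

text \<open>The law of the sampled family is invariant under permutations of \<open>t\<close>, and
  these act transitively on lists of \<open>k\<close> disjoint sets. This spares counting the ways
  to complete such a list to a family of \<open>q\<close> sets.\<close>

lemma sample_family_then_list:
  assumes t: "finite t" "card t = N" and q: "k \<le> q" "q * n \<le> N" "1 \<le> n"
  shows "bind_pmf (pmf_of_set (disjoint_families n q t)) (\<lambda>S. pmf_of_set (distinct_lists k S)) =
    pmf_of_set (disjoint_lists n k t)"
proof (rule pmf_eq_pmf_of_set_if_transitive)
  let ?p = "bind_pmf (pmf_of_set (disjoint_families n q t)) (\<lambda>S. pmf_of_set (distinct_lists k S))"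
  note D = disjoint_families[OF t q(2,3)]
  have fam: "finite S \<and> k \<le> card S" if "S \<in> disjoint_families n q t" for S
  proof -
    have "S \<subseteq> Pow t" using that by (auto simp: disjoint_families_def)
    then have "finite S" using t(1) finite_subset by auto
    then show ?thesis using that q(1) by (simp add: disjoint_families_def)
  qed
  show "finite (disjoint_lists n k t)" by (rule finite_disjoint_lists[OF t(1)])
  show sub: "set_pmf ?p \<subseteq> disjoint_lists n k t"
  proof
    fix l assume "l \<in> set_pmf ?p"
    then obtain S where S: "S \<in> set_pmf (pmf_of_set (disjoint_families n q t))"
        "l \<in> set_pmf (pmf_of_set (distinct_lists k S))"
      by (auto simp only: set_bind_pmf)
    have S': "S \<in> disjoint_families n q t" using S(1) D by simp
    then have l: "distinct l" "length l = k" "set l \<subseteq> S"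
      using S(2) distinct_lists[of S k] fam[OF S'] by (auto simp: distinct_lists_def)
    show "l \<in> disjoint_lists n k t"
      unfolding disjoint_lists_def
    proof (intro CollectI conjI allI impI ballI l(2))
      fix i j assume ij: "i < k" "j < k" "i \<noteq> j"
      then have "l ! i \<noteq> l ! j" "l ! i \<in> S" "l ! j \<in> S"
        using l nth_eq_iff_index_eq by auto
      then show "l ! i \<inter> l ! j = {}" using S' by (auto simp: disjoint_families_def disjoint_def)
    qed (use l(3) S' in \<open>auto simp: disjoint_families_def\<close>)
  qed
  then show "disjoint_lists n k t \<noteq> {}" using set_pmf_not_empty[of ?p] by blast
  fix a b assume "a \<in> disjoint_lists n k t" "b \<in> disjoint_lists n k t"
  then obtain \<pi> where \<pi>: "\<pi> permutes t" "map ((`) \<pi>) a = b"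
    using disjoint_lists_transitive[OF t(1)] by blast
  have inj: "inj ((`) \<pi>)" using permutes_inj[OF \<pi>(1)] by (rule inj_image_set)
  have 1: "map_pmf ((`) ((`) \<pi>)) (pmf_of_set (disjoint_families n q t)) = pmf_of_set (disjoint_families n q t)"
  proof (rule map_permutation_pmf_of_subsets[OF \<pi>(1) t(1) D(2,1), where f = "\<lambda>\<sigma>. (`) ((`) \<sigma>)"])
    fix S and \<sigma> :: "'a \<Rightarrow> 'a" assume \<sigma>: "\<sigma> permutes t"
    show "(`) \<sigma> ` ((`) (inv_into UNIV \<sigma>) ` S) = S"
      using permutes_inverses[OF \<sigma>] by (simp add: image_image)
    assume S: "S \<in> disjoint_families n q t"
    have i\<sigma>: "inj \<sigma>" by (rule permutes_inj[OF \<sigma>])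
    have "card ((`) \<sigma> ` S) = q"
      using S card_image[OF inj_on_subset[OF inj_image_set[OF i\<sigma>] subset_UNIV]] by (simp add: disjoint_families_def)
    moreover have "disjoint ((`) \<sigma> ` S)"
      unfolding disjoint_def
    proof (intro ballI impI)
      fix a b assume ab: "a \<in> (`) \<sigma> ` S" "b \<in> (`) \<sigma> ` S" "a \<noteq> b"
      then obtain a' b' where a'b': "a' \<in> S" "b' \<in> S" "a = \<sigma> ` a'" "b = \<sigma> ` b'" by auto
      then have "a' \<noteq> b'" using ab(3) by auto
      moreover have "disjoint S" using S by (simp add: disjoint_families_def)
      ultimately have "a' \<inter> b' = {}" using disjointD a'b'(1,2) by metis
      then show "a \<inter> b = {}" unfolding a'b' image_Int[OF i\<sigma>, symmetric] by simp
    qed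
    moreover have "\<forall>s\<in>(`) \<sigma> ` S. s \<subseteq> t \<and> card s = n"
      using S permutes_in_image[OF \<sigma>] card_image[OF inj_on_subset[OF i\<sigma> subset_UNIV]]
      by (auto simp: disjoint_families_def)
    ultimately show "(`) \<sigma> ` S \<in> disjoint_families n q t" by (simp add: disjoint_families_def)
  qed
  have "map_pmf (map ((`) \<pi>)) ?p =
      bind_pmf (pmf_of_set (disjoint_families n q t)) (\<lambda>S. pmf_of_set (distinct_lists k ((`) \<pi> ` S)))"
    unfolding map_bind_pmf
    by (rule bind_pmf_cong[OF refl], rule map_permutation_distinct_lists[OF inj]) (use fam D in auto)
  also have "\<dots> = bind_pmf (map_pmf ((`) ((`) \<pi>)) (pmf_of_set (disjoint_families n q t))) (\<lambda>S. pmf_of_set (distinct_lists k S))"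
    by (simp add: bind_map_pmf)
  finally have "map_pmf (map ((`) \<pi>)) ?p = ?p" unfolding 1 .
  then show "\<exists>\<phi>. inj \<phi> \<and> map_pmf \<phi> ?p = ?p \<and> \<phi> a = b"
    using \<pi>(2) inj by (intro exI[of _ "map ((`) \<pi>)"]) (auto intro: inj_mapI)
qed

text \<open>For \<open>i = 1\<close> and \<open>i = 2\<close> this turns distance and weight in the
  faces complex into probabilities over labellings. The hypothesis says that \<open>i + 1\<close>
  blocks fit into a top face.\<close>

lemma (in random_labelling) ordered_face_pmf_faces_complex:
  assumes "(i + 1) * (r + 1) \<le> d + 1"
  shows "ordered_face_pmf i (faces_complex_pmf d r \<mu>) =
    map_pmf (\<lambda>x. map (\<lambda>j. x ` block (r + 1) j) [0..<i + 1]) P"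
proof -
  define q where "q = (d + 1) div (r + 1)"
  have q: "i + 1 \<le> q" "q * (r + 1) \<le> d + 1"
    using assms by (simp_all only: q_def less_eq_div_iff_mult_less_eq zero_less_Suc Suc_eq_plus1[symmetric] div_times_less_eq_dividend)
  have fc: "faces_complex_pmf d r \<mu> = bind_pmf \<mu> (\<lambda>t. pmf_of_set (disjoint_families (r + 1) q t))"
    by (simp add: faces_complex_pmf_def disjoint_families_def q_def)
  have fam: "finite S \<and> i + 1 \<le> card S" if S: "S \<in> set_pmf (faces_complex_pmf d r \<mu>)" for S
  proof -
    obtain t where t: "t \<in> set_pmf \<mu>" "S \<in> set_pmf (pmf_of_set (disjoint_families (r + 1) q t))"
      using S unfolding fc set_bind_pmf by (elim UN_E)
    then have "S \<in> disjoint_families (r + 1) q t"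
      using disjoint_families[of t "d + 1" q "r + 1"] top[OF t(1)] q(2) by auto
    then have "S \<subseteq> Pow t" "card S = q" by (auto simp: disjoint_families_def)
    then show ?thesis using top[OF t(1)] q(1) finite_subset[of S "Pow t"] by simp
  qed
  have "ordered_face_pmf i (faces_complex_pmf d r \<mu>) =
      bind_pmf \<mu> (\<lambda>t. bind_pmf (pmf_of_set (disjoint_families (r + 1) q t)) (\<lambda>S. pmf_of_set (distinct_lists (i + 1) S)))"
    by (simp only: ordered_face_pmf_eq_distinct_lists[OF fam]) (simp only: fc bind_assoc_pmf)
  also have "\<dots> = bind_pmf \<mu> (\<lambda>t. pmf_of_set (disjoint_lists (r + 1) (i + 1) t))"
    by (rule bind_pmf_cong[OF refl], rule sample_family_then_list[where N = "d + 1"]) (use top q in auto)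
  also have "\<dots> = map_pmf (\<lambda>x. map (\<lambda>j. x ` block (r + 1) j) [0..<i + 1]) P"
    unfolding P_def labelling_pmf_def map_bind_pmf
    by (rule bind_pmf_cong[OF refl], rule map_labellings_eq_disjoint_lists[symmetric]) (use top assms in auto)
  finally show ?thesis .
qed

section \<open>Coboundary expansion of the faces complex\<close>

context coboundary_labelling
begin

lemma faces_complex_edge:
  assumes "x \<in> set_pmf P" "card S = r + 1" "card T = r + 1" "S \<inter> T = {}" "S \<union> T \<subseteq> {..<d + 1}"
  shows "x ` S \<noteq> x ` T" "{x ` S, x ` T} \<in> faces_complex r X"
proof -
  have dis: "x ` S \<inter> x ` T = {}"
    using inj_on_image_Int[OF P_inj[OF assms(1)], of S T] assms(4,5) by auto
  have "S \<noteq> {}" using assms(2) by auto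
  then show "x ` S \<noteq> x ` T" using dis by auto
  have "x ` S \<union> x ` T \<in> X"
    using P_image[OF assms(1,5)] by (simp add: image_Un)
  moreover have "x ` S \<in> faces X (int r)" "x ` T \<in> faces X (int r)"
    using P_image[OF assms(1)] card_image_P[OF assms(1)] assms(2,3,5) by (auto simp: faces_def)
  ultimately show "{x ` S, x ` T} \<in> faces_complex r X"
    using dis by (auto simp: faces_complex_def disjoint_def)
qed

theorem faces_complex_coboundary_expander_over:
  "coboundary_expander_over G (faces_complex r X) (faces_complex_pmf d r \<mu>) ((\<beta> / 1231713) ^ (r + 1))"
  unfolding coboundary_expander_over_def
proof
  fix f assume f: "f \<in> cochains1 (faces_complex r X) G"
  \<comment> \<open>Extending by the identity off the edges makes the cochain antisymmetric on all
    pairs; on sampled edges nothing changes.\<close>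
  define f0 where "f0 s t = (if s \<noteq> t \<and> {s, t} \<in> faces_complex r X then f s t else \<one>)" for s t
  have f0: "antisymmetric f0"
    unfolding antisymmetric_def
  proof (intro allI)
    fix s t
    show "f0 s t \<in> carrier G \<and> f0 s t = inv f0 t s"
    proof (cases "s \<noteq> t \<and> {s, t} \<in> faces_complex r X")
      case True
      then have "f s t \<in> carrier G \<and> f s t = inv f t s" using f unfolding cochains1_def by blast
      moreover have "f0 s t = f s t" "f0 t s = f t s"
        using True by (auto simp: f0_def insert_commute)
      ultimately show ?thesis by metis
    next
      case False
      then have "f0 s t = \<one>" "f0 t s = \<one>" by (auto simp: f0_def insert_commute)
      then show ?thesis by simp
    qed
  qed
  let ?B = "\<lambda>j. block (r + 1) j"
  have B: "?B j \<subseteq> {..<d + 1}" if "j < 3" for j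
  proof (rule block_subset)
    have "(j + 1) * (r + 1) \<le> 3 * (r + 1)" using that by (intro mult_right_mono) auto
    then show "(j + 1) * (r + 1) \<le> d + 1" using r by simp
  qed
  have edge: "f (x ` S) (x ` T) = f0 (x ` S) (x ` T)"
    if "x \<in> set_pmf P" "card S = r + 1" "card T = r + 1" "S \<inter> T = {}" "S \<union> T \<subseteq> {..<d + 1}" for x S T
    using faces_complex_edge[OF that] by (simp add: f0_def)
  have Bd: "?B i \<inter> ?B j = {}" if "i \<noteq> j" for i j
    using that by (rule block_disjoint)
  have dist: "cochain_dist (faces_complex_pmf d r \<mu>) f (coboundary0 G h) =
      pr (\<lambda>x. f0 (x ` ?B 0) (x ` ?B 1) \<noteq> h (x ` ?B 0) \<otimes> inv h (x ` ?B 1))" for h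
  proof -
    have "cochain_dist (faces_complex_pmf d r \<mu>) f (coboundary0 G h) =
        pr (\<lambda>x. f (x ` ?B 0) (x ` ?B 1) \<noteq> coboundary0 G h (x ` ?B 0) (x ` ?B 1))"
      unfolding cochain_dist_def using r
      by (subst ordered_face_pmf_faces_complex) (simp_all add: vimage_def upt_rec)
    also have "\<dots> = pr (\<lambda>x. f0 (x ` ?B 0) (x ` ?B 1) \<noteq> h (x ` ?B 0) \<otimes> inv h (x ` ?B 1))"
      using edge[of _ "?B 0" "?B 1"] Bd[of 0 1] B[of 0] B[of 1]
      by (intro pr_cong) (simp add: coboundary0_def)
    finally show ?thesis .
  qed
  have weight: "coboundary1_weight (faces_complex_pmf d r \<mu>) G f =
      pr (\<lambda>x. \<not> flat f0 (x ` ?B 0) (x ` ?B 1) (x ` ?B 2))"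
  proof -
    have "coboundary1_weight (faces_complex_pmf d r \<mu>) G f =
        pr (\<lambda>x. coboundary1 G f (x ` ?B 0) (x ` ?B 1) (x ` ?B 2) \<noteq> \<one>)"
      unfolding coboundary1_weight_def using r
      by (subst ordered_face_pmf_faces_complex) (simp_all add: vimage_def upt_rec numeral_2_eq_2)
    also have "\<dots> = pr (\<lambda>x. \<not> flat f0 (x ` ?B 0) (x ` ?B 1) (x ` ?B 2))"
    proof (rule pr_cong)
      fix x assume x: "x \<in> set_pmf P"
      have "f (x ` ?B i) (x ` ?B j) = f0 (x ` ?B i) (x ` ?B j)" if "i \<noteq> j" "i < 3" "j < 3" for i j
        using edge[OF x, of "?B i" "?B j"] Bd[OF that(1)] B that by auto
      then have "coboundary1 G f (x ` ?B 0) (x ` ?B 1) (x ` ?B 2) =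
          coboundary1 G f0 (x ` ?B 0) (x ` ?B 1) (x ` ?B 2)"
        by (simp add: coboundary1_def)
      then show "(coboundary1 G f (x ` ?B 0) (x ` ?B 1) (x ` ?B 2) \<noteq> \<one>) =
          (\<not> flat f0 (x ` ?B 0) (x ` ?B 1) (x ` ?B 2))"
        using flat_iff_coboundary1[of f0] antisymmetricD[OF f0] by simp
    qed
    finally show ?thesis .
  qed
  define e where "e = coboundary1_weight (faces_complex_pmf d r \<mu>) G f"
  \<comment> \<open>The weight concerns the first three blocks; a permutation of the labels carries
    them to any three disjoint index sets of the same size.\<close>
  have flat: "pr (\<lambda>x. \<not> flat f0 (x ` S) (x ` T) (x ` U)) \<le> e"
    if S: "card S = r + 1" "card T = r + 1" "card U = r + 1" "S \<inter> T = {}" "S \<inter> U = {}" "T \<inter> U = {}"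
      "S \<union> T \<union> U \<subseteq> {..<d + 1}" for S T U
  proof -
    have "\<exists>\<pi>. \<pi> permutes {..<d + 1} \<and> map ((`) \<pi>) [?B 0, ?B 1, ?B 2] = [S, T, U]"
    proof (rule disjoint_lists_transitive[where n = "r + 1" and k = 3])
      have three: "i < 3 \<Longrightarrow> i = 0 \<or> i = 1 \<or> i = 2" for i :: nat by auto
      have nth: "[?B 0, ?B 1, ?B 2] ! i = ?B i" if "i < 3" for i using three[OF that] by auto
      show "[?B 0, ?B 1, ?B 2] \<in> disjoint_lists (r + 1) 3 {..<d + 1}"
        unfolding disjoint_lists_def
      proof (intro CollectI conjI allI impI ballI)
        fix s assume "s \<in> set [?B 0, ?B 1, ?B 2]"
        then have "s = ?B 0 \<or> s = ?B 1 \<or> s = ?B 2" by auto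
        then show "s \<subseteq> {..<d + 1}" "card s = r + 1" using B[of 0] B[of 1] B[of 2] by auto
      next
        fix i j :: nat assume ij: "i < 3" "j < 3" "i \<noteq> j"
        show "[?B 0, ?B 1, ?B 2] ! i \<inter> [?B 0, ?B 1, ?B 2] ! j = {}"
          unfolding nth[OF ij(1)] nth[OF ij(2)] by (rule Bd[OF ij(3)])
      qed simp
      show "[S, T, U] \<in> disjoint_lists (r + 1) 3 {..<d + 1}"
        using S unfolding disjoint_lists_def by (auto dest!: three)
    qed simp
    then obtain \<pi> where \<pi>: "\<pi> permutes {..<d + 1}" "\<pi> ` ?B 0 = S" "\<pi> ` ?B 1 = T" "\<pi> ` ?B 2 = U"
      by auto
    have "pr (\<lambda>x. \<not> flat f0 ((x \<circ> \<pi>) ` ?B 0) ((x \<circ> \<pi>) ` ?B 1) ((x \<circ> \<pi>) ` ?B 2)) = e"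
      unfolding e_def weight by (rule pr_permute[OF \<pi>(1)])
    then show ?thesis by (simp only: image_comp[symmetric] \<pi>(2-4))
  qed
  have "0 \<le> e" by (simp add: e_def coboundary1_weight_def)
  have "\<exists>h. (\<forall>s. h s \<in> carrier G) \<and> (\<forall>S T. card S = r + 1 \<longrightarrow> card T = r + 1 \<longrightarrow> S \<inter> T = {} \<longrightarrow>
    S \<union> T \<subseteq> {..<d + 1} \<longrightarrow>
    pr (\<lambda>x. f0 (x ` S) (x ` T) \<noteq> h (x ` S) \<otimes> inv h (x ` T)) \<le> (1231713 / \<beta>) ^ (r + 1) * e)"
    by (rule disjoint_cocycle_is_coboundary[OF f0 \<open>0 \<le> e\<close>]) (rule flat)
  then obtain h where hc: "\<forall>s. h s \<in> carrier G" and h: "\<forall>S T. card S = r + 1 \<longrightarrow> card T = r + 1 \<longrightarrow> S \<inter> T = {} \<longrightarrow>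
    S \<union> T \<subseteq> {..<d + 1} \<longrightarrow>
    pr (\<lambda>x. f0 (x ` S) (x ` T) \<noteq> h (x ` S) \<otimes> inv h (x ` T)) \<le> (1231713 / \<beta>) ^ (r + 1) * e"
    by (elim exE conjE) (rule that; assumption)
  have "cochain_dist (faces_complex_pmf d r \<mu>) f (coboundary0 G h) \<le> (1231713 / \<beta>) ^ (r + 1) * e"
    unfolding dist by (rule h[rule_format]) (use B[of 0] B[of 1] Bd[of 0 1] in auto)
  then have "(\<beta> / 1231713) ^ (r + 1) * cochain_dist (faces_complex_pmf d r \<mu>) f (coboundary0 G h) \<le>
      (\<beta> / 1231713) ^ (r + 1) * ((1231713 / \<beta>) ^ (r + 1) * e)"
    using \<beta> by (intro mult_left_mono) auto
  also have "\<dots> = ((\<beta> / 1231713) * (1231713 / \<beta>)) ^ (r + 1) * e"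
    by (simp only: power_mult_distrib mult.assoc)
  also have "(\<beta> / 1231713) * (1231713 / \<beta>) = 1" using \<beta> by simp
  finally show "\<exists>g\<in>cochains0 (faces_complex r X) G.
      (\<beta> / 1231713) ^ (r + 1) * cochain_dist (faces_complex_pmf d r \<mu>) f (coboundary0 G g) \<le>
      coboundary1_weight (faces_complex_pmf d r \<mu>) G f"
    using hc by (intro bexI[of _ h]) (auto simp: e_def cochains0_def)
qed

end

section \<open>Absorbing the numerical constants\<close>

lemma coboundary_expander_over_mono:
  assumes "coboundary_expander_over G X \<mu> \<beta>" "\<beta>' \<le> \<beta>"
  shows "coboundary_expander_over G X \<mu> \<beta>'"
  unfolding coboundary_expander_over_def
proof
  fix f assume "f \<in> cochains1 X G"
  then obtain g where g: "g \<in> cochains0 X G"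
      "\<beta> * cochain_dist \<mu> f (coboundary0 G g) \<le> coboundary1_weight \<mu> G f"
    using assms(1) by (auto simp: coboundary_expander_over_def)
  have "\<beta>' * cochain_dist \<mu> f (coboundary0 G g) \<le> \<beta> * cochain_dist \<mu> f (coboundary0 G g)"
    using assms(2) by (rule mult_right_mono) (simp add: cochain_dist_def)
  then show "\<exists>g\<in>cochains0 X G. \<beta>' * cochain_dist \<mu> f (coboundary0 G g) \<le> coboundary1_weight \<mu> G f"
    using g by (intro bexI[of _ g]) auto
qed

theorem mainTheorem3:
  shows "\<exists>K::real. K > 0 \<and>
    (\<forall>(d::nat) (r::nat) (X :: 'a set set) (\<mu> :: 'a set pmf) (\<beta>::real) (lam::real).
       weighted_complex d X \<mu> \<longrightarrow>
       1 \<le> r \<longrightarrow>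
       7 * r + 7 \<le> d \<longrightarrow>
       0 < \<beta> \<longrightarrow>
       (\<forall>m\<in>{-1..int r}. \<forall>s\<in>faces X m.
          coboundary_expander (link_faces X s) (link_pmf \<mu> s) \<beta>) \<longrightarrow>
       two_sided_local_spectral_expander d X \<mu> lam \<longrightarrow>
       lam < 1 / (2 * (real r)\<^sup>2) \<longrightarrow>
       swap_coboundary_expander r d X \<mu> (min \<beta> (1 / 2) powr (K * real r)))"
proof (intro exI[of _ 44] conjI allI impI)
  fix d r :: nat and X :: "'a set set" and \<mu> :: "'a set pmf" and \<beta> lam :: real
  assume W: "weighted_complex d X \<mu>" and r: "1 \<le> r" "7 * r + 7 \<le> d" and \<beta>: "0 < \<beta>"
    and links: "\<forall>m\<in>{-1..int r}. \<forall>s\<in>faces X m. coboundary_expander (link_faces X s) (link_pmf \<mu> s) \<beta>"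
    and spec: "two_sided_local_spectral_expander d X \<mu> lam" and lam: "lam < 1 / (2 * (real r)\<^sup>2)"
  \<comment> \<open>Powers of \<beta> cannot absorb a numerical constant when \<beta> is near 1 or
    larger, so the base is capped at 1/2.\<close>
  define b where "b = min \<beta> (1 / 2)"
  have b: "0 < b" "b \<le> 1 / 2" "b \<le> \<beta>" using \<beta> by (auto simp: b_def)
  have "1 \<le> (real r)\<^sup>2" using r(1) by (intro one_le_power) simp
  then have "1 / (2 * (real r)\<^sup>2) \<le> 1 / 2" by (intro frac_le) auto
  then have lam2: "lam \<le> 1 / 2" using lam by linarith
  \<comment> \<open>1231713 is below \<open>2 ^ 21\<close>, so \<open>b ^ 21\<close> absorbs it and
    one more factor \<open>b\<close> is left for the numerator. As \<open>1 \<le> r\<close>, the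
    exponent \<open>22 * (r + 1)\<close> is at most \<open>44 * r\<close>.\<close>
  have small: "b powr (44 * real r) \<le> (b / 1231713) ^ (r + 1)"
  proof -
    have "b powr (44 * real r) = b powr real (44 * r)" by simp
    also have "\<dots> = b ^ (44 * r)" using b(1) by (rule powr_realpow)
    also have "\<dots> \<le> b ^ (22 * (r + 1))"
      by (rule power_decreasing) (use r(1) b in auto)
    also have "\<dots> = (b ^ 21 * b) ^ (r + 1)"
      by (simp only: power_mult[symmetric] power_Suc2[symmetric]) simp
    also have "\<dots> \<le> ((1 / 1231713) * b) ^ (r + 1)"
    proof (intro power_mono mult_right_mono)
      have "b ^ 21 \<le> (1 / 2) ^ 21" by (rule power_mono) (use b in auto)
      also have "\<dots> \<le> 1 / 1231713" by (simp add: power_divide)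
      finally show "b ^ 21 \<le> 1 / 1231713" .
    qed (use b in auto)
    finally show ?thesis by simp
  qed
  show "swap_coboundary_expander r d X \<mu> (min \<beta> (1 / 2) powr (44 * real r))"
    unfolding swap_coboundary_expander_def coboundary_expander_def b_def[symmetric]
  proof (intro allI impI)
    fix G :: "nat monoid" assume G: "group G"
    interpret group G by (rule G)
    interpret coboundary_labelling d X \<mu> lam G r b
    proof unfold_locales
      fix A assume A: "A \<in> X" "card A \<le> r + 1"
      have "A \<in> faces X (int (card A) - 1)" "int (card A) - 1 \<in> {-1..int r}"
        using A by (auto simp: faces_def)
      then have "coboundary_expander_over G (link_faces X A) (link_pmf \<mu> A) \<beta>"
        using links G unfolding coboundary_expander_def by blast
      then show "coboundary_expander_over G (link_faces X A) (link_pmf \<mu> A) b"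
        using b(3) by (rule coboundary_expander_over_mono)
    qed (use W spec lam2 b r in auto)
    show "coboundary_expander_over G (faces_complex r X) (faces_complex_pmf d r \<mu>) (b powr (44 * real r))"
      using faces_complex_coboundary_expander_over small by (rule coboundary_expander_over_mono)
  qed
qed simp

end
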